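(* Let $N\geq 2$ and $s\in(0,1)$. For $R>0$ let $A_R:=\{x\in\mathbb{R}^N: R<|x|<R+1\}$. There is $R_0>0$ such that for any $R\geq R_0$, any second eigenfunction corresponding to $\lambda_{2,s}(A_R)$ is nonradial.
   Context: For $N\ge 1$ and $s\in(0,1)$, the fractional Laplacian $(-\Delta)^s$ is defined for $\phi\in C_c^\infty(\mathbb{R}^N)$ by $(-\Delta)^s\phi(x)=\frac{b_{N,s}}{2}\int_{\mathbb{R}^N}\frac{2\phi(x)-\phi(x+y)-\phi(x-y)}{|y|^{N+2s}}\,dy$, with $b_{N,s}=\frac{s4^s\Gamma(\frac N2+s)}{\pi^{N/2}\Gamma(1-s)}$, and $\mathcal{E}_s(\phi,\psi)=\frac{b_{N,s}}{2}\int_{\mathbb{R}^{2N}}\frac{(\phi(x)-\phi(y))(\psi(x)-\psi(y))}{|x-y|^{N+2s}}\,dx\,dy$. For a bounded open set $\Omega\subset\mathbb{R}^N$, $\mathcal{H}^s_0(\Omega)$ is the completion of $C_c^\infty(\Omega)$ with respect to the norm $\mathcal{E}_s(\psi,\psi)^{1/2}$ (functions extended by $0$ outside $\Omega$). A function $\phi\in\mathcal{H}^s_0(\Omega)$ is a weak solution of $(-\Delta)^s\phi=\mu\phi$ in $\Omega$, $\phi=0$ in $\mathbb{R}^N\setminus\Omega$, if $\mathcal{E}_s(\phi,\psi)=\mu\int_\Omega\phi\psi\,dx$ for all $\psi\in\mathcal{H}^s_0(\Omega)$. The eigenvalues (those $\mu$ with a nontrivial weak solution), counted with multiplicity, are $0<\lambda_{1,s}(\Omega)<\lambda_{2,s}(\Omega)\le\lambda_{3,s}(\Omega)\le\dots\nearrow+\infty$.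 A second eigenfunction of $\Omega$ is a nontrivial weak solution with $\mu=\lambda_{2,s}(\Omega)$. A function is radial if it depends only on $|x|$ (a.e.), and nonradial otherwise. *)

theory Defs
  imports "HOL-Analysis.Analysis" "HOL-Library.Extended_Nat"
begin

text \<open>Functions on the whole space stand for their classes modulo equality almost everywhere;
  each class is represented by its Borel measurable members.\<close>

definition frac_const :: "nat \<Rightarrow> real \<Rightarrow> real" where
  "frac_const N s =
     s * 4 powr s * Gamma (real N / 2 + s) / (pi powr (real N / 2) * Gamma (1 - s))"

definition frac_integrand ::
    "real \<Rightarrow> ('a::euclidean_space \<Rightarrow> real) \<Rightarrow> ('a \<Rightarrow> real) \<Rightarrow> 'a \<times> 'a \<Rightarrow> real" where
  "frac_integrand s u v = (\<lambda>(x, y).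
     (u x - u y) * (v x - v y) / norm (x - y) powr (real DIM('a) + 2 * s))"

definition frac_form ::
    "real \<Rightarrow> ('a::euclidean_space \<Rightarrow> real) \<Rightarrow> ('a \<Rightarrow> real) \<Rightarrow> real" where
  "frac_form s u v = frac_const DIM('a) s / 2 * (LINT p|lborel. frac_integrand s u v p)"

primrec C_order :: "nat \<Rightarrow> ('a::euclidean_space \<Rightarrow> real) \<Rightarrow> bool" where
  "C_order 0 f \<longleftrightarrow> continuous_on UNIV f"
| "C_order (Suc k) f \<longleftrightarrow> (\<forall>x. f differentiable (at x)) \<and>
     (\<forall>b\<in>Basis. C_order k (\<lambda>x. frechet_derivative f (at x) b))"

definition test_functions :: "'a::euclidean_space set \<Rightarrow> ('a \<Rightarrow> real) set" where
  "test_functions \<Omega> = {u. (\<forall>k. C_order k u) \<and>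
     compact (closure {x. u x \<noteq> 0}) \<and> closure {x. u x \<noteq> 0} \<subseteq> \<Omega>}"

text \<open>The completion of the test functions, realised as a space of functions. For bounded
  \<open>\<Omega>\<close> the energy norm controls the \<open>L\<^sup>2\<close> norm of functions vanishing outside \<open>\<Omega>\<close>,
  so a Cauchy sequence of test functions has exactly one limit of the following kind, up to null
  sets. Integrability is required explicitly because the Bochner integral of a non-integrable
  function is 0.\<close>

definition frac_sobolev0 :: "real \<Rightarrow> 'a::euclidean_space set \<Rightarrow> ('a \<Rightarrow> real) set" where
  "frac_sobolev0 s \<Omega> = {u. u \<in> borel_measurable borel \<and>
     (AE x in lborel. x \<notin> \<Omega> \<longrightarrow> u x = 0) \<and>
     (\<exists>v. (\<forall>k. v k \<in> test_functions \<Omega> \<and>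
             integrable lborel (frac_integrand s (\<lambda>x. v k x - u x) (\<lambda>x. v k x - u x))) \<and>
          (\<lambda>k::nat. frac_form s (\<lambda>x. v k x - u x) (\<lambda>x. v k x - u x)) \<longlonglongrightarrow> 0)}"

definition weak_solution ::
    "real \<Rightarrow> 'a::euclidean_space set \<Rightarrow> real \<Rightarrow> ('a \<Rightarrow> real) \<Rightarrow> bool" where
  "weak_solution s \<Omega> \<mu> u \<longleftrightarrow> u \<in> frac_sobolev0 s \<Omega> \<and>
     (\<forall>v\<in>frac_sobolev0 s \<Omega>. frac_form s u v = \<mu> * (LINT x:\<Omega>|lborel. u x * v x))"

definition nontrivial :: "('a::euclidean_space \<Rightarrow> real) \<Rightarrow> bool" where
  "nontrivial u \<longleftrightarrow> \<not> (AE x in lborel. u x = 0)"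

definition lin_indep_ae :: "nat \<Rightarrow> (nat \<Rightarrow> 'a::euclidean_space \<Rightarrow> real) \<Rightarrow> bool" where
  "lin_indep_ae m f \<longleftrightarrow>
     (\<forall>c. (AE x in lborel. (\<Sum>i<m. c i * f i x) = 0) \<longrightarrow> (\<forall>i<m. c i = 0))"

text \<open>The dimension of the space of weak solutions modulo null functions; it is 0 unless \<open>\<mu>\<close>
  is an eigenvalue.\<close>

definition multiplicity_ev :: "real \<Rightarrow> 'a::euclidean_space set \<Rightarrow> real \<Rightarrow> enat" where
  "multiplicity_ev s \<Omega> \<mu> =
     (SUP m\<in>{m. \<exists>f. (\<forall>i<m. weak_solution s \<Omega> \<mu> (f i)) \<and> lin_indep_ae m f}. enat m)"

definition is_eigenvalue :: "real \<Rightarrow> 'a::euclidean_space set \<Rightarrow> real \<Rightarrow> bool" where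
  "is_eigenvalue s \<Omega> \<mu> \<longleftrightarrow> (\<exists>u. weak_solution s \<Omega> \<mu> u \<and> nontrivial u)"

text \<open>The \<open>k\<close>-th eigenvalue (\<open>k \<ge> 1\<close>) is the smallest \<open>\<mu>\<close> such that at least \<open>k\<close> eigenvalues,
  counted with multiplicity, are at most \<open>\<mu>\<close>. Counting over finite sets of eigenvalues and in
  \<^typ>\<open>enat\<close> keeps the definition meaningful independently of the discreteness of the spectrum.\<close>

definition eigenvalue :: "nat \<Rightarrow> real \<Rightarrow> 'a::euclidean_space set \<Rightarrow> real" where
  "eigenvalue k s \<Omega> = Inf {\<mu>. \<exists>F. finite F \<and>
     (\<forall>\<nu>\<in>F. is_eigenvalue s \<Omega> \<nu> \<and> \<nu> \<le> \<mu>) \<and> enat k \<le> (\<Sum>\<nu>\<in>F. multiplicity_ev s \<Omega> \<nu>)}"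

definition second_eigenfunction ::
    "real \<Rightarrow> 'a::euclidean_space set \<Rightarrow> ('a \<Rightarrow> real) \<Rightarrow> bool" where
  "second_eigenfunction s \<Omega> u \<longleftrightarrow> weak_solution s \<Omega> (eigenvalue 2 s \<Omega>) u \<and> nontrivial u"

definition radial :: "('a::euclidean_space \<Rightarrow> real) \<Rightarrow> bool" where
  "radial u \<longleftrightarrow> (\<exists>g::real \<Rightarrow> real. AE x in lborel. u x = g (norm x))"

definition annulus :: "real \<Rightarrow> 'a::euclidean_space set" where
  "annulus R = {x. R < norm x \<and> norm x < R + 1}"

end

theory Submission imports Defs "HOL-Library.Diagonal_Subsequence" begin

text \<open>
  Let \<open>\<lambda>\<close> be the second eigenvalue of the annulus \<open>A\<^sub>R\<close> and suppose that it has a radial eigenfunction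
  \<open>u = p - q\<close> with \<open>p, q \<ge> 0\<close> and \<open>p q = 0\<close>. An odd function of Rayleigh quotient \<open>\<rho>\<close> yields an odd and
  an even eigenfunction with eigenvalues at most \<open>\<rho>\<close> (minimise over odd and over even functions; passing
  to \<open>\<bar>f\<bar>\<close> shows that the even minimum is not larger), so \<open>\<lambda> \<le> \<rho>\<close>.

  If \<open>u\<close> has one sign, minimising over the orthogonal complement of \<open>u\<close> shows that its
  eigenvalue is simple and strictly below all others, hence not the second one.
  If \<open>u\<close> changes sign, say with \<open>\<parallel>p\<parallel> \<le> \<parallel>q\<parallel>\<close>, test with the odd functions
  \<open>x\<^sub>i p\<close>. Summing over \<open>i\<close> and using the equation for \<open>u\<close>,
  \<open>\<integral>\<integral> (q(x) p(y) \<bar>y\<bar>\<^sup>2 + q(y) p(x) \<bar>x\<bar>\<^sup>2) K(x - y)\<close> is bounded by \<open>\<integral>\<integral> p(x) p(y) \<bar>x - y\<bar>\<^sup>2 K(x - y)\<close> with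
  \<open>K(z) = \<bar>z\<bar> powr (- N - 2 s)\<close>. The right-hand side is \<open>O(R powr (2 - 2 s)) \<parallel>p\<parallel>\<^sup>2\<close>, whereas the left-hand side
  is at least \<open>R\<^sup>2 \<integral>\<integral> (p(x) q(y) + p(y) q(x)) K(x - y) \<ge> c R\<^sup>2 \<parallel>p\<parallel>\<^sup>2\<close>. The last inequality holds because the energy of
  \<open>p\<close> is at most \<open>\<lambda> \<parallel>p\<parallel>\<^sup>2\<close>, with \<open>\<lambda>\<close> bounded independently of \<open>R\<close>, and likewise for \<open>q\<close>,
  so both interact with themselves at small distances, and by radial symmetry each has comparable mass
  near every point of the annulus.
  For large \<open>R\<close> this is a contradiction.
\<close>

section \<open>Integrals of powers of the norm\<close>

text \<open>The sign regions of \<open>u\<close> interact at every distance, and the proof turns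
  this interaction into the gain. Multiplying \<open>p\<close> by the coordinates puts the weight
  |y|^2, of size R^2 on the annulus, into the interaction with \<open>q\<close>, whereas the loss
  carries |x - y|^2. The integral of |z|^2 K(z) over a ball of radius 2 R + 2 grows only like R^(2 -
  2 s), and the missing factor R^(2 s) is the whole contradiction. Every other constant must
  therefore depend on the dimension and on \<open>s\<close> alone; for the eigenvalue bound this
  holds because a shell of width 1 contains a bump of fixed size. One obstacle remains in bounding
  the interaction from below: the ratio of the integrals of \<open>p\<close> and \<open>q\<close> is
  unknown. Each of the two functions gives an estimate containing this ratio, once directly and once
  inverted, and whichever is favourable bounds the smaller of the two L^2 norms. This is why the
  function of smaller norm is the one multiplied by coordinates. All eigenfunctions that are
  constructed come from constrained minimisation, and positivity of the kernel does the work of a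
  strong maximum principle.\<close>

lemma nn_integral_suminf_indicator:
  fixes c :: "nat \<Rightarrow> ennreal"
  assumes [measurable]: "\<And>k. A k \<in> sets M"
  shows "(\<integral>\<^sup>+z. (\<Sum>k. c k * indicator (A k) z) \<partial>M) = (\<Sum>k. c k * emeasure M (A k))"
  by (subst nn_integral_suminf) (measurable, simp add: nn_integral_cmult_indicator)

lemma ennreal_term_le_suminf: "f k \<le> (\<Sum>k. f k :: ennreal)"
  using sum_le_suminf[of f "{k}"] by simp

text \<open>Dyadic shells: where \<open>\<rho> / 2 ^ Suc k < norm z \<le> \<rho> / 2 ^ k\<close> the
  weight is at most its value at the inner radius, and the volumes shrink fast enough to leave a
  geometric series of ratio \<open>2 powr (a - N)\<close>, which is below 1 since
  \<open>a < N\<close>.\<close>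

lemma nn_integral_powr_cball:
  fixes a \<rho> :: real
  assumes a: "0 \<le> a" "a < real DIM('a)"
  shows "\<exists>C>0. \<forall>\<rho>>0. (\<integral>\<^sup>+z. ennreal (norm (z::'a::euclidean_space) powr (- a)) * indicator (cball 0 \<rho>) z \<partial>lborel)
    \<le> ennreal (C * \<rho> powr (real DIM('a) - a))"
proof -
  let ?N = "real DIM('a)" let ?w = "unit_ball_vol ?N"
  define C where "C = (\<Sum>k. ?w * 2 powr a * (2 powr (a - ?N)) ^ k)"
  have q: "2 powr (a - ?N) < 1" using a powr_less_mono[of "a - ?N" 0 2] by simp
  have sm: "summable (\<lambda>k. ?w * 2 powr a * (2 powr (a - ?N)) ^ k)"
    by (intro summable_mult summable_geometric) (use q in simp)
  have wpos: "0 < ?w" by simp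
  have Cpos: "0 < C" unfolding C_def
    by (rule suminf_pos[OF sm]) (use wpos in simp)
  have "(\<integral>\<^sup>+z. ennreal (norm (z::'a) powr (- a)) * indicator (cball 0 \<rho>) z \<partial>lborel)
    \<le> ennreal (C * \<rho> powr (?N - a))" if \<rho>: "\<rho> > 0" for \<rho>
  proof -
    let ?r = "\<lambda>k::nat. \<rho> / 2 ^ k"
    have "(\<integral>\<^sup>+z. ennreal (norm (z::'a) powr (- a)) * indicator (cball 0 \<rho>) z \<partial>lborel)
      \<le> (\<integral>\<^sup>+z. (\<Sum>k. ennreal (?r (Suc k) powr (- a)) * indicator (cball 0 (?r k)) (z::'a)) \<partial>lborel)"
    proof (rule nn_integral_mono)
      fix z :: 'a
      show "ennreal (norm z powr (- a)) * indicator (cball 0 \<rho>) z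
        \<le> (\<Sum>k. ennreal (?r (Suc k) powr (- a)) * indicator (cball 0 (?r k)) z)"
      proof (cases "0 < norm z \<and> norm z \<le> \<rho>")
        \<comment> \<open>\<open>0 powr x\<close> is 0, so the origin, where the weight should be
          infinite, contributes nothing.\<close>
        case False then show ?thesis by (auto simp: indicator_def)
      next
        case True
        obtain n where n: "?r n < norm z"
        proof -
          obtain n where "(1/2::real)^n < norm z / \<rho>"
            using real_arch_pow_inv[of "norm z / \<rho>" "1/2"] True \<rho> by auto
          then show ?thesis using that[of n] \<rho> by (simp add: field_simps power_divide)
        qed
        define m where "m = (LEAST n. ?r n < norm z)"
        have m: "?r m < norm z" unfolding m_def by (rule LeastI[of "\<lambda>n. ?r n < norm z", OF n])
        have "m \<noteq> 0" using m True by (cases m) auto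
        then obtain k where k: "m = Suc k" by (cases m) auto
        have "\<not> ?r k < norm z" using not_less_Least[of k "\<lambda>n. ?r n < norm z"] k m_def by simp
        then have kz: "norm z \<le> ?r k" by simp
        have "norm z powr (- a) \<le> ?r (Suc k) powr (- a)"
          using m k \<rho> a by (intro powr_mono2') auto
        then have "ennreal (norm z powr (- a)) * indicator (cball 0 \<rho>) z
           \<le> ennreal (?r (Suc k) powr (- a)) * indicator (cball 0 (?r k)) z"
          using kz by (auto simp: indicator_def intro!: ennreal_leI)
        also have "\<dots> \<le> (\<Sum>k. ennreal (?r (Suc k) powr (- a)) * indicator (cball 0 (?r k)) z)"
          by (rule ennreal_term_le_suminf[of "\<lambda>k. ennreal (?r (Suc k) powr (- a)) * indicator (cball 0 (?r k)) z" k])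
        finally show ?thesis .
      qed
    qed
    also have "\<dots> = (\<Sum>k. ennreal (?r (Suc k) powr (- a)) * emeasure lborel (cball (0::'a) (?r k)))"
      by (rule nn_integral_suminf_indicator) simp
    also have "\<dots> = (\<Sum>k. ennreal (?w * 2 powr a * (2 powr (a - ?N)) ^ k * \<rho> powr (?N - a)))"
    proof (rule suminf_cong)
      fix k
      have "?r (Suc k) powr (- a) * (?w * ?r k ^ DIM('a)) = ?w * 2 powr a * (2 powr (a - ?N)) ^ k * \<rho> powr (?N - a)"
      proof -
        have "?r (Suc k) powr (- a) = \<rho> powr (-a) * 2 powr (a * (real k + 1))"
        proof -
          have "(2::real) ^ Suc k = 2 powr (real k + 1)" by (metis of_nat_Suc powr_realpow add.commute zero_less_numeral)
          then have "?r (Suc k) powr (- a) = \<rho> powr (- a) / (2 powr (real k + 1)) powr (- a)"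
            using \<rho> by (simp only: powr_divide)
          moreover have "((2::real) powr (real k + 1)) powr (- a) = 2 powr (- (a * (real k + 1)))"
            by (simp only: powr_powr) (simp add: mult.commute)
          ultimately have "?r (Suc k) powr (- a) = \<rho> powr (- a) / 2 powr (- (a * (real k + 1)))"
            by (simp only:)
          also have "\<dots> = \<rho> powr (- a) * 2 powr (a * (real k + 1))"
            by (simp only: powr_minus[of 2] divide_inverse inverse_inverse_eq)
          finally show ?thesis .
        qed
        moreover have "?r k ^ DIM('a) = \<rho> powr ?N * 2 powr (- ?N * real k)"
        proof -
          have "?r k ^ DIM('a) = \<rho> ^ DIM('a) / 2 ^ (k * DIM('a))" by (simp add: power_divide power_mult)
          moreover have "(2::real) ^ (k * DIM('a)) = 2 powr (real k * ?N)" by (subst powr_realpow[symmetric]) auto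
          ultimately show ?thesis using \<rho> by (simp add: powr_realpow powr_minus divide_inverse mult.commute)
        qed
        moreover have "(2 powr (a - ?N)) ^ k = 2 powr ((a - ?N) * real k)"
          by (simp add: powr_realpow[symmetric] powr_powr)
        moreover have "2 powr (a * (real k + 1)) * 2 powr (- ?N * real k) = 2 powr a * (2::real) powr ((a - ?N) * real k)"
          unfolding powr_add[symmetric] by (simp add: algebra_simps)
        moreover have "\<rho> powr (?N - a) = \<rho> powr (- a) * \<rho> powr ?N"
          unfolding powr_add[symmetric] by simp
        ultimately show ?thesis by (simp only: mult_ac)
      qed
      then show "ennreal (?r (Suc k) powr (- a)) * emeasure lborel (cball (0::'a) (?r k))
        = ennreal (?w * 2 powr a * (2 powr (a - ?N)) ^ k * \<rho> powr (?N - a))"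
        using \<rho> by (subst emeasure_cball) (auto simp: ennreal_mult'[symmetric])
    qed
    also have "\<dots> = ennreal (C * \<rho> powr (?N - a))"
    proof -
      have "(\<lambda>k. ?w * 2 powr a * (2 powr (a - ?N)) ^ k * \<rho> powr (?N - a)) sums (C * \<rho> powr (?N - a))"
        unfolding C_def by (intro sums_mult2 summable_sums sm)
      then show ?thesis by (intro suminf_ennreal_eq) auto
    qed
    finally show ?thesis .
  qed
  then show ?thesis using Cpos by blast
qed

text \<open>The same series with shells growing outwards; its ratio is now
  \<open>2 powr (N - a)\<close>.\<close>

lemma nn_integral_powr_outside_ball:
  fixes a :: real
  assumes a: "a > real DIM('a)"
  shows "(\<integral>\<^sup>+z. ennreal (norm (z::'a::euclidean_space) powr (- a)) * indicator (- ball 0 1) z \<partial>lborel) < \<infinity>"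
proof -
  let ?N = "real DIM('a)" let ?w = "unit_ball_vol ?N"
  have q: "2 powr (?N - a) < 1" using a powr_less_mono[of "?N - a" 0 2] by simp
  have sm: "summable (\<lambda>k. ?w * 2 powr ?N * (2 powr (?N - a)) ^ k)"
    by (intro summable_mult summable_geometric) (use q in simp)
  have wpos: "0 < ?w" by simp
  have "(\<integral>\<^sup>+z. ennreal (norm (z::'a) powr (- a)) * indicator (- ball 0 1) z \<partial>lborel)
    \<le> (\<integral>\<^sup>+z. (\<Sum>k. ennreal ((2 ^ k) powr (- a)) * indicator (cball 0 (2 ^ Suc k)) (z::'a)) \<partial>lborel)"
  proof (rule nn_integral_mono)
    fix z :: 'a
    show "ennreal (norm z powr (- a)) * indicator (- ball 0 1) z
      \<le> (\<Sum>k. ennreal ((2 ^ k) powr (- a)) * indicator (cball 0 (2 ^ Suc k)) z)"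
    proof (cases "1 \<le> norm z")
      case False then show ?thesis by (auto simp: indicator_def)
    next
      case True
      obtain n where n: "norm z < 2 ^ n" using real_arch_pow[of 2 "norm z"] by auto
      define m where "m = (LEAST n. norm z < 2 ^ n)"
      have m: "norm z < 2 ^ m" unfolding m_def by (rule LeastI[of "\<lambda>n. norm z < 2 ^ n", OF n])
      have "m \<noteq> 0" using m True by (cases m) auto
      then obtain k where k: "m = Suc k" by (cases m) auto
      have "\<not> norm z < 2 ^ k" using not_less_Least[of k "\<lambda>n. norm z < 2 ^ n"] k m_def by simp
      then have kz: "2 ^ k \<le> norm z" by simp
      have "norm z powr (- a) \<le> (2 ^ k) powr (- a)"
        using kz a by (intro powr_mono2') auto
      then have "ennreal (norm z powr (- a)) * indicator (- ball 0 1) z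
         \<le> ennreal ((2 ^ k) powr (- a)) * indicator (cball 0 (2 ^ Suc k)) z"
        using m k by (auto simp: indicator_def intro!: ennreal_leI)
      also have "\<dots> \<le> (\<Sum>k. ennreal ((2 ^ k) powr (- a)) * indicator (cball 0 (2 ^ Suc k)) z)"
        by (rule ennreal_term_le_suminf[of "\<lambda>k. ennreal ((2 ^ k) powr (- a)) * indicator (cball 0 (2 ^ Suc k)) z" k])
      finally show ?thesis .
    qed
  qed
  also have "\<dots> = (\<Sum>k. ennreal ((2 ^ k) powr (- a)) * emeasure lborel (cball (0::'a) (2 ^ Suc k)))"
    by (rule nn_integral_suminf_indicator) simp
  also have "\<dots> = (\<Sum>k. ennreal (?w * 2 powr ?N * (2 powr (?N - a)) ^ k))"
  proof (rule suminf_cong)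
    fix k
    have "(2 ^ k) powr (- a) * (?w * (2 ^ Suc k) ^ DIM('a)) = ?w * 2 powr ?N * (2 powr (?N - a)) ^ k"
    proof -
      have "(2 ^ k) powr (- a) = 2 powr (- a * real k)"
        by (simp add: powr_realpow[symmetric] powr_powr mult.commute)
      moreover have "((2::real) ^ Suc k) ^ DIM('a) = 2 powr (?N * (real k + 1))"
      proof -
        have "((2::real) ^ Suc k) ^ DIM('a) = 2 ^ (DIM('a) * Suc k)" by (metis power_mult mult.commute)
        also have "\<dots> = 2 powr (real (DIM('a) * Suc k))" by (rule powr_realpow[symmetric]) simp
        finally show ?thesis by (simp add: algebra_simps)
      qed
      moreover have "(2 powr (?N - a)) ^ k = 2 powr ((?N - a) * real k)"
        by (simp add: powr_realpow[symmetric] powr_powr)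
      moreover have "2 powr (- a * real k) * 2 powr (?N * (real k + 1)) = 2 powr ?N * (2::real) powr ((?N - a) * real k)"
        unfolding powr_add[symmetric] by (simp add: algebra_simps)
      ultimately show ?thesis by (simp only: mult_ac)
    qed
    then show "ennreal ((2 ^ k) powr (- a)) * emeasure lborel (cball (0::'a) (2 ^ Suc k))
      = ennreal (?w * 2 powr ?N * (2 powr (?N - a)) ^ k)"
      by (subst emeasure_cball) (auto simp: ennreal_mult'[symmetric])
  qed
  also have "\<dots> < \<infinity>"
    using sm by (subst suminf_ennreal2) auto
  finally show ?thesis .
qed

section \<open>The energy form\<close>

text \<open>Half of the exponent of the kernel goes to each factor, so that
  \<open>frac_integrand s u v\<close> is a product of two expressions linear in \<open>u\<close> and
  \<open>v\<close>. Bilinearity and the Cauchy-Schwarz type bounds then reduce to pointwise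
  algebra.\<close>

definition fdiff :: "real \<Rightarrow> ('a::euclidean_space \<Rightarrow> real) \<Rightarrow> 'a \<times> 'a \<Rightarrow> real" where
  "fdiff s u = (\<lambda>(x, y). (u x - u y) / norm (x - y) powr ((real DIM('a) + 2 * s) / 2))"

text \<open>Since \<open>0 powr x\<close> is 0, the kernel vanishes at the origin instead of being
  infinite there; the diagonal is a null set.\<close>

definition kern :: "real \<Rightarrow> 'a::euclidean_space \<Rightarrow> real" where
  "kern s z = norm z powr (- (real DIM('a) + 2 * s))"

text \<open>The Bochner integral of a non-integrable function is 0, so additivity of
  \<open>en\<close> can only be stated for functions whose finite energy is recorded
  explicitly.\<close>

definition fin_en :: "real \<Rightarrow> ('a::euclidean_space \<Rightarrow> real) \<Rightarrow> bool" where
  "fin_en s u \<longleftrightarrow> u \<in> borel_measurable borel \<and> integrable lborel (frac_integrand s u u)"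

definition en :: "real \<Rightarrow> ('a::euclidean_space \<Rightarrow> real) \<Rightarrow> ('a \<Rightarrow> real) \<Rightarrow> real" where
  "en s u v = (LINT p|lborel. frac_integrand s u v p)"

abbreviation density :: "real \<Rightarrow> ('a::euclidean_space \<Rightarrow> real) \<Rightarrow> 'a \<times> 'a \<Rightarrow> real" where
  "density s u \<equiv> frac_integrand s u u"

abbreviation energy :: "real \<Rightarrow> ('a::euclidean_space \<Rightarrow> real) \<Rightarrow> real" where
  "energy s u \<equiv> en s u u"

lemma frac_form_en: "frac_form s u v = frac_const DIM('a) s / 2 * en s u (v :: 'a::euclidean_space \<Rightarrow> real)"
  by (simp add: frac_form_def en_def)

lemma frac_const_pos: "0 < s \<Longrightarrow> s < 1 \<Longrightarrow> 0 < frac_const N s"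
  unfolding frac_const_def by (auto intro!: divide_pos_pos mult_pos_pos Gamma_real_pos add_nonneg_pos)

lemma frac_integrand_fdiff: "frac_integrand s u v p = fdiff s u p * fdiff s v p"
proof -
  obtain x y where p: "p = (x, y)" by (cases p)
  show ?thesis unfolding p frac_integrand_def fdiff_def
    by (simp flip: powr_add)
qed

lemma frac_integrand_kern:
  "frac_integrand s u v (x, y) = (u x - u y) * (v x - v y) * kern s (x - y)"
  unfolding frac_integrand_def kern_def powr_minus divide_inverse by simp

lemma kern_nonneg [simp]: "0 \<le> kern s z"
  by (simp add: kern_def)

lemma measurable_fst_borel [measurable]: "fst \<in> borel_measurable (borel :: ('a::euclidean_space \<times> 'a) measure)"
  by (intro borel_measurable_continuous_onI continuous_intros)

lemma measurable_snd_borel [measurable]: "snd \<in> borel_measurable (borel :: ('a::euclidean_space \<times> 'a) measure)"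
  by (intro borel_measurable_continuous_onI continuous_intros)

lemma kern_measurable [measurable]: "kern s \<in> borel_measurable borel"
  unfolding kern_def by measurable

lemma fdiff_measurable [measurable]:
  fixes u :: "'a::euclidean_space \<Rightarrow> real"
  assumes [measurable]: "u \<in> borel_measurable borel"
  shows "fdiff s u \<in> borel_measurable borel"
  unfolding fdiff_def case_prod_beta by measurable

lemma frac_integrand_measurable [measurable]:
  fixes u :: "'a::euclidean_space \<Rightarrow> real"
  assumes [measurable]: "u \<in> borel_measurable borel" "v \<in> borel_measurable borel"
  shows "frac_integrand s u v \<in> borel_measurable borel"
  unfolding frac_integrand_fdiff[abs_def] by measurable

lemma fdiff_add: "fdiff s (\<lambda>x. u x + v x) p = fdiff s u p + fdiff s v p"
  by (cases p) (simp add: fdiff_def add_divide_distrib diff_divide_distrib)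

lemma fdiff_diff: "fdiff s (\<lambda>x. u x - v x) p = fdiff s u p - fdiff s v p"
  by (cases p) (simp add: fdiff_def diff_divide_distrib)

lemma fdiff_cmult: "fdiff s (\<lambda>x. c * u x) p = c * fdiff s u p"
  by (cases p) (simp add: fdiff_def algebra_simps diff_divide_distrib)

lemma frac_integrand_nonneg: "0 \<le> density s u p"
  by (simp add: frac_integrand_fdiff)

lemma fin_en_measurable: "fin_en s u \<Longrightarrow> u \<in> borel_measurable borel"
  by (simp add: fin_en_def)

lemma integrable_mult_of_squares:
  fixes f g :: "'b \<Rightarrow> real"
  assumes [measurable]: "f \<in> borel_measurable M" "g \<in> borel_measurable M"
    and i: "integrable M (\<lambda>x. f x * f x)" "integrable M (\<lambda>x. g x * g x)"
  shows "integrable M (\<lambda>x. f x * g x)"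
proof (rule Bochner_Integration.integrable_bound)
  show "integrable M (\<lambda>x. f x * f x + g x * g x)" using i by simp
  show "AE x in M. norm (f x * g x) \<le> norm (f x * f x + g x * g x)"
  proof (rule AE_I2)
    fix x
    have "2 * \<bar>f x\<bar> * \<bar>g x\<bar> \<le> f x * f x + g x * g x"
      using sum_squares_bound[of "\<bar>f x\<bar>" "\<bar>g x\<bar>"] by (simp add: power2_eq_square)
    moreover have "0 \<le> \<bar>f x\<bar> * \<bar>g x\<bar>" "0 \<le> f x * f x + g x * g x" by auto
    ultimately show "norm (f x * g x) \<le> norm (f x * f x + g x * g x)"
      unfolding real_norm_def abs_mult by linarith
  qed
qed measurable

lemma integrable_frac_integrand:
  assumes "fin_en s u" "fin_en s v"
  shows "integrable lborel (frac_integrand s u v)"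
  using assms unfolding fin_en_def frac_integrand_fdiff[abs_def]
  by (elim conjE) (rule integrable_mult_of_squares, auto)

lemma fin_en_add:
  assumes "fin_en s u" "fin_en s v"
  shows "fin_en s (\<lambda>x. u x + v x)"
proof -
  have "density s (\<lambda>x. u x + v x)
    = (\<lambda>p. density s u p + density s v p + 2 * frac_integrand s u v p)"
    by (auto simp: frac_integrand_fdiff fdiff_add algebra_simps)
  then show ?thesis
    using assms integrable_frac_integrand[OF assms] by (auto simp: fin_en_def)
qed

lemma fin_en_cmult:
  assumes "fin_en s u"
  shows "fin_en s (\<lambda>x. c * u x)"
proof -
  have "density s (\<lambda>x. c * u x) = (\<lambda>p. c * c * density s u p)"
    by (auto simp: frac_integrand_fdiff fdiff_cmult algebra_simps)
  then show ?thesis using assms by (auto simp: fin_en_def)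
qed

lemma fin_en_diff:
  assumes "fin_en s u" "fin_en s v"
  shows "fin_en s (\<lambda>x. u x - v x)"
  using fin_en_add[OF assms(1) fin_en_cmult[OF assms(2), of "-1"]] by simp

lemma en_commute: "en s u v = en s v u"
  unfolding en_def by (rule Bochner_Integration.integral_cong) (auto simp: frac_integrand_fdiff)

lemma en_nonneg: "0 \<le> energy s u"
  unfolding en_def by (rule integral_nonneg_AE) (simp add: frac_integrand_nonneg)

lemma en_add_left:
  assumes "fin_en s u" "fin_en s v" "fin_en s w"
  shows "en s (\<lambda>x. u x + v x) w = en s u w + en s v w"
  unfolding en_def
  by (subst Bochner_Integration.integral_add[symmetric])
     (auto intro!: integrable_frac_integrand assms Bochner_Integration.integral_cong simp: frac_integrand_fdiff fdiff_add algebra_simps)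

lemma en_diff_left:
  assumes "fin_en s u" "fin_en s v" "fin_en s w"
  shows "en s (\<lambda>x. u x - v x) w = en s u w - en s v w"
  unfolding en_def
  by (subst Bochner_Integration.integral_diff[symmetric])
     (auto intro!: integrable_frac_integrand assms Bochner_Integration.integral_cong simp: frac_integrand_fdiff fdiff_diff algebra_simps)

lemma en_cmult_left: "en s (\<lambda>x. c * u x) w = c * en s u w"
  unfolding en_def frac_integrand_fdiff[abs_def] fdiff_cmult by (simp add: mult.assoc)

lemma en_cmult_right: "en s w (\<lambda>x. c * u x) = c * en s w u"
  using en_cmult_left en_commute by metis

lemma en_add_right:
  assumes "fin_en s u" "fin_en s v" "fin_en s w"
  shows "en s w (\<lambda>x. u x + v x) = en s w u + en s w v"
  using en_add_left[OF assms] en_commute by metis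

lemma en_diff_right:
  assumes "fin_en s u" "fin_en s v" "fin_en s w"
  shows "en s w (\<lambda>x. u x - v x) = en s w u - en s w v"
  using en_diff_left[OF assms] en_commute by metis

lemma en_add_self:
  assumes "fin_en s u" "fin_en s v"
  shows "energy s (\<lambda>x. u x + v x) = energy s u + energy s v + 2 * en s u v"
  using assms by (simp add: en_add_left en_add_right fin_en_add en_commute[of s v u])

lemma en_diff_self:
  assumes "fin_en s u" "fin_en s v"
  shows "energy s (\<lambda>x. u x - v x) = energy s u + energy s v - 2 * en s u v"
  using assms by (simp add: en_diff_left en_diff_right fin_en_diff en_commute[of s v u])

text \<open>Parallelogram law with the energy of the difference dropped.\<close>

lemma en_add_le:
  assumes "fin_en s u" "fin_en s v"
  shows "energy s (\<lambda>x. u x + v x) \<le> 2 * energy s u + 2 * energy s v"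
  using en_nonneg[of s "\<lambda>x. u x - v x"] assms by (simp add: en_add_self en_diff_self)

lemma en_diff_le:
  assumes "fin_en s u" "fin_en s v"
  shows "energy s (\<lambda>x. u x - v x) \<le> 2 * energy s u + 2 * energy s v"
  using en_nonneg[of s "\<lambda>x. u x + v x"] assms by (simp add: en_add_self en_diff_self)

text \<open>Bridge between the two integrals: estimates are made in \<open>ennreal\<close>, where
  Tonelli asks for measurability only, and are read back as real inequalities.\<close>

lemma nn_integral_frac_integrand:
  assumes "fin_en s u"
  shows "(\<integral>\<^sup>+p. ennreal (density s u p) \<partial>lborel) = ennreal (energy s u)"
  using assms unfolding en_def fin_en_def
  by (intro nn_integral_eq_integral) (auto simp: frac_integrand_nonneg)

lemma fin_enI:
  assumes [measurable]: "u \<in> borel_measurable borel"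
    and "(\<integral>\<^sup>+p. ennreal (density s u p) \<partial>lborel) < \<infinity>"
  shows "fin_en s u"
  using assms unfolding fin_en_def
  by (auto intro!: integrableI_nonneg simp: frac_integrand_nonneg)

lemma en_leI:
  assumes "fin_en s u" "0 \<le> B" "(\<integral>\<^sup>+p. ennreal (density s u p) \<partial>lborel) \<le> ennreal B"
  shows "energy s u \<le> B"
  using assms nn_integral_frac_integrand[OF assms(1)] by simp

section \<open>Tonelli, translations and null sets on the product space\<close>

lemma nn_integral_lborel_pair:
  fixes f :: "'a::euclidean_space \<times> 'a \<Rightarrow> ennreal"
  assumes "f \<in> borel_measurable borel"
  shows "(\<integral>\<^sup>+p. f p \<partial>lborel) = (\<integral>\<^sup>+x. \<integral>\<^sup>+y. f (x, y) \<partial>lborel \<partial>lborel)"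
proof -
  have "f \<in> borel_measurable (lborel \<Otimes>\<^sub>M lborel)" using assms by (simp add: lborel_prod)
  from lborel.nn_integral_fst[OF this] show ?thesis by (simp add: lborel_prod)
qed

lemma nn_integral_lborel_pair':
  fixes f :: "'a::euclidean_space \<times> 'a \<Rightarrow> ennreal"
  assumes "f \<in> borel_measurable borel"
  shows "(\<integral>\<^sup>+p. f p \<partial>lborel) = (\<integral>\<^sup>+y. \<integral>\<^sup>+x. f (x, y) \<partial>lborel \<partial>lborel)"
proof -
  have "(\<lambda>(x, y). f (x, y)) \<in> borel_measurable (lborel \<Otimes>\<^sub>M lborel)" using assms by (simp add: lborel_prod)
  from lborel_pair.nn_integral_snd[OF this] show ?thesis by (simp add: lborel_prod)
qed

lemma nn_integral_lborel_shift:
  fixes f :: "'a::euclidean_space \<Rightarrow> ennreal"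
  assumes [measurable]: "f \<in> borel_measurable borel"
  shows "(\<integral>\<^sup>+y. f (c + y) \<partial>lborel) = (\<integral>\<^sup>+y. f y \<partial>lborel)"
proof -
  have "(\<integral>\<^sup>+y. f y \<partial>lborel) = (\<integral>\<^sup>+y. f y \<partial>distr lborel borel ((+) c))"
    by (simp add: lborel_distr_plus)
  also have "\<dots> = (\<integral>\<^sup>+y. f (c + y) \<partial>lborel)"
    by (rule nn_integral_distr) auto
  finally show ?thesis by simp
qed

lemma AE_lborel_fst:
  fixes P :: "'a::euclidean_space \<Rightarrow> bool"
  assumes "AE x in lborel. P x"
  shows "AE p in lborel. P (fst (p :: 'a \<times> 'a))"
proof -
  obtain N where N: "N \<in> null_sets lborel" "{x. \<not> P x} \<subseteq> N"
    using assms by (auto elim!: AE_E simp: null_sets_def)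
  then have "N \<times> (UNIV :: 'a set) \<in> null_sets (lborel \<Otimes>\<^sub>M lborel)"
    by (auto simp: null_sets_def lborel.emeasure_pair_measure_Times)
  then have "N \<times> (UNIV :: 'a set) \<in> null_sets lborel" by (simp add: lborel_prod)
  then show ?thesis by (rule AE_I') (use N in auto)
qed

lemma AE_lborel_snd:
  fixes P :: "'a::euclidean_space \<Rightarrow> bool"
  assumes "AE x in lborel. P x"
  shows "AE p in lborel. P (snd (p :: 'a \<times> 'a))"
proof -
  obtain N where N: "N \<in> null_sets lborel" "{x. \<not> P x} \<subseteq> N"
    using assms by (auto elim!: AE_E simp: null_sets_def)
  then have "(UNIV :: 'a set) \<times> N \<in> null_sets (lborel \<Otimes>\<^sub>M lborel)"
    by (auto simp: null_sets_def lborel.emeasure_pair_measure_Times)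
  then have "(UNIV :: 'a set) \<times> N \<in> null_sets lborel" by (simp add: lborel_prod)
  then show ?thesis by (rule AE_I') (use N in auto)
qed

lemma AE_frac_integrand_cong:
  assumes "AE x in lborel. u x = u' x" "AE x in lborel. v x = v' x"
  shows "AE p in lborel. frac_integrand s u v p = frac_integrand s u' v' p"
  using AE_lborel_fst[OF assms(1)] AE_lborel_snd[OF assms(1)] AE_lborel_fst[OF assms(2)] AE_lborel_snd[OF assms(2)]
  by eventually_elim (auto simp: frac_integrand_def case_prod_beta)

lemma en_cong_AE:
  assumes "AE x in lborel. u x = u' x" "AE x in lborel. v x = v' x"
    and [measurable]: "u \<in> borel_measurable borel" "v \<in> borel_measurable borel"
     "u' \<in> borel_measurable borel" "v' \<in> borel_measurable borel"
  shows "en s u v = en s u' v'"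
  unfolding en_def by (rule integral_cong_AE) (use AE_frac_integrand_cong[OF assms(1,2)] in auto)

text \<open>A Poincare inequality that needs no compactness: \<open>u\<close> vanishes on a unit
  ball placed outside \<open>\<Omega>\<close>, and the interaction of each point of
  \<open>\<Omega>\<close> with that ball alone already contributes a fixed multiple of
  \<open>u x * u x\<close> to the energy.\<close>

lemma nn_integral_square_le_energy:
  fixes \<Omega> :: "'a::euclidean_space set"
  assumes s: "0 < s" and bnd: "bounded \<Omega>"
  shows "\<exists>C>0. \<forall>u. u \<in> borel_measurable borel \<longrightarrow> (AE x in lborel. x \<notin> \<Omega> \<longrightarrow> u x = 0) \<longrightarrow>
    (\<integral>\<^sup>+x. ennreal (u x * u x) \<partial>lborel) \<le> ennreal C * (\<integral>\<^sup>+p. ennreal (density s u p) \<partial>lborel)"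
proof -
  obtain \<rho> where \<rho>: "\<rho> > 0" "\<Omega> \<subseteq> ball 0 \<rho>" using bnd bounded_subset_ballD by blast
  obtain e :: 'a where e: "e \<in> Basis" using nonempty_Basis by blast
  \<comment> \<open>At this distance the unit ball around \<open>z0\<close> misses the ball of
    radius \<open>\<rho>\<close> containing \<open>\<Omega>\<close>.\<close>
  define z0 where "z0 = (\<rho> + 1) *\<^sub>R e"
  have nz0: "norm z0 = \<rho> + 1" using e \<rho> by (simp add: z0_def)
  let ?a = "real DIM('a) + 2 * s"
  \<comment> \<open>Bounds \<open>norm (x - y)\<close> for \<open>x\<close> in
    \<open>\<Omega>\<close> and \<open>y\<close> in the auxiliary ball, since
    \<open>norm x < \<rho>\<close> and \<open>norm y \<le> \<rho> + 2\<close>.\<close>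
  define M where "M = 2 * \<rho> + 2"
  have Mpos: "M > 0" using \<rho> by (simp add: M_def)
  define k where "k = M powr (- ?a) * unit_ball_vol (real DIM('a))"
  have kpos: "k > 0" using Mpos by (simp add: k_def)
  have "(\<integral>\<^sup>+x. ennreal (u x * u x) \<partial>lborel) \<le> ennreal (1/k) * (\<integral>\<^sup>+p. ennreal (density s u p) \<partial>lborel)"
    if [measurable]: "u \<in> borel_measurable borel" and v: "AE x in lborel. x \<notin> \<Omega> \<longrightarrow> u x = 0" for u
  proof -
    have ae: "AE x in lborel. AE y in lborel. ennreal (u x * u x * M powr (- ?a)) * indicator (ball z0 1) y
       \<le> ennreal (density s u (x, y))"
      using v
    proof eventually_elim
      fix x assume x: "x \<notin> \<Omega> \<longrightarrow> u x = 0"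
      show "AE y in lborel. ennreal (u x * u x * M powr (- ?a)) * indicator (ball z0 1) y
       \<le> ennreal (density s u (x, y))"
        using v
      proof eventually_elim
        fix y assume y: "y \<notin> \<Omega> \<longrightarrow> u y = 0"
        show "ennreal (u x * u x * M powr (- ?a)) * indicator (ball z0 1) y
            \<le> ennreal (density s u (x, y))"
        proof (cases "y \<in> ball z0 1 \<and> x \<in> \<Omega>")
          case True
          then have d: "norm (z0 - y) < 1" and xr: "norm x < \<rho>" using \<rho> by (auto simp: dist_norm)
          have ny: "norm y > \<rho>" using d nz0 norm_triangle_ineq2[of z0 y] by simp
          then have "y \<notin> \<Omega>" using \<rho> by auto
          then have u0: "u y = 0" using y by simp
          have "norm y \<le> \<rho> + 2" using d nz0 norm_triangle_ineq2[of y z0] by (simp add: norm_minus_commute)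
          then have xy: "norm (x - y) \<le> M" using xr norm_triangle_ineq4[of x y] by (simp add: M_def)
          have xy0: "norm (x - y) > 0" using xr ny by auto
          have "M powr (- ?a) \<le> norm (x - y) powr (- ?a)"
            using xy xy0 s by (intro powr_mono2') auto
          then have "u x * u x * M powr (- ?a) \<le> u x * u x * norm (x - y) powr (- ?a)"
            by (intro mult_left_mono) auto
          then show ?thesis using True u0 by (simp add: frac_integrand_kern kern_def ennreal_leI)
        next
          case False
          then show ?thesis using x by (auto simp: indicator_def)
        qed
      qed
    qed
    have "(\<integral>\<^sup>+y. ennreal (u x * u x * M powr (- ?a)) * indicator (ball z0 1) y \<partial>lborel) = ennreal k * ennreal (u x * u x)" for x
      by (subst nn_integral_cmult_indicator) (auto simp: emeasure_ball k_def ennreal_mult'[symmetric] mult_ac)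
    then have "ennreal k * (\<integral>\<^sup>+x. ennreal (u x * u x) \<partial>lborel)
       = (\<integral>\<^sup>+x. \<integral>\<^sup>+y. ennreal (u x * u x * M powr (- ?a)) * indicator (ball z0 1) y \<partial>lborel \<partial>lborel)"
      by (simp add: nn_integral_cmult)
    also have "\<dots> \<le> (\<integral>\<^sup>+x. \<integral>\<^sup>+y. ennreal (density s u (x, y)) \<partial>lborel \<partial>lborel)"
      by (rule nn_integral_mono_AE) (use ae in \<open>auto elim!: eventually_mono intro!: nn_integral_mono_AE\<close>)
    also have "\<dots> = (\<integral>\<^sup>+p. ennreal (density s u p) \<partial>lborel)"
      by (subst nn_integral_lborel_pair) auto
    finally have *: "ennreal k * (\<integral>\<^sup>+x. ennreal (u x * u x) \<partial>lborel) \<le> (\<integral>\<^sup>+p. ennreal (density s u p) \<partial>lborel)" .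
    have "(\<integral>\<^sup>+x. ennreal (u x * u x) \<partial>lborel) = ennreal (1/k) * (ennreal k * (\<integral>\<^sup>+x. ennreal (u x * u x) \<partial>lborel))"
      using kpos by (simp add: mult.assoc[symmetric] ennreal_mult'[symmetric])
    also have "\<dots> \<le> ennreal (1/k) * (\<integral>\<^sup>+p. ennreal (density s u p) \<partial>lborel)"
      by (rule mult_left_mono[OF *]) simp
    finally show ?thesis .
  qed
  then show ?thesis using kpos by (intro exI[of _ "1/k"]) auto
qed

section \<open>Smooth functions with compact support\<close>

text \<open>\<open>C_order\<close> speaks of \<open>frechet_derivative\<close>, a choice operator;
  uniqueness of derivatives allows any explicit candidate \<open>D\<close> in its place.\<close>

lemma C_order_SucI:
  assumes "\<And>x. (f has_derivative D x) (at x)" "\<And>b. b \<in> Basis \<Longrightarrow> C_order k (\<lambda>x. D x b)"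
  shows "C_order (Suc k) f"
proof -
  have "frechet_derivative f (at x) = D x" for x
    using frechet_derivative_at[OF assms(1)] by simp
  then show ?thesis using assms by (auto simp: differentiable_def)
qed

lemma C_order_has_derivative:
  "C_order (Suc k) f \<Longrightarrow> (f has_derivative frechet_derivative f (at x)) (at x)"
  using frechet_derivative_works by auto

lemma C_order_Suc_imp: "C_order (Suc k) f \<Longrightarrow> C_order k f"
proof (induction k arbitrary: f)
  case 0
  then show ?case by (auto intro!: continuous_at_imp_continuous_on differentiable_imp_continuous_within)
next
  case (Suc k)
  then show ?case by (simp only: C_order.simps(2)) blast
qed

lemma C_order_const: "C_order k (\<lambda>x. c)"
proof (induction k arbitrary: c)
  case (Suc k)
  show ?case by (rule C_order_SucI[where D = "\<lambda>_ _. 0"]) (auto intro: Suc)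
qed simp

lemma C_order_inner: "C_order k (\<lambda>x. x \<bullet> c)"
proof (cases k)
  case 0 then show ?thesis by (auto intro!: continuous_intros)
next
  case (Suc j)
  have "C_order (Suc j) (\<lambda>x. x \<bullet> c)"
    by (rule C_order_SucI[where D = "\<lambda>_ h. h \<bullet> c"]) (auto intro!: derivative_eq_intros C_order_const)
  then show ?thesis using Suc by simp
qed

lemma C_order_add: "C_order k f \<Longrightarrow> C_order k g \<Longrightarrow> C_order k (\<lambda>x. f x + g x)"
proof (induction k arbitrary: f g)
  case 0 then show ?case by (auto intro!: continuous_intros)
next
  case (Suc k)
  show ?case
    by (rule C_order_SucI[OF has_derivative_add[OF C_order_has_derivative[OF Suc.prems(1)] C_order_has_derivative[OF Suc.prems(2)]]])
       (use Suc in auto)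
qed

lemma C_order_mult:
  fixes f g :: "'a::euclidean_space \<Rightarrow> real"
  shows "C_order k f \<Longrightarrow> C_order k g \<Longrightarrow> C_order k (\<lambda>x. f x * g x)"
proof (induction k arbitrary: f g)
  case 0 then show ?case by (auto intro!: continuous_intros)
next
  case (Suc k)
  have fg: "C_order k f" "C_order k g" using Suc.prems C_order_Suc_imp by blast+
  show ?case
    by (rule C_order_SucI[OF has_derivative_mult[OF C_order_has_derivative[OF Suc.prems(1)] C_order_has_derivative[OF Suc.prems(2)]]])
       (use Suc fg in \<open>auto intro!: C_order_add\<close>)
qed

lemma C_order_cmult:
  fixes f :: "'a::euclidean_space \<Rightarrow> real"
  shows "C_order k f \<Longrightarrow> C_order k (\<lambda>x. c * f x)"
  by (intro C_order_mult C_order_const)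

lemma C_order_diff:
  fixes f g :: "'a::euclidean_space \<Rightarrow> real"
  assumes "C_order k f" "C_order k g"
  shows "C_order k (\<lambda>x. f x - g x)"
  using C_order_add[OF assms(1) C_order_cmult[OF assms(2), of "-1"]] by simp

lemma C_order_sum:
  fixes f :: "'i \<Rightarrow> 'a::euclidean_space \<Rightarrow> real"
  assumes "\<And>i. i \<in> I \<Longrightarrow> C_order k (f i)"
  shows "C_order k (\<lambda>x. \<Sum>i\<in>I. f i x)"
  using assms by (induction I rule: infinite_finite_induct) (auto intro: C_order_const C_order_add)

text \<open>The derivative of 1/f contains 1/f itself, which the induction hypothesis supplies one
  order lower. The square root below works in the same way.\<close>

lemma C_order_inverse:
  fixes f :: "'a::euclidean_space \<Rightarrow> real"
  assumes nz: "\<And>x. f x \<noteq> 0"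
  shows "C_order k f \<Longrightarrow> C_order k (\<lambda>x. inverse (f x))"
proof (induction k)
  case 0 then show ?case using nz by (auto intro!: continuous_intros)
next
  case (Suc k)
  have f: "C_order k (\<lambda>x. inverse (f x))" using Suc.prems Suc.IH C_order_Suc_imp by blast
  show ?case
  proof (rule C_order_SucI[OF Deriv.has_derivative_inverse[OF nz C_order_has_derivative[OF Suc.prems]]])
    fix b :: 'a assume "b \<in> Basis"
    then have "C_order k (\<lambda>x. frechet_derivative f (at x) b)" using Suc.prems by simp
    then have "C_order k (\<lambda>x. -1 * (inverse (f x) * frechet_derivative f (at x) b * inverse (f x)))"
      by (intro C_order_mult f C_order_const)
    then show "C_order k (\<lambda>x. - (inverse (f x) * frechet_derivative f (at x) b * inverse (f x)))"
      by simp
  qed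
qed

lemma C_order_sqrt:
  fixes f :: "'a::euclidean_space \<Rightarrow> real"
  assumes pos: "\<And>x. f x > 0"
  shows "C_order k f \<Longrightarrow> C_order k (\<lambda>x. sqrt (f x))"
proof (induction k)
  case 0 then show ?case by (auto intro!: continuous_intros)
next
  case (Suc k)
  have f: "C_order k (\<lambda>x. inverse (sqrt (f x)))"
    using Suc.prems Suc.IH C_order_Suc_imp pos by (intro C_order_inverse) (auto simp: less_imp_neq[symmetric])
  show ?case
  proof (rule C_order_SucI[OF has_derivative_real_sqrt[OF pos C_order_has_derivative[OF Suc.prems]]])
    fix b :: 'a assume "b \<in> Basis"
    then have "C_order k (\<lambda>x. frechet_derivative f (at x) b)" using Suc.prems by simp
    then have "C_order k (\<lambda>x. frechet_derivative f (at x) b * (inverse (sqrt (f x)) * (1/2)))"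
      by (intro C_order_mult f C_order_const)
    then show "C_order k (\<lambda>x. frechet_derivative f (at x) b * (inverse (sqrt (f x)) / 2))"
      by simp
  qed
qed

lemma C_order_reflect:
  fixes f :: "'a::euclidean_space \<Rightarrow> real"
  shows "C_order k f \<Longrightarrow> C_order k (\<lambda>x. f (- x))"
proof (induction k arbitrary: f)
  case 0
  then have "continuous_on UNIV (f \<circ> uminus)"
    by (intro continuous_on_compose) (auto intro!: continuous_intros intro: continuous_on_subset)
  then show ?case by (simp add: o_def)
next
  case (Suc k)
  show ?case
  proof (rule C_order_SucI[where D = "\<lambda>x h. frechet_derivative f (at (- x)) (- h)"])
    fix x :: 'a
    have "((\<lambda>x. - x) has_derivative (\<lambda>h. - h)) (at x)" by (auto intro!: derivative_eq_intros)
    from has_derivative_compose[OF this C_order_has_derivative[OF Suc.prems]]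
    show "((\<lambda>x. f (- x)) has_derivative (\<lambda>h. frechet_derivative f (at (- x)) (- h))) (at x)" .
  next
    fix b :: 'a assume b: "b \<in> Basis"
    have "frechet_derivative f (at (- x)) (- b) = -1 * frechet_derivative f (at (- x)) b" for x
      using has_derivative_linear[OF C_order_has_derivative[OF Suc.prems, of "- x"]] by (simp add: linear_neg)
    moreover have "C_order k (\<lambda>x. -1 * frechet_derivative f (at (- x)) b)"
      by (intro C_order_cmult Suc.IH[where f = "\<lambda>x. frechet_derivative f (at x) b"]) (use Suc.prems b in auto)
    ultimately show "C_order k (\<lambda>x. frechet_derivative f (at (- x)) (- b))" by simp
  qed
qed

text \<open>The case \<open>n = 0\<close> is the classical smooth function that is flat at 0. The
  pole order \<open>n\<close> is carried along because derivatives are again combinations of members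
  of this family.\<close>

definition flat_fn :: "nat \<Rightarrow> real \<Rightarrow> real" where
  "flat_fn n t = (if t > 0 then exp (- (1 / t)) / t ^ n else 0)"

text \<open>Keeping only the term of index \<open>n + 2\<close> in the exponential series beats the
  pole \<open>t ^ n\<close> with two powers of \<open>t\<close> to spare, enough for a zero
  derivative at 0.\<close>

lemma flat_fn_le:
  assumes "t > 0"
  shows "flat_fn n t \<le> fact (n + 2) * t ^ 2"
proof -
  have "(1/t) ^ (n + 2) / fact (n + 2) \<le> exp (1/t)"
  proof -
    have "(\<Sum>k\<in>{n+2}. (1/t) ^ k / fact k) \<le> (\<Sum>k. (1/t) ^ k / fact k)"
      using assms summable_exp_generic[of "1/t"] by (intro sum_le_suminf) (auto simp: scaleR_conv_of_real field_simps)
    then show ?thesis by (simp add: exp_def scaleR_conv_of_real field_simps)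
  qed
  moreover define M where "M = fact (n + 2) * t ^ (n + 2)"
  moreover have "M > 0" using assms by (simp add: M_def)
  ultimately have "1 / M \<le> exp (1/t)" by (simp only: power_one_over) (simp add: mult.commute)
  then have "exp (- (1/t)) \<le> M"
    using \<open>M > 0\<close> by (simp add: exp_minus field_simps)
  then have "exp (- (1/t)) \<le> fact (n + 2) * t ^ (n + 2)" by (simp only: M_def)
  then have "exp (- (1/t)) / t ^ n \<le> fact (n + 2) * t ^ (n + 2) / t ^ n"
    using assms by (intro divide_right_mono) auto
  then show ?thesis using assms by (simp add: flat_fn_def power_add power2_eq_square mult.assoc)
qed

lemma flat_fn_deriv: "(flat_fn n has_real_derivative (flat_fn (n + 2) t - real n * flat_fn (n + 1) t)) (at t)"
proof -
  consider "t > 0" | "t < 0" | "t = 0" by linarith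
  then show ?thesis
  proof cases
    case 1
    have "((\<lambda>t. exp (- (1 / t)) / t ^ n) has_real_derivative (flat_fn (n + 2) t - real n * flat_fn (n + 1) t)) (at t)"
    proof -
      have "((\<lambda>t. exp (- (1 / t)) / t ^ n) has_real_derivative
         (exp (- (1/t)) * (1 / t^2) * t ^ n - exp (- (1/t)) * (real n * t ^ (n - 1))) / (t ^ n * t ^ n)) (at t)"
        using 1 by (auto intro!: derivative_eq_intros simp: power2_eq_square)
      moreover have "(exp (- (1/t)) * (1 / t^2) * t ^ n - exp (- (1/t)) * (real n * t ^ (n - 1))) / (t ^ n * t ^ n)
         = flat_fn (n + 2) t - real n * flat_fn (n + 1) t"
        using 1 by (cases n) (simp_all add: flat_fn_def field_simps power2_eq_square)
      ultimately show ?thesis by simp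
    qed
    then show ?thesis
      by (rule has_field_derivative_transform_within[where d = t]) (use 1 in \<open>auto simp: flat_fn_def dist_real_def\<close>)
  next
    case 2
    have "((\<lambda>t. 0) has_real_derivative (flat_fn (n + 2) t - real n * flat_fn (n + 1) t)) (at t)"
      using 2 by (simp add: flat_fn_def)
    then show ?thesis
      by (rule has_field_derivative_transform_within[where d = "- t"]) (use 2 in \<open>auto simp: flat_fn_def dist_real_def\<close>)
  next
    case 3
    have "((\<lambda>h. (flat_fn n h - flat_fn n 0) / h) \<longlongrightarrow> 0) (at 0)"
    proof (rule Lim_null_comparison)
      show "\<forall>\<^sub>F h in at 0. norm ((flat_fn n h - flat_fn n 0) / h) \<le> fact (n + 2) * \<bar>h\<bar>"
      proof (intro always_eventually allI)
        fix h :: real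
        show "norm ((flat_fn n h - flat_fn n 0) / h) \<le> fact (n + 2) * \<bar>h\<bar>"
        proof (cases "h > 0")
          case True
          have "0 \<le> flat_fn n h" using True by (simp add: flat_fn_def)
          then show ?thesis using flat_fn_le[OF True, of n] True
            by (simp add: flat_fn_def[of n 0] field_simps power2_eq_square)
        next
          case False
          have "0 \<le> fact (n + 2) * \<bar>h\<bar>" by (intro mult_nonneg_nonneg) auto
          then show ?thesis using False by (simp only: flat_fn_def) simp
        qed
      qed
      show "((\<lambda>h. fact (n + 2) * \<bar>h\<bar>) \<longlongrightarrow> 0) (at (0::real))"
        by (auto intro!: tendsto_eq_intros)
    qed
    then show ?thesis using 3 by (simp add: has_field_derivative_iff flat_fn_def[of _ 0])
  qed
qed

text \<open>The induction must leave \<open>n\<close> arbitrary, since each derivative raises it by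
  1 and 2.\<close>

lemma C_order_flat_fn:
  fixes q :: "'a::euclidean_space \<Rightarrow> real"
  assumes q: "\<And>k. C_order k q"
  shows "C_order k (\<lambda>x. flat_fn n (q x))"
proof (induction k arbitrary: n)
  case 0
  have "continuous_on UNIV (flat_fn n)"
    using flat_fn_deriv by (meson DERIV_isCont continuous_at_imp_continuous_on)
  moreover have "continuous_on UNIV q" using q[of 0] by simp
  ultimately show ?case using continuous_on_compose[of UNIV q "flat_fn n"]
    by (auto simp: o_def intro: continuous_on_subset)
next
  case (Suc k)
  let ?D = "\<lambda>x h. (flat_fn (n + 2) (q x) - real n * flat_fn (n + 1) (q x)) * frechet_derivative q (at x) h"
  show ?case
  proof (rule C_order_SucI[where D = ?D])
    fix x :: 'a
    have "(flat_fn n has_derivative (*) (flat_fn (n + 2) (q x) - real n * flat_fn (n + 1) (q x))) (at (q x))"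
      using flat_fn_deriv[of n "q x"] by (simp add: has_field_derivative_def)
    from has_derivative_compose[OF C_order_has_derivative[OF q[of "Suc 0"]] this]
    show "((\<lambda>x. flat_fn n (q x)) has_derivative ?D x) (at x)" .
  next
    fix b :: 'a assume "b \<in> Basis"
    then have "C_order k (\<lambda>x. frechet_derivative q (at x) b)" using q[of "Suc k"] by simp
    then show "C_order k (\<lambda>x. ?D x b)"
      by (intro C_order_mult C_order_diff C_order_const Suc)
  qed
qed

text \<open>The squared norm is a polynomial in the coordinates, hence smooth also at the
  centre.\<close>

lemma C_order_bump:
  fixes a :: "'a::euclidean_space"
  shows "C_order k (\<lambda>x. flat_fn 0 (r\<^sup>2 - (norm (x - a))\<^sup>2))"
proof (rule C_order_flat_fn)
  fix k
  have "C_order k (\<lambda>x. r\<^sup>2 - (\<Sum>b\<in>Basis. (x \<bullet> b - a \<bullet> b) * (x \<bullet> b - a \<bullet> b)))"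
    by (intro C_order_diff C_order_const C_order_sum C_order_mult C_order_inner)
  moreover have "(norm (x - a))\<^sup>2 = (\<Sum>b\<in>Basis. (x \<bullet> b - a \<bullet> b) * (x \<bullet> b - a \<bullet> b))" for x
    by (simp only: power2_norm_eq_inner euclidean_inner[of "x - a" "x - a"]) (simp add: inner_diff_left)
  ultimately show "C_order k (\<lambda>x. r\<^sup>2 - (norm (x - a))\<^sup>2)" by simp
qed

section \<open>Closure properties of test functions\<close>

lemma test_functionsI:
  assumes "f \<in> test_functions \<Omega>" "\<And>k. C_order k g" "\<And>x. f x = 0 \<Longrightarrow> g x = 0"
  shows "g \<in> test_functions \<Omega>"
proof -
  have sub: "closure {x. g x \<noteq> 0} \<subseteq> closure {x. f x \<noteq> 0}"
    by (rule closure_mono) (use assms(3) in auto)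
  then have "compact (closure {x. g x \<noteq> 0})"
    using assms(1) compact_Int_closed[of "closure {x. f x \<noteq> 0}" "closure {x. g x \<noteq> 0}"]
    by (simp add: test_functions_def inf_absorb2)
  then show ?thesis using assms sub by (auto simp: test_functions_def)
qed

lemma test_functions_add:
  assumes "f \<in> test_functions \<Omega>" "g \<in> test_functions \<Omega>"
  shows "(\<lambda>x. f x + g x) \<in> test_functions \<Omega>"
proof -
  let ?c = "closure {x. f x \<noteq> 0} \<union> closure {x. g x \<noteq> 0}"
  have c: "compact ?c" using assms by (auto simp: test_functions_def)
  have "closure {x. f x + g x \<noteq> 0} \<subseteq> closure ({x. f x \<noteq> 0} \<union> {x. g x \<noteq> 0})"
    by (rule closure_mono) auto
  then have sub: "closure {x. f x + g x \<noteq> 0} \<subseteq> ?c" by (simp add: closure_Un)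
  then have "compact (closure {x. f x + g x \<noteq> 0})"
    using compact_Int_closed[OF c, of "closure {x. f x + g x \<noteq> 0}"] by (simp add: inf_absorb2)
  then show ?thesis using assms sub by (auto simp: test_functions_def intro: C_order_add)
qed

lemma test_functions_smooth: "f \<in> test_functions \<Omega> \<Longrightarrow> C_order k f"
  by (simp add: test_functions_def)

lemma test_functions_mult:
  assumes "f \<in> test_functions \<Omega>" "\<And>k. C_order k g"
  shows "(\<lambda>x. g x * f x) \<in> test_functions \<Omega>"
  by (rule test_functionsI[OF assms(1)]) (auto intro!: C_order_mult assms test_functions_smooth[OF assms(1)])

lemma test_functions_cmult: "f \<in> test_functions \<Omega> \<Longrightarrow> (\<lambda>x. c * f x) \<in> test_functions \<Omega>"
  by (intro test_functions_mult C_order_const)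

text \<open>A smooth substitute for the absolute value of \<open>f\<close>. Subtracting
  \<open>e\<close> makes it vanish where \<open>f\<close> does, so the support stays compact inside
  \<open>\<Omega>\<close>.\<close>

lemma test_functions_smooth_abs:
  assumes "f \<in> test_functions \<Omega>" "e > 0"
  shows "(\<lambda>x. sqrt (f x * f x + e\<^sup>2) - e) \<in> test_functions \<Omega>"
proof (rule test_functionsI[OF assms(1)])
  fix k show "C_order k (\<lambda>x. sqrt (f x * f x + e\<^sup>2) - e)"
    by (intro C_order_diff C_order_sqrt C_order_add C_order_mult C_order_const test_functions_smooth[OF assms(1)])
       (use assms(2) in \<open>simp add: add_nonneg_pos\<close>)
qed (use assms(2) in simp)

lemma test_functions_reflect:
  assumes f: "f \<in> test_functions \<Omega>" and sym: "\<And>x. x \<in> \<Omega> \<Longrightarrow> - x \<in> \<Omega>"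
  shows "(\<lambda>x. f (- x)) \<in> test_functions \<Omega>"
proof -
  have "{x. f (- x) \<noteq> 0} = uminus ` {x. f x \<noteq> 0}" by (force simp: image_iff)
  then have cl: "closure {x. f (- x) \<noteq> 0} = uminus ` closure {x. f x \<noteq> 0}"
    using closure_injective_linear_image[of uminus "{x. f x \<noteq> 0}"] by (simp add: linear_iff)
  have "compact (uminus ` closure {x. f x \<noteq> 0})"
    using f by (auto simp: test_functions_def intro!: compact_negations)
  moreover have "uminus ` closure {x. f x \<noteq> 0} \<subseteq> \<Omega>"
    using f sym by (auto simp: test_functions_def)
  moreover have "\<forall>k. C_order k (\<lambda>x. f (- x))"
    using f by (auto simp: test_functions_def intro!: C_order_reflect)
  ultimately show ?thesis by (simp only: test_functions_def mem_Collect_eq cl) simp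
qed

lemma test_functions_continuous: "f \<in> test_functions \<Omega> \<Longrightarrow> continuous_on UNIV f"
  using test_functions_smooth[of f \<Omega> 0] by simp

lemma test_functions_measurable [measurable_dest]: "f \<in> test_functions \<Omega> \<Longrightarrow> f \<in> borel_measurable borel"
  by (intro borel_measurable_continuous_onI test_functions_continuous)

lemma test_functions_zero: "f \<in> test_functions \<Omega> \<Longrightarrow> x \<notin> \<Omega> \<Longrightarrow> f x = 0"
  using closure_subset[of "{x. f x \<noteq> 0}"] by (auto simp: test_functions_def)

lemma bounded_of_compact_support:
  fixes g :: "'a::euclidean_space \<Rightarrow> real"
  assumes "continuous_on UNIV g" "compact K" "\<And>x. x \<notin> K \<Longrightarrow> g x = 0"
  shows "\<exists>B\<ge>0. \<forall>x. \<bar>g x\<bar> \<le> B"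
proof -
  have "bounded (g ` K)"
    using assms by (intro compact_imp_bounded compact_continuous_image) (auto intro: continuous_on_subset)
  then obtain B where "\<And>x. x \<in> K \<Longrightarrow> \<bar>g x\<bar> \<le> B" by (auto simp: bounded_iff)
  then have "\<forall>x. \<bar>g x\<bar> \<le> max B 0" using assms(3) by (metis abs_zero max.cobounded2 max.coboundedI1)
  then show ?thesis by (intro exI[of _ "max B 0"]) auto
qed

lemma test_functions_bounded:
  assumes "f \<in> test_functions \<Omega>"
  shows "\<exists>B\<ge>0. \<forall>x. \<bar>f x\<bar> \<le> B"
  by (rule bounded_of_compact_support[where K = "closure {x. f x \<noteq> 0}"])
     (use assms closure_subset[of "{x. f x \<noteq> 0}"] in \<open>auto simp: test_functions_continuous test_functions_def\<close>)

text \<open>Partial derivatives are continuous and vanish off the compact support, hence are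
  bounded; the mean value inequality on the convex whole space finishes.\<close>

lemma test_functions_lipschitz:
  fixes f :: "'a::euclidean_space \<Rightarrow> real"
  assumes f: "f \<in> test_functions \<Omega>"
  shows "\<exists>L\<ge>0. \<forall>x y. \<bar>f x - f y\<bar> \<le> L * norm (x - y)"
proof -
  let ?K = "closure {x. f x \<noteq> 0}"
  let ?D = "\<lambda>b x. frechet_derivative f (at x) b"
  have der: "(f has_derivative frechet_derivative f (at x)) (at x)" for x
    by (rule C_order_has_derivative[OF test_functions_smooth[OF f, of "Suc 0"]])
  have "\<exists>B\<ge>0. \<forall>x. \<bar>?D b x\<bar> \<le> B" if b: "b \<in> Basis" for b
  proof (rule bounded_of_compact_support[where K = ?K])
    show "continuous_on UNIV (?D b)" using test_functions_smooth[OF f, of "Suc 0"] b by simp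
    show "compact ?K" using f by (simp add: test_functions_def)
    fix x assume x: "x \<notin> ?K"
    have "(f has_derivative (\<lambda>h. 0)) (at x)"
    proof (rule has_derivative_transform_within_open[of "\<lambda>x. 0" "\<lambda>h. 0" x UNIV "- ?K"])
      show "0 = f y" if "y \<in> - ?K" for y using that closure_subset[of "{x. f x \<noteq> 0}"] by auto
    qed (use x in auto)
    then show "?D b x = 0" using frechet_derivative_at by metis
  qed
  then obtain B where B: "\<And>b. b \<in> Basis \<Longrightarrow> B b \<ge> 0 \<and> (\<forall>x. \<bar>?D b x\<bar> \<le> B b)" by metis
  have on: "onorm (frechet_derivative f (at x)) \<le> (\<Sum>b\<in>Basis. B b)" for x
  proof -
    have "norm (frechet_derivative f (at x) h) \<le> (\<Sum>b\<in>Basis. B b) * norm h" for h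
    proof -
      have lin: "linear (frechet_derivative f (at x))" by (rule has_derivative_linear[OF der])
      have "frechet_derivative f (at x) h = frechet_derivative f (at x) (\<Sum>b\<in>Basis. (h \<bullet> b) *\<^sub>R b)"
        by (simp add: euclidean_representation)
      also have "\<dots> = (\<Sum>b\<in>Basis. (h \<bullet> b) * ?D b x)"
        using lin by (simp add: linear_sum linear_scale)
      also have "norm \<dots> \<le> (\<Sum>b\<in>Basis. norm h * B b)"
        unfolding real_norm_def
        by (rule order_trans[OF sum_abs], rule sum_mono, simp only: abs_mult, rule mult_mono)
           (use B Basis_le_norm in auto)
      finally show ?thesis by (simp add: sum_distrib_left mult.commute)
    qed
    then show ?thesis by (rule onorm_le)
  qed
  have "norm (f x - f y) \<le> (\<Sum>b\<in>Basis. B b) * norm (x - y)" for x y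
    by (rule differentiable_bound[OF convex_UNIV _ on]) (use der in auto)
  then show ?thesis using B by (intro exI[of _ "\<Sum>b\<in>Basis. B b"]) (auto intro: sum_nonneg)
qed

section \<open>The energy space\<close>

lemma distr_lborel_uminus: "distr lborel borel uminus = (lborel :: 'a::euclidean_space measure)"
  using lborel_affine[of "- 1" "0 :: 'a"] by (simp add: density_1 scaleR_minus1_left)

lemma nn_integral_lborel_reflect:
  fixes f :: "'a::euclidean_space \<Rightarrow> ennreal"
  assumes [measurable]: "f \<in> borel_measurable borel"
  shows "(\<integral>\<^sup>+x. f (- x) \<partial>lborel) = (\<integral>\<^sup>+x. f x \<partial>lborel)"
proof -
  have "(\<integral>\<^sup>+x. f x \<partial>lborel) = (\<integral>\<^sup>+x. f x \<partial>distr lborel borel uminus)"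
    by (simp add: distr_lborel_uminus)
  also have "\<dots> = (\<integral>\<^sup>+x. f (- x) \<partial>lborel)" by (rule nn_integral_distr) auto
  finally show ?thesis by simp
qed

lemma integral_lborel_reflect:
  fixes f :: "'a::euclidean_space \<Rightarrow> real"
  assumes [measurable]: "f \<in> borel_measurable borel"
  shows "(LINT x|lborel. f (- x)) = (LINT x|lborel. f x)"
proof -
  have "(LINT x|lborel. f x) = (LINT x|distr lborel borel uminus. f x)"
    by (simp add: distr_lborel_uminus)
  also have "\<dots> = (LINT x|lborel. f (- x))" by (rule integral_distr) auto
  finally show ?thesis by simp
qed

text \<open>Preimages of null sets under a measure preserving map are null. It serves the reflection
  here and rotations later.\<close>

lemma AE_lborel_distr:
  fixes P :: "'a::euclidean_space \<Rightarrow> bool"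
  assumes T [measurable]: "T \<in> borel_measurable borel" and dT: "distr lborel borel T = lborel" and P: "AE x in lborel. P x"
  shows "AE x in lborel. P (T x)"
proof -
  obtain N where N: "N \<in> sets borel" "emeasure lborel N = 0" "{x. \<not> P x} \<subseteq> N"
    using P by (auto elim!: AE_E)
  have "emeasure lborel (T -` N \<inter> space lborel) = emeasure (distr lborel borel T) N"
    using N by (subst emeasure_distr) auto
  then have "T -` N \<in> null_sets lborel"
    using N measurable_sets[OF T, of N] by (auto simp: dT null_sets_def)
  then show ?thesis by (rule AE_I') (use N in auto)
qed

lemma AE_lborel_reflect:
  fixes P :: "'a::euclidean_space \<Rightarrow> bool"
  shows "AE x in lborel. P x \<Longrightarrow> AE x in lborel. P (- x)"
  by (rule AE_lborel_distr[OF _ distr_lborel_uminus]) auto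

lemma frac_integrand_reflect:
  "frac_integrand s (\<lambda>x. u (- x)) (\<lambda>x. v (- x)) p = frac_integrand s u v (- p)"
  by (cases p) (simp add: frac_integrand_kern kern_def norm_minus_commute)

lemma fin_en_reflect:
  assumes "fin_en s u"
  shows "fin_en s (\<lambda>x. u (- x))"
proof (rule fin_enI)
  have [measurable]: "u \<in> borel_measurable borel" using assms by (rule fin_en_measurable)
  show "(\<lambda>x. u (- x)) \<in> borel_measurable borel" by measurable
  have "(\<integral>\<^sup>+p. ennreal (density s u (- p)) \<partial>lborel) = (\<integral>\<^sup>+p. ennreal (density s u p) \<partial>lborel)"
    by (rule nn_integral_lborel_reflect) auto
  then show "(\<integral>\<^sup>+p. ennreal (density s (\<lambda>x. u (- x)) p) \<partial>lborel) < \<infinity>"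
    using nn_integral_frac_integrand[OF assms] by (simp add: frac_integrand_reflect)
qed

lemma en_reflect:
  assumes [measurable]: "u \<in> borel_measurable borel" "v \<in> borel_measurable borel"
  shows "en s (\<lambda>x. u (- x)) (\<lambda>x. v (- x)) = en s u v"
  unfolding en_def frac_integrand_reflect by (rule integral_lborel_reflect) measurable

text \<open>The kernel depends on differences only, so a shift of the function is a diagonal
  translation of the product space. A bump therefore has the same energy wherever it is
  placed.\<close>

lemma nn_integral_frac_integrand_shift:
  assumes [measurable]: "u \<in> borel_measurable borel"
  shows "(\<integral>\<^sup>+p. ennreal (density s (\<lambda>x. u (c + x)) p) \<partial>lborel)
     = (\<integral>\<^sup>+p. ennreal (density s u p) \<partial>lborel)"
proof -
  have "density s (\<lambda>x. u (c + x)) p = density s u ((c, c) + p)" for p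
    by (cases p) (simp add: frac_integrand_kern kern_def)
  then show ?thesis
    by (simp add: nn_integral_lborel_shift[of "\<lambda>p. ennreal (density s u p)"])
qed

lemma fin_en_shift:
  assumes "fin_en s u"
  shows "fin_en s (\<lambda>x. u (c + x))"
proof (rule fin_enI)
  have [measurable]: "u \<in> borel_measurable borel" using assms by (rule fin_en_measurable)
  show "(\<lambda>x. u (c + x)) \<in> borel_measurable borel" by measurable
  show "(\<integral>\<^sup>+p. ennreal (density s (\<lambda>x. u (c + x)) p) \<partial>lborel) < \<infinity>"
    using nn_integral_frac_integrand[OF assms] by (simp add: nn_integral_frac_integrand_shift)
qed

lemma en_shift:
  assumes "fin_en s u"
  shows "energy s (\<lambda>x. u (c + x)) = energy s u"
  using nn_integral_frac_integrand[OF assms] nn_integral_frac_integrand[OF fin_en_shift[OF assms, of c]]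
    nn_integral_frac_integrand_shift[OF fin_en_measurable[OF assms], of s c] by (simp add: en_nonneg)

text \<open>For fixed \<open>x\<close> the inner integral is that of a reflected translate of
  \<open>g\<close>, hence independent of \<open>x\<close>.\<close>

lemma nn_integral_convolution_fst:
  fixes g h :: "'a::euclidean_space \<Rightarrow> ennreal"
  assumes [measurable]: "g \<in> borel_measurable borel" "h \<in> borel_measurable borel"
    and even: "\<And>z. g (- z) = g z"
  shows "(\<integral>\<^sup>+p. h (fst p) * g (fst p - snd p) \<partial>lborel) = (\<integral>\<^sup>+x. h x \<partial>lborel) * (\<integral>\<^sup>+z. g z \<partial>lborel)"
proof -
  have "(\<integral>\<^sup>+p. h (fst p) * g (fst p - snd p) \<partial>lborel) = (\<integral>\<^sup>+x. \<integral>\<^sup>+y. h x * g (x - y) \<partial>lborel \<partial>lborel)"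
    by (subst nn_integral_lborel_pair) auto
  also have "\<dots> = (\<integral>\<^sup>+x. h x * (\<integral>\<^sup>+z. g z \<partial>lborel) \<partial>lborel)"
  proof (rule nn_integral_cong)
    fix x :: 'a
    have "(\<integral>\<^sup>+y. g (x - y) \<partial>lborel) = (\<integral>\<^sup>+y. g (- x + y) \<partial>lborel)"
      by (rule nn_integral_cong) (use even in \<open>metis add.commute minus_diff_eq uminus_add_conv_diff\<close>)
    also have "\<dots> = (\<integral>\<^sup>+z. g z \<partial>lborel)" by (rule nn_integral_lborel_shift) auto
    finally show "(\<integral>\<^sup>+y. h x * g (x - y) \<partial>lborel) = h x * (\<integral>\<^sup>+z. g z \<partial>lborel)"
      by (simp add: nn_integral_cmult)
  qed
  finally show ?thesis by (simp add: nn_integral_multc)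
qed

lemma nn_integral_convolution_snd:
  fixes g h :: "'a::euclidean_space \<Rightarrow> ennreal"
  assumes [measurable]: "g \<in> borel_measurable borel" "h \<in> borel_measurable borel"
    and even: "\<And>z. g (- z) = g z"
  shows "(\<integral>\<^sup>+p. h (snd p) * g (fst p - snd p) \<partial>lborel) = (\<integral>\<^sup>+x. h x \<partial>lborel) * (\<integral>\<^sup>+z. g z \<partial>lborel)"
proof -
  have "(\<integral>\<^sup>+p. h (snd p) * g (fst p - snd p) \<partial>lborel) = (\<integral>\<^sup>+y. \<integral>\<^sup>+x. h y * g (x - y) \<partial>lborel \<partial>lborel)"
    by (subst nn_integral_lborel_pair') auto
  also have "\<dots> = (\<integral>\<^sup>+y. h y * (\<integral>\<^sup>+z. g z \<partial>lborel) \<partial>lborel)"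
  proof (rule nn_integral_cong)
    fix y :: 'a
    have "(\<integral>\<^sup>+x. g (x - y) \<partial>lborel) = (\<integral>\<^sup>+x. g (- y + x) \<partial>lborel)"
      by (rule nn_integral_cong) simp
    also have "\<dots> = (\<integral>\<^sup>+z. g z \<partial>lborel)" by (rule nn_integral_lborel_shift) auto
    finally show "(\<integral>\<^sup>+x. h y * g (x - y) \<partial>lborel) = h y * (\<integral>\<^sup>+z. g z \<partial>lborel)"
      by (simp add: nn_integral_cmult)
  qed
  finally show ?thesis by (simp add: nn_integral_multc)
qed

lemma norm_square_kern: "norm z ^ 2 * kern s z = norm (z::'a::euclidean_space) powr (- (real DIM('a) + 2 * s - 2))"
proof (cases "z = 0")
  case False
  then have "norm z ^ 2 = norm z powr 2" by simp
  then show ?thesis unfolding kern_def by (simp only: powr_add[symmetric]) (simp add: algebra_simps)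
qed (simp add: kern_def)

text \<open>The exponent is \<open>N + 2 s - 2\<close>: nonnegative because \<open>N\<close> is at
  least 2 and below \<open>N\<close> because \<open>s < 1\<close>. This is the source of the growth
  rate \<open>2 - 2 * s\<close>.\<close>

lemma nn_integral_norm_square_kern:
  fixes s :: real
  assumes "0 < s" "s < 1" "2 \<le> DIM('a::euclidean_space)"
  shows "\<exists>C>0. \<forall>\<rho>>0. (\<integral>\<^sup>+z. ennreal (norm z ^ 2 * kern s (z::'a)) * indicator (cball 0 \<rho>) z \<partial>lborel)
    \<le> ennreal (C * \<rho> powr (2 - 2 * s))"
proof -
  have "0 \<le> real DIM('a) + 2 * s - 2" "real DIM('a) + 2 * s - 2 < real DIM('a)"
    using assms by auto
  from nn_integral_powr_cball[OF this] show ?thesis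
    unfolding norm_square_kern by (simp add: algebra_simps)
qed

section \<open>The space \<open>H\<close> on a bounded domain: test functions, Poincare inequality,
  linear structure\<close>

locale frac_domain =
  fixes s :: real and \<Omega> :: "'a::euclidean_space set"
  assumes s_pos: "0 < s" and s_less: "s < 1" and dim: "2 \<le> DIM('a)"
    and bounded_dom: "bounded \<Omega>" and meas_dom [measurable]: "\<Omega> \<in> sets borel"
begin

definition vanishing :: "('a \<Rightarrow> real) \<Rightarrow> bool" where
  "vanishing u \<longleftrightarrow> (AE x in lborel. x \<notin> \<Omega> \<longrightarrow> u x = 0)"

abbreviation "H \<equiv> frac_sobolev0 s \<Omega>"
abbreviation "tf \<equiv> test_functions \<Omega>"
definition cst :: real where "cst = frac_const DIM('a) s / 2"

lemma cst_pos: "cst > 0"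
  unfolding cst_def using frac_const_pos[OF s_pos s_less] by simp

lemma frac_form_cst: "frac_form s u v = cst * en s u (v :: 'a \<Rightarrow> real)"
  by (simp add: frac_form_en cst_def)

lemma emeasure_dom_finite: "emeasure lborel \<Omega> < \<infinity>"
  by (rule emeasure_bounded_finite[OF bounded_dom])

text \<open>The kernel is split at distance 1: the Lipschitz bound tames the singularity, the sup
  bound the tail. The integrand vanishes unless one of the two points lies in
  \<open>\<Omega>\<close>, so the energy is at most twice the volume of \<open>\<Omega>\<close>
  times the integral of \<open>g\<close>.\<close>

lemma tf_fin_en:
  assumes u: "u \<in> tf"
  shows "fin_en s u"
proof (rule fin_enI)
  have [measurable]: "u \<in> borel_measurable borel" using u by (rule test_functions_measurable)
  then show "u \<in> borel_measurable borel" .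
  obtain B where B: "B \<ge> 0" "\<And>x. \<bar>u x\<bar> \<le> B" using test_functions_bounded[OF u] by blast
  obtain L where L: "L \<ge> 0" "\<And>x y. \<bar>u x - u y\<bar> \<le> L * norm (x - y)" using test_functions_lipschitz[OF u] by blast
  define g :: "'a \<Rightarrow> ennreal" where "g z = ennreal (L\<^sup>2) * (ennreal (norm z ^ 2 * kern s z) * indicator (cball 0 1) z)
    + ennreal ((2 * B)\<^sup>2) * (ennreal (kern s z) * indicator (- ball 0 1) z)" for z
  have [measurable]: "cball (0::'a) 1 \<in> sets borel" "- ball (0::'a) 1 \<in> sets borel" by auto
  have [measurable]: "g \<in> borel_measurable borel" unfolding g_def by measurable
  have even: "g (- z) = g z" for z by (simp add: g_def kern_def indicator_def)
  have pw: "ennreal (density s u p) \<le> indicator \<Omega> (fst p) * g (fst p - snd p) + indicator \<Omega> (snd p) * g (fst p - snd p)" for p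
  proof -
    obtain x y where p: "p = (x, y)" by (cases p)
    have *: "ennreal (density s u (x, y)) \<le> g (x - y)"
    proof (cases "norm (x - y) \<le> 1")
      case True
      have "(u x - u y) * (u x - u y) \<le> L\<^sup>2 * norm (x - y) ^ 2"
        using power_mono[OF L(2)[of x y], of 2] by (simp add: power2_eq_square[of "u x - u y"] power_mult_distrib)
      then have "density s u (x, y) \<le> L\<^sup>2 * (norm (x - y) ^ 2 * kern s (x - y))"
        unfolding frac_integrand_kern mult.assoc[symmetric] by (intro mult_right_mono) auto
      then have "ennreal (density s u (x, y)) \<le> ennreal (L\<^sup>2) * (ennreal (norm (x - y) ^ 2 * kern s (x - y)) * indicator (cball 0 1) (x - y))"
        using True by (simp add: ennreal_mult'[symmetric] ennreal_leI)
      then show ?thesis unfolding g_def by (rule add_increasing2[rotated]) simp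
    next
      case False
      have "\<bar>u x - u y\<bar> \<le> 2 * B" using B(2)[of x] B(2)[of y] by linarith
      then have "(u x - u y) * (u x - u y) \<le> (2 * B)\<^sup>2"
        using power_mono[of "\<bar>u x - u y\<bar>" "2 * B" 2] by (simp add: power2_eq_square[of "u x - u y"])
      then have "density s u (x, y) \<le> (2 * B)\<^sup>2 * kern s (x - y)"
        unfolding frac_integrand_kern by (intro mult_right_mono) auto
      then have "ennreal (density s u (x, y)) \<le> ennreal ((2 * B)\<^sup>2) * (ennreal (kern s (x - y)) * indicator (- ball 0 1) (x - y))"
        using False by (simp add: ennreal_mult'[symmetric] ennreal_leI)
      then show ?thesis unfolding g_def by (rule add_increasing[rotated]) simp
    qed
    show ?thesis
    proof (cases "x \<in> \<Omega> \<or> y \<in> \<Omega>")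
      case True
      then show ?thesis using * unfolding p by (auto simp: indicator_def intro: add_increasing2)
    next
      case False
      then show ?thesis unfolding p by (simp add: frac_integrand_kern test_functions_zero[OF u])
    qed
  qed
  have gfin: "(\<integral>\<^sup>+z. g z \<partial>lborel) < \<infinity>"
  proof -
    obtain C where "\<And>\<rho>. \<rho> > 0 \<Longrightarrow> (\<integral>\<^sup>+z. ennreal (norm z ^ 2 * kern s (z::'a)) * indicator (cball 0 \<rho>) z \<partial>lborel) \<le> ennreal (C * \<rho> powr (2 - 2 * s))"
      using nn_integral_norm_square_kern[OF s_pos s_less dim] by blast
    from this[of 1] have C: "(\<integral>\<^sup>+z. ennreal (norm z ^ 2 * kern s (z::'a)) * indicator (cball 0 1) z \<partial>lborel) \<le> ennreal C"
      by simp
    have C': "(\<integral>\<^sup>+z. ennreal (kern s (z::'a)) * indicator (- ball 0 1) z \<partial>lborel) < \<infinity>"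
      unfolding kern_def by (rule nn_integral_powr_outside_ball) (use s_pos in simp)
    have "(\<integral>\<^sup>+z. g z \<partial>lborel) = ennreal (L\<^sup>2) * (\<integral>\<^sup>+z. ennreal (norm z ^ 2 * kern s (z::'a)) * indicator (cball 0 1) z \<partial>lborel)
      + ennreal ((2 * B)\<^sup>2) * (\<integral>\<^sup>+z. ennreal (kern s (z::'a)) * indicator (- ball 0 1) z \<partial>lborel)"
      unfolding g_def by (simp add: nn_integral_add nn_integral_cmult)
    also have "\<dots> < \<infinity>" using C C' le_less_trans[OF C ennreal_less_top]
      by (simp add: ennreal_mult_less_top ennreal_add_less_top)
    finally show ?thesis .
  qed
  have "(\<integral>\<^sup>+p. ennreal (density s u p) \<partial>lborel)
    \<le> (\<integral>\<^sup>+p. (indicator \<Omega> (fst p) * g (fst p - snd p) + indicator \<Omega> (snd p) * g (fst p - snd p)) \<partial>lborel)"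
    by (rule nn_integral_mono) (rule pw)
  also have "\<dots> = (\<integral>\<^sup>+p. indicator \<Omega> (fst p) * g (fst p - snd p) \<partial>lborel) + (\<integral>\<^sup>+p. indicator \<Omega> (snd p) * g (fst p - snd p) \<partial>lborel)"
    by (rule nn_integral_add) measurable
  also have "\<dots> = 2 * (emeasure lborel \<Omega> * (\<integral>\<^sup>+z. g z \<partial>lborel))"
    by (subst nn_integral_convolution_fst nn_integral_convolution_snd; (simp add: even mult_2)?)+
  also have "\<dots> < \<infinity>" using gfin emeasure_dom_finite by (simp add: ennreal_mult_less_top)
  finally show "(\<integral>\<^sup>+p. ennreal (density s u p) \<partial>lborel) < \<infinity>" .
qed

lemma poincare:
  "\<exists>C>0. \<forall>u. fin_en s u \<longrightarrow> vanishing u \<longrightarrow> integrable lborel (\<lambda>x. u x * u x) \<and> (LINT x|lborel. u x * u x) \<le> C * energy s u"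
proof -
  obtain C where C: "C > 0" "\<And>u. u \<in> borel_measurable borel \<Longrightarrow> (AE x in lborel. x \<notin> \<Omega> \<longrightarrow> u x = 0) \<Longrightarrow>
    (\<integral>\<^sup>+x. ennreal (u x * u x) \<partial>lborel) \<le> ennreal C * (\<integral>\<^sup>+p. ennreal (density s u p) \<partial>lborel)"
    using nn_integral_square_le_energy[OF s_pos bounded_dom] by blast
  have "integrable lborel (\<lambda>x. u x * u x) \<and> (LINT x|lborel. u x * u x) \<le> C * energy s u"
    if u: "fin_en s u" "vanishing u" for u
  proof -
    have [measurable]: "u \<in> borel_measurable borel" by (rule fin_en_measurable[OF u(1)])
    have b: "(\<integral>\<^sup>+x. ennreal (u x * u x) \<partial>lborel) \<le> ennreal (C * energy s u)"
      using C(2)[of u] u nn_integral_frac_integrand[OF u(1)] C(1) by (simp add: vanishing_def ennreal_mult')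
    then have i: "integrable lborel (\<lambda>x. u x * u x)"
      by (intro integrableI_nonneg) (auto simp: less_top[symmetric] top_unique)
    have "ennreal (LINT x|lborel. u x * u x) \<le> ennreal (C * energy s u)"
      using b nn_integral_eq_integral[OF i] by simp
    then show ?thesis using i C(1) en_nonneg[of s u] by simp
  qed
  then show ?thesis using C(1) by blast
qed

lemma vanishing_add: "vanishing u \<Longrightarrow> vanishing v \<Longrightarrow> vanishing (\<lambda>x. u x + v x)"
  unfolding vanishing_def by (erule (1) eventually_elim2) auto

lemma vanishing_diff: "vanishing u \<Longrightarrow> vanishing v \<Longrightarrow> vanishing (\<lambda>x. u x - v x)"
  unfolding vanishing_def by (erule (1) eventually_elim2) auto

lemma vanishing_mult: "vanishing u \<Longrightarrow> vanishing (\<lambda>x. f x * u x)"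
  unfolding vanishing_def by (erule eventually_mono) auto

text \<open>The definition only requires the differences \<open>v k - u\<close> to have finite
  energy; writing \<open>u\<close> as \<open>v 0 - (v 0 - u)\<close> shows that \<open>u\<close>
  itself has.\<close>

lemma H_iff: "u \<in> H \<longleftrightarrow> fin_en s u \<and> vanishing u \<and>
   (\<exists>v. (\<forall>k::nat. v k \<in> tf) \<and> (\<lambda>k. energy s (\<lambda>x. v k x - u x)) \<longlonglongrightarrow> 0)"
proof
  assume "u \<in> H"
  then obtain v where u: "u \<in> borel_measurable borel" "vanishing u"
    and v: "\<And>k::nat. v k \<in> tf" "\<And>k. integrable lborel (density s (\<lambda>x. v k x - u x))"
    "(\<lambda>k. frac_form s (\<lambda>x. v k x - u x) (\<lambda>x. v k x - u x)) \<longlonglongrightarrow> 0"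
    unfolding frac_sobolev0_def vanishing_def by blast
  have f: "fin_en s (\<lambda>x. v k x - u x)" for k
    using v(2) u(1) test_functions_measurable[OF v(1)] by (simp add: fin_en_def)
  have "fin_en s (\<lambda>x. v 0 x - (v 0 x - u x))" by (rule fin_en_diff[OF tf_fin_en[OF v(1)] f])
  then have "fin_en s u" by simp
  moreover have "(\<lambda>k. energy s (\<lambda>x. v k x - u x)) \<longlonglongrightarrow> 0"
    using tendsto_mult_left[OF v(3), of "1 / cst"] cst_pos by (simp add: frac_form_cst)
  ultimately show "fin_en s u \<and> vanishing u \<and>
   (\<exists>v. (\<forall>k::nat. v k \<in> tf) \<and> (\<lambda>k. energy s (\<lambda>x. v k x - u x)) \<longlonglongrightarrow> 0)"
    using u v by blast
next
  assume "fin_en s u \<and> vanishing u \<and>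
   (\<exists>v. (\<forall>k::nat. v k \<in> tf) \<and> (\<lambda>k. energy s (\<lambda>x. v k x - u x)) \<longlonglongrightarrow> 0)"
  then obtain v where u: "fin_en s u" "vanishing u" and v: "\<And>k::nat. v k \<in> tf"
    "(\<lambda>k. energy s (\<lambda>x. v k x - u x)) \<longlonglongrightarrow> 0" by blast
  have "(\<lambda>k. frac_form s (\<lambda>x. v k x - u x) (\<lambda>x. v k x - u x)) \<longlonglongrightarrow> 0"
    using tendsto_mult_left[OF v(2), of cst] by (simp add: frac_form_cst)
  moreover have "integrable lborel (density s (\<lambda>x. v k x - u x))" for k
    using fin_en_diff[OF tf_fin_en[OF v(1)] u(1)] by (simp add: fin_en_def)
  ultimately show "u \<in> H" using u v fin_en_measurable[OF u(1)]
    unfolding frac_sobolev0_def vanishing_def by blast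
qed

lemma H_fin_en: "u \<in> H \<Longrightarrow> fin_en s u" and H_vanishing: "u \<in> H \<Longrightarrow> vanishing u"
  by (simp_all add: H_iff)

lemma H_measurable: "u \<in> H \<Longrightarrow> u \<in> borel_measurable borel"
  using H_fin_en fin_en_measurable by blast

lemma H_integrable_square: "u \<in> H \<Longrightarrow> integrable lborel (\<lambda>x. u x * u x)"
  using poincare H_fin_en H_vanishing by blast

lemma H_integrable_mult: "u \<in> H \<Longrightarrow> v \<in> H \<Longrightarrow> integrable lborel (\<lambda>x. u x * v x)"
  by (rule integrable_mult_of_squares) (auto intro: H_measurable H_integrable_square)

lemma tf_vanishing: "u \<in> tf \<Longrightarrow> vanishing u"
  by (simp add: vanishing_def test_functions_zero)

lemma tf_H: "u \<in> tf \<Longrightarrow> u \<in> H"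
  unfolding H_iff by (auto simp: tf_fin_en tf_vanishing en_def frac_integrand_def case_prod_beta intro!: exI[of _ "\<lambda>_. u"])

text \<open>\<open>H\<close> is closed under energy limits: each \<open>w k\<close> is replaced by a
  test function at energy distance below \<open>1 / Suc k\<close>.\<close>

lemma H_limit:
  assumes u: "fin_en s u" "vanishing u" and w: "\<And>k::nat. w k \<in> H"
    and lim: "(\<lambda>k. energy s (\<lambda>x. w k x - u x)) \<longlonglongrightarrow> 0"
  shows "u \<in> H"
proof -
  have "\<exists>v\<in>tf. energy s (\<lambda>x. v x - w k x) < 1 / real (Suc k)" for k
  proof -
    obtain v where v: "\<And>j::nat. v j \<in> tf" "(\<lambda>j. energy s (\<lambda>x. v j x - w k x)) \<longlonglongrightarrow> 0"
      using w[of k] unfolding H_iff by blast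
    have "eventually (\<lambda>j. energy s (\<lambda>x. v j x - w k x) < 1 / real (Suc k)) sequentially"
      by (rule order_tendstoD(2)[OF v(2)]) simp
    then show ?thesis using v(1) by (meson eventually_sequentially order_refl)
  qed
  then obtain v where v: "\<And>k. v k \<in> tf" "\<And>k. energy s (\<lambda>x. v k x - w k x) < 1 / real (Suc k)" by metis
  have le: "energy s (\<lambda>x. v k x - u x) \<le> 2 * (1 / real (Suc k)) + 2 * energy s (\<lambda>x. w k x - u x)" for k
  proof -
    have "energy s (\<lambda>x. (v k x - w k x) + (w k x - u x))
       \<le> 2 * energy s (\<lambda>x. v k x - w k x) + 2 * energy s (\<lambda>x. w k x - u x)"
      by (intro en_add_le fin_en_diff tf_fin_en v H_fin_en w u)
    then show ?thesis using v(2)[of k] by simp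
  qed
  have "(\<lambda>k. energy s (\<lambda>x. v k x - u x)) \<longlonglongrightarrow> 0"
  proof (rule tendsto_sandwich[OF _ _ tendsto_const])
    show "\<forall>\<^sub>F k in sequentially. 0 \<le> energy s (\<lambda>x. v k x - u x)" by (simp add: en_nonneg)
    show "\<forall>\<^sub>F k in sequentially. energy s (\<lambda>x. v k x - u x) \<le> 2 * (1 / real (Suc k)) + 2 * energy s (\<lambda>x. w k x - u x)"
      using le by simp
    have "(\<lambda>k. 2 * (1 / real (Suc k)) + 2 * energy s (\<lambda>x. w k x - u x)) \<longlonglongrightarrow> 2 * 0 + 2 * 0"
      using lim LIMSEQ_inverse_real_of_nat by (intro tendsto_intros) (simp add: inverse_eq_divide)
    then show "(\<lambda>k. 2 * (1 / real (Suc k)) + 2 * energy s (\<lambda>x. w k x - u x)) \<longlonglongrightarrow> 0" by simp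
  qed
  then show ?thesis using u v(1) unfolding H_iff by blast
qed

lemma H_cmult:
  assumes "u \<in> H"
  shows "(\<lambda>x. c * u x) \<in> H"
proof -
  obtain v where v: "\<And>k::nat. v k \<in> tf" "(\<lambda>k. energy s (\<lambda>x. v k x - u x)) \<longlonglongrightarrow> 0"
    using assms unfolding H_iff by blast
  have "energy s (\<lambda>x. c * v k x - c * u x) = c * c * energy s (\<lambda>x. v k x - u x)" for k
    using en_cmult_left[of s c "\<lambda>x. v k x - u x"] en_cmult_right[of s _ c "\<lambda>x. v k x - u x"] by (simp add: right_diff_distrib)
  then have "(\<lambda>k. energy s (\<lambda>x. c * v k x - c * u x)) \<longlonglongrightarrow> 0"
    using tendsto_mult_left[OF v(2), of "c * c"] by simp
  with H_limit[OF fin_en_cmult[OF H_fin_en[OF assms]] vanishing_mult[OF H_vanishing[OF assms]]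
      tf_H[OF test_functions_cmult[OF v(1)]]]
  show ?thesis .
qed

lemma H_add:
  assumes u: "u \<in> H" and w: "w \<in> H"
  shows "(\<lambda>x. u x + w x) \<in> H"
proof -
  obtain v where v: "\<And>k::nat. v k \<in> tf" "(\<lambda>k. energy s (\<lambda>x. v k x - u x)) \<longlonglongrightarrow> 0"
    using u unfolding H_iff by blast
  obtain z where z: "\<And>k::nat. z k \<in> tf" "(\<lambda>k. energy s (\<lambda>x. z k x - w x)) \<longlonglongrightarrow> 0"
    using w unfolding H_iff by blast
  have le: "energy s (\<lambda>x. (v k x + z k x) - (u x + w x))
     \<le> 2 * energy s (\<lambda>x. v k x - u x) + 2 * energy s (\<lambda>x. z k x - w x)" for k
  proof -
    have "(\<lambda>x. (v k x + z k x) - (u x + w x)) = (\<lambda>x. (v k x - u x) + (z k x - w x))" by auto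
    then show ?thesis
      using en_add_le[of s "\<lambda>x. v k x - u x" "\<lambda>x. z k x - w x"] v z u w
      by (simp add: fin_en_diff tf_fin_en H_fin_en)
  qed
  have "(\<lambda>k. energy s (\<lambda>x. (v k x + z k x) - (u x + w x))) \<longlonglongrightarrow> 0"
  proof (rule tendsto_sandwich[OF _ _ tendsto_const])
    have "(\<lambda>k. 2 * energy s (\<lambda>x. v k x - u x) + 2 * energy s (\<lambda>x. z k x - w x)) \<longlonglongrightarrow> 2 * 0 + 2 * 0"
      by (intro tendsto_intros v z)
    then show "(\<lambda>k. 2 * energy s (\<lambda>x. v k x - u x) + 2 * energy s (\<lambda>x. z k x - w x)) \<longlonglongrightarrow> 0" by simp
  qed (auto simp: en_nonneg le)
  with H_limit[OF fin_en_add[OF H_fin_en[OF u] H_fin_en[OF w]] vanishing_add[OF H_vanishing[OF u] H_vanishing[OF w]]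
      tf_H[OF test_functions_add[OF v(1) z(1)]]]
  show ?thesis .
qed

lemma H_diff: "u \<in> H \<Longrightarrow> w \<in> H \<Longrightarrow> (\<lambda>x. u x - w x) \<in> H"
  using H_add[of u "\<lambda>x. -1 * w x"] H_cmult[of w "-1"] by simp

end

section \<open>Stability of \<open>H\<close> under absolute values, multiplication by coordinates
  and reflection\<close>

context frac_domain
begin

lemma H_AE_convergent_subseq:
  assumes w: "\<And>k::nat. fin_en s (w k)" "\<And>k. vanishing (w k)"
    and lim: "(\<lambda>k. energy s (w k)) \<longlonglongrightarrow> 0"
  shows "\<exists>r. strict_mono r \<and> (AE x in lborel. (\<lambda>k. w (r k) x) \<longlonglongrightarrow> 0)"
proof -
  obtain C where C: "C > 0" "\<And>u. fin_en s u \<Longrightarrow> vanishing u \<Longrightarrow> integrable lborel (\<lambda>x. u x * u x) \<and> (LINT x|lborel. u x * u x) \<le> C * energy s u"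
    using poincare by blast
  have "(\<lambda>k. LINT x|lborel. norm (w k x * w k x)) \<longlonglongrightarrow> 0"
  proof (rule tendsto_sandwich[OF _ _ tendsto_const])
    show "(\<lambda>k. C * energy s (w k)) \<longlonglongrightarrow> 0" using tendsto_mult_left[OF lim, of C] by simp
    show "\<forall>\<^sub>F k in sequentially. (LINT x|lborel. norm (w k x * w k x)) \<le> C * energy s (w k)"
      using C(2) w by simp
  qed simp
  moreover have "integrable lborel (\<lambda>x. w k x * w k x)" for k using C(2) w by blast
  ultimately obtain r where r: "strict_mono r" "AE x in lborel. (\<lambda>k. w (r k) x * w (r k) x) \<longlonglongrightarrow> 0"
    using tendsto_L1_AE_subseq[of lborel "\<lambda>k x. w k x * w k x"] by blast
  have "AE x in lborel. (\<lambda>k. w (r k) x) \<longlonglongrightarrow> 0"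
    using r(2)
  proof eventually_elim
    fix x assume "(\<lambda>k. w (r k) x * w (r k) x) \<longlonglongrightarrow> 0"
    then have "(\<lambda>k. sqrt (w (r k) x * w (r k) x)) \<longlonglongrightarrow> sqrt 0" by (rule tendsto_real_sqrt)
    then show "(\<lambda>k. w (r k) x) \<longlonglongrightarrow> 0" by (simp add: tendsto_rabs_zero_iff)
  qed
  then show ?thesis using r(1) by blast
qed

text \<open>Dominated convergence with a moving majorant. The part
  \<open>a * density s (F k)\<close> tends to 0 in mean; what exceeds it is dominated by the fixed
  function \<open>b * density s G\<close>.\<close>

lemma en_tendsto_0_dominated:
  fixes D F :: "nat \<Rightarrow> 'a \<Rightarrow> real"
  assumes D: "\<And>k::nat. fin_en s (D k)" and F: "\<And>k. fin_en s (F k)" and G: "fin_en s G"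
    and le: "\<And>k p. density s (D k) p \<le> a * density s (F k) p + b * density s G p"
    and a: "0 \<le> a" and b: "0 \<le> b"
    and F0: "(\<lambda>k. energy s (F k)) \<longlonglongrightarrow> 0"
    and D0: "AE x in lborel. (\<lambda>k. D k x) \<longlonglongrightarrow> 0"
  shows "(\<lambda>k. energy s (D k)) \<longlonglongrightarrow> 0"
proof -
  note [measurable] = fin_en_measurable[OF D] fin_en_measurable[OF F] fin_en_measurable[OF G]
  \<comment> \<open>The excess over the moving part of the majorant: dominated, and tending to 0
    almost everywhere.\<close>
  define m where "m k p = max 0 (density s (D k) p - a * density s (F k) p)" for k p
  have m_int: "integrable lborel (m k)" for k
    unfolding m_def using integrable_frac_integrand[OF D D] integrable_frac_integrand[OF F F] by (intro integrable_max) auto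
  have D0': "AE p in lborel. (\<lambda>k. density s (D k) p) \<longlonglongrightarrow> 0"
    using AE_lborel_fst[OF D0] AE_lborel_snd[OF D0]
  proof eventually_elim
    fix p :: "'a \<times> 'a" assume "(\<lambda>k. D k (fst p)) \<longlonglongrightarrow> 0" "(\<lambda>k. D k (snd p)) \<longlonglongrightarrow> 0"
    then have "(\<lambda>k. (D k (fst p) - D k (snd p)) * (D k (fst p) - D k (snd p)) * kern s (fst p - snd p)) \<longlonglongrightarrow> (0 - 0) * (0 - 0) * kern s (fst p - snd p)"
      by (intro tendsto_intros)
    then show "(\<lambda>k. density s (D k) p) \<longlonglongrightarrow> 0"
      using frac_integrand_kern[of s _ _ "fst p" "snd p"] by simp
  qed
  have m0: "AE p in lborel. (\<lambda>k. m k p) \<longlonglongrightarrow> 0"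
    using D0'
  proof eventually_elim
    fix p assume l: "(\<lambda>k. density s (D k) p) \<longlonglongrightarrow> 0"
    show "(\<lambda>k. m k p) \<longlonglongrightarrow> 0"
    proof (rule tendsto_sandwich[OF _ _ tendsto_const l])
      show "\<forall>\<^sub>F k in sequentially. m k p \<le> density s (D k) p"
        by (intro always_eventually allI) (simp add: m_def frac_integrand_nonneg a)
    qed (simp add: m_def)
  qed
  have "(\<lambda>k. LINT p|lborel. m k p) \<longlonglongrightarrow> (LINT p|(lborel :: ('a \<times> 'a) measure). 0)"
  proof (rule integral_dominated_convergence[where w = "\<lambda>p. b * density s G p"])
    show "integrable lborel (\<lambda>p. b * density s G p)" using integrable_frac_integrand[OF G G] by simp
    show "AE p in lborel. norm (m k p) \<le> b * density s G p" for k
    proof (rule AE_I2)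
      fix p
      have "0 \<le> b * density s G p" by (rule mult_nonneg_nonneg[OF b frac_integrand_nonneg])
      then show "norm (m k p) \<le> b * density s G p" using le[of k p] by (simp add: m_def)
    qed
  qed (use m0 m_int in auto)
  then have mlim: "(\<lambda>k. LINT p|lborel. m k p) \<longlonglongrightarrow> 0" by simp
  show ?thesis
  proof (rule tendsto_sandwich[OF _ _ tendsto_const])
    show "(\<lambda>k. (LINT p|lborel. m k p) + a * energy s (F k)) \<longlonglongrightarrow> 0"
      using tendsto_add[OF mlim tendsto_mult_left[OF F0, of a]] by simp
    have "energy s (D k) \<le> (LINT p|lborel. m k p) + a * energy s (F k)" for k
    proof -
      have "energy s (D k) \<le> (LINT p|lborel. m k p + a * density s (F k) p)"
        unfolding en_def
        by (rule integral_mono) (use m_int integrable_frac_integrand[OF D D] integrable_frac_integrand[OF F F] in \<open>auto simp: m_def\<close>)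
      also have "\<dots> = (LINT p|lborel. m k p) + a * energy s (F k)"
        unfolding en_def using m_int integrable_frac_integrand[OF F F] by simp
      finally show ?thesis .
    qed
    then show "\<forall>\<^sub>F k in sequentially. energy s (D k) \<le> (LINT p|lborel. m k p) + a * energy s (F k)" by simp
  qed (simp add: en_nonneg)
qed

lemma frac_integrand_contraction:
  assumes "\<And>x y. \<bar>f x - f y\<bar> \<le> \<bar>u x - u y\<bar>"
  shows "density s f p \<le> density s u p"
proof -
  obtain x y where p: "p = (x, y)" by (cases p)
  have "(f x - f y) * (f x - f y) \<le> (u x - u y) * (u x - u y)"
    using assms[of x y] by (simp add: abs_le_square_iff power2_eq_square)
  then show ?thesis unfolding p frac_integrand_kern by (intro mult_right_mono) auto
qed

lemma fin_en_contraction: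
  assumes u: "fin_en s u" and [measurable]: "f \<in> borel_measurable borel" and le: "\<And>x y. \<bar>f x - f y\<bar> \<le> \<bar>u x - u y\<bar>"
  shows "fin_en s f" "energy s f \<le> energy s u"
proof -
  have "(\<integral>\<^sup>+p. ennreal (density s f p) \<partial>lborel) \<le> (\<integral>\<^sup>+p. ennreal (density s u p) \<partial>lborel)"
    by (intro nn_integral_mono ennreal_leI frac_integrand_contraction le)
  also have "\<dots> = ennreal (energy s u)" by (rule nn_integral_frac_integrand[OF u])
  finally have b: "(\<integral>\<^sup>+p. ennreal (density s f p) \<partial>lborel) \<le> ennreal (energy s u)" .
  show f: "fin_en s f" by (rule fin_enI) (use b in \<open>auto intro: le_less_trans\<close>)
  show "energy s f \<le> energy s u" by (rule en_leI[OF f en_nonneg b])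
qed

text \<open>The square root is the Euclidean norm of the pair \<open>(a, e)\<close>, so this is the
  reverse triangle inequality.\<close>

lemma sqrt_sub_contraction: "\<bar>(sqrt (a * a + e\<^sup>2) - e) - (sqrt (b * b + e\<^sup>2) - e)\<bar> \<le> \<bar>a - b\<bar>"
proof -
  have "\<bar>norm (a, e) - norm (b, e)\<bar> \<le> norm ((a, e) - (b, e))" by (rule norm_triangle_ineq3)
  then show ?thesis by (simp add: norm_prod_def power2_eq_square)
qed

text \<open>The absolute value of a test function need not be smooth, and it is not linear in
  \<open>u\<close>, so energy convergence of the approximations does not pass through it directly.
  Smoothed absolute values with parameter tending to 0 are used, along an almost everywhere
  convergent subsequence.\<close>

lemma H_abs:
  assumes u: "u \<in> H"
  shows "(\<lambda>x. \<bar>u x\<bar>) \<in> H"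
proof -
  obtain v where v: "\<And>k::nat. v k \<in> tf" "(\<lambda>k. energy s (\<lambda>x. v k x - u x)) \<longlonglongrightarrow> 0"
    using u unfolding H_iff by blast
  have vu: "fin_en s (\<lambda>x. v k x - u x)" "vanishing (\<lambda>x. v k x - u x)" for k
    by (rule fin_en_diff[OF tf_fin_en[OF v(1)] H_fin_en[OF u]], rule vanishing_diff[OF tf_vanishing[OF v(1)] H_vanishing[OF u]])
  obtain r where r: "strict_mono r" "AE x in lborel. (\<lambda>k. v (r k) x - u x) \<longlonglongrightarrow> 0"
    using H_AE_convergent_subseq[OF vu v(2)] by blast
  define e where "e k = 1 / real (Suc k)" for k
  have epos: "e k > 0" for k by (simp add: e_def)
  have e0: "e \<longlonglongrightarrow> 0" using LIMSEQ_inverse_real_of_nat by (simp add: e_def[abs_def] inverse_eq_divide)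
  define a where "a k x = sqrt (v (r k) x * v (r k) x + (e k)\<^sup>2) - e k" for k x
  have a_tf: "a k \<in> tf" for k
    unfolding a_def by (rule test_functions_smooth_abs[OF v(1) epos])
  have [measurable]: "u \<in> borel_measurable borel" using u by (rule H_measurable)
  have au: "fin_en s (\<lambda>x. \<bar>u x\<bar>)"
    by (rule fin_en_contraction(1)[OF H_fin_en[OF u]]) (auto simp: abs_triangle_ineq3)
  have av: "vanishing (\<lambda>x. \<bar>u x\<bar>)"
    using H_vanishing[OF u] unfolding vanishing_def by (rule eventually_mono) auto
  have ca: "\<bar>a k x - a k y\<bar> \<le> \<bar>v (r k) x - v (r k) y\<bar>" for k x y
    unfolding a_def by (rule sqrt_sub_contraction)
  have "(\<lambda>k. energy s (\<lambda>x. a k x - \<bar>u x\<bar>)) \<longlonglongrightarrow> 0"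
  \<comment> \<open>The factors come from applying \<open>(z - w)^2 \<le> 2 z^2 + 2 w^2\<close>
    twice: the densities of \<open>v (r k)\<close> and \<open>u\<close> enter with factor 2 each,
    and the first of them splits into 2 times that of \<open>v (r k) - u\<close> plus 2 times that
    of \<open>u\<close>; hence 4 and 2 * 2 + 2 = 6.\<close>
  proof (rule en_tendsto_0_dominated[where F = "\<lambda>k x. v (r k) x - u x" and G = u and a = 4 and b = 6])
    show "(\<lambda>k. energy s (\<lambda>x. v (r k) x - u x)) \<longlonglongrightarrow> 0"
      using LIMSEQ_subseq_LIMSEQ[OF v(2) r(1)] by (simp add: o_def)
    show "density s (\<lambda>x. a k x - \<bar>u x\<bar>) p
      \<le> 4 * density s (\<lambda>x. v (r k) x - u x) p + 6 * density s u p" for k p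
    proof -
      have sq: "(z - w) * (z - w) \<le> 2 * (z * z) + 2 * (w * w)" "z * z \<le> 2 * ((z - w) * (z - w)) + 2 * (w * w)" for z w :: real
        using zero_le_square[of "z + w"] zero_le_square[of "z - w - w"] by (simp_all add: algebra_simps)
      have "density s (\<lambda>x. a k x - \<bar>u x\<bar>) p
         \<le> 2 * density s (a k) p + 2 * density s (\<lambda>x. \<bar>u x\<bar>) p"
        unfolding frac_integrand_fdiff fdiff_diff by (rule sq)
      also have "\<dots> \<le> 2 * density s (v (r k)) p + 2 * density s u p"
        by (intro add_mono mult_left_mono frac_integrand_contraction)
           (auto simp: ca abs_triangle_ineq3)
      also have "density s (v (r k)) p \<le> 2 * density s (\<lambda>x. v (r k) x - u x) p
         + 2 * density s u p"
        unfolding frac_integrand_fdiff fdiff_diff by (rule sq)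
      finally show ?thesis by simp
    qed
    show "AE x in lborel. (\<lambda>k. a k x - \<bar>u x\<bar>) \<longlonglongrightarrow> 0"
      using r(2)
    proof eventually_elim
      fix x assume "(\<lambda>k. v (r k) x - u x) \<longlonglongrightarrow> 0"
      then have "(\<lambda>k. v (r k) x) \<longlonglongrightarrow> u x" by (simp add: LIM_zero_iff)
      then have "(\<lambda>k. a k x - \<bar>u x\<bar>) \<longlonglongrightarrow> sqrt (u x * u x + 0\<^sup>2) - 0 - \<bar>u x\<bar>"
        unfolding a_def by (intro tendsto_intros e0)
      then show "(\<lambda>k. a k x - \<bar>u x\<bar>) \<longlonglongrightarrow> 0" by simp
    qed
  qed (use vu(1) fin_en_diff[OF tf_fin_en[OF a_tf] au] H_fin_en[OF u] in auto)
  then show ?thesis by (rule H_limit[OF au av tf_H[OF a_tf]])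
qed

lemma H_pos_part:
  assumes u: "u \<in> H"
  shows "(\<lambda>x. max 0 (u x)) \<in> H"
proof -
  have "(\<lambda>x. max 0 (u x)) = (\<lambda>x. 1/2 * (u x + \<bar>u x\<bar>))" by (auto simp: max_def)
  then show ?thesis using H_cmult[OF H_add[OF u H_abs[OF u]], of "1/2"] by simp
qed

text \<open>Product rule for differences:
  \<open>(x \<bullet> c) * (u x - u y) + u y * ((x - y) \<bullet> c)\<close>. The second term
  produces the square of \<open>u\<close> convolved with |z|^2 K(z), locally integrable, and the
  Poincare inequality absorbs it.\<close>

lemma fin_en_mult_inner:
  "\<exists>C\<ge>0. \<forall>u. fin_en s u \<longrightarrow> vanishing u \<longrightarrow> fin_en s (\<lambda>x. (x \<bullet> c) * u x) \<and> energy s (\<lambda>x. (x \<bullet> c) * u x) \<le> C * energy s u"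
proof -
  obtain \<rho> where \<rho>: "\<rho> > 0" "\<Omega> \<subseteq> ball 0 \<rho>" using bounded_dom bounded_subset_ballD by blast
  obtain P where P: "P > 0" "\<And>u. fin_en s u \<Longrightarrow> vanishing u \<Longrightarrow> integrable lborel (\<lambda>x. u x * u x) \<and> (LINT x|lborel. u x * u x) \<le> P * energy s u"
    using poincare by blast
  obtain K where K: "K > 0" "\<And>\<rho>. \<rho> > 0 \<Longrightarrow> (\<integral>\<^sup>+z. ennreal (norm z ^ 2 * kern s (z::'a)) * indicator (cball 0 \<rho>) z \<partial>lborel) \<le> ennreal (K * \<rho> powr (2 - 2 * s))"
    using nn_integral_norm_square_kern[OF s_pos s_less dim] by blast
  define g :: "'a \<Rightarrow> ennreal" where "g z = ennreal (norm z ^ 2 * kern s z) * indicator (cball 0 (2 * \<rho>)) z" for z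
  define k where "k = K * (2 * \<rho>) powr (2 - 2 * s)"
  have k: "(\<integral>\<^sup>+z. g z \<partial>lborel) \<le> ennreal k" "k \<ge> 0" using K(2)[of "2 * \<rho>"] \<rho> K(1) by (auto simp: g_def k_def)
  have [measurable]: "cball (0::'a) (2 * \<rho>) \<in> sets borel" by auto
  have [measurable]: "g \<in> borel_measurable borel" unfolding g_def by measurable
  have even: "g (- z) = g z" for z by (simp add: g_def kern_def indicator_def)
  define A where "A = 2 * (\<rho> * norm c)\<^sup>2"
  define B where "B = 2 * (norm c)\<^sup>2"
  have AB: "A \<ge> 0" "B \<ge> 0" by (auto simp: A_def B_def)
  have "fin_en s (\<lambda>x. (x \<bullet> c) * u x) \<and> energy s (\<lambda>x. (x \<bullet> c) * u x) \<le> (A + B * P * k) * energy s u"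
    if u: "fin_en s u" "vanishing u" for u
  proof -
    have [measurable]: "u \<in> borel_measurable borel" by (rule fin_en_measurable[OF u(1)])
    let ?h = "\<lambda>x. (x \<bullet> c) * u x"
    have hb: "\<bar>x \<bullet> c\<bar> \<le> \<rho> * norm c" if "x \<in> \<Omega>" for x
    proof -
      have "\<bar>x \<bullet> c\<bar> \<le> norm x * norm c" by (rule Cauchy_Schwarz_ineq2)
      also have "\<dots> \<le> \<rho> * norm c" using that \<rho> by (intro mult_right_mono) auto
      finally show ?thesis .
    qed
    have pw: "AE p in lborel. ennreal (density s ?h p)
       \<le> ennreal A * ennreal (density s u p) + ennreal B * (ennreal (u (snd p) * u (snd p)) * g (fst p - snd p))"
      using AE_lborel_fst[OF u(2)[unfolded vanishing_def]] AE_lborel_snd[OF u(2)[unfolded vanishing_def]]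
    proof eventually_elim
      fix p :: "'a \<times> 'a"
      assume p0: "fst p \<notin> \<Omega> \<longrightarrow> u (fst p) = 0" "snd p \<notin> \<Omega> \<longrightarrow> u (snd p) = 0"
      obtain x y where p: "p = (x, y)" by (cases p)
      have x0: "x \<notin> \<Omega> \<Longrightarrow> u x = 0" and y0: "y \<notin> \<Omega> \<Longrightarrow> u y = 0" using p0 p by auto
      have sq: "(z + w) * (z + w) \<le> 2 * (z * z) + 2 * (w * w)" for z w :: real
        using zero_le_square[of "z - w"] by (simp add: algebra_simps)
      \<comment> \<open>The coordinate is unbounded off \<open>\<Omega>\<close>, so pairs with a
        point outside are treated apart: there \<open>u\<close> vanishes at that point and only the
        bounded weight at the other point survives. For pairs inside,
        \<open>norm (x - y) \<le> 2 * \<rho>\<close> localises the kernel.\<close>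
      have one: "(?h x - ?h y) * (?h x - ?h y) \<le> A * ((u x - u y) * (u x - u y))" if "x \<notin> \<Omega> \<or> y \<notin> \<Omega>"
      proof -
        obtain z where z: "(?h x - ?h y) * (?h x - ?h y) = (z \<bullet> c)\<^sup>2 * ((u x - u y) * (u x - u y))" "z \<in> \<Omega> \<or> u x - u y = 0"
        proof (cases "x \<in> \<Omega>")
          case True
          then show ?thesis using that[of x] y0 \<open>x \<notin> \<Omega> \<or> y \<notin> \<Omega>\<close> by (simp add: power2_eq_square)
        next
          case False
          then show ?thesis using that[of y] x0 y0 by (auto simp: power2_eq_square)
        qed
        have "(z \<bullet> c)\<^sup>2 * ((u x - u y) * (u x - u y)) \<le> (\<rho> * norm c)\<^sup>2 * ((u x - u y) * (u x - u y))"
        proof (cases "u x - u y = 0")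
          case False
          then show ?thesis using z(2) hb[of z]
            by (intro mult_right_mono) (auto simp: abs_le_square_iff[symmetric] abs_mult \<rho>(1) less_imp_le)
        qed simp
        also have "\<dots> \<le> A * ((u x - u y) * (u x - u y))" unfolding A_def by (intro mult_right_mono) auto
        finally show ?thesis using z(1) by simp
      qed
      have two: "(?h x - ?h y) * (?h x - ?h y) \<le> A * ((u x - u y) * (u x - u y)) + B * (u y * u y * norm (x - y) ^ 2)" if "x \<in> \<Omega>"
      proof -
        have "?h x - ?h y = (x \<bullet> c) * (u x - u y) + u y * ((x - y) \<bullet> c)" by (simp add: algebra_simps inner_diff_left)
        then have "(?h x - ?h y) * (?h x - ?h y) \<le> 2 * (((x \<bullet> c) * (u x - u y)) * ((x \<bullet> c) * (u x - u y)))
            + 2 * ((u y * ((x - y) \<bullet> c)) * (u y * ((x - y) \<bullet> c)))" using sq by metis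
        also have "\<dots> = 2 * ((x \<bullet> c)\<^sup>2 * ((u x - u y) * (u x - u y))) + 2 * (((x - y) \<bullet> c)\<^sup>2 * (u y * u y))"
          by (simp add: power2_eq_square mult_ac)
        also have "\<dots> \<le> 2 * ((\<rho> * norm c)\<^sup>2 * ((u x - u y) * (u x - u y))) + 2 * ((norm (x - y) * norm c)\<^sup>2 * (u y * u y))"
          using hb[OF that] Cauchy_Schwarz_ineq2[of "x - y" c]
          by (intro add_mono mult_left_mono mult_right_mono) (auto simp: abs_le_square_iff[symmetric] abs_mult \<rho>(1) less_imp_le)
        also have "\<dots> = A * ((u x - u y) * (u x - u y)) + B * (u y * u y * norm (x - y) ^ 2)"
          by (simp add: A_def B_def power_mult_distrib)
        finally show ?thesis .
      qed
      show "ennreal (density s ?h p)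
       \<le> ennreal A * ennreal (density s u p) + ennreal B * (ennreal (u (snd p) * u (snd p)) * g (fst p - snd p))"
      proof (cases "x \<in> \<Omega> \<and> y \<in> \<Omega>")
        case False
        then have "density s ?h p \<le> A * density s u p"
          using one unfolding p frac_integrand_kern mult.assoc[of A, symmetric] by (intro mult_right_mono) auto
        then have "ennreal (density s ?h p) \<le> ennreal A * ennreal (density s u p)"
          using AB by (simp add: ennreal_mult'[symmetric] ennreal_leI)
        then show ?thesis by (rule add_increasing2[rotated]) simp
      next
        case True
        have nx: "norm (x - y) \<le> 2 * \<rho>"
          using True \<rho> norm_triangle_ineq4[of x y] by (auto simp: subset_iff) (smt (verit) dist_0_norm mem_ball)
        have "density s ?h p \<le> (A * ((u x - u y) * (u x - u y)) + B * (u y * u y * norm (x - y) ^ 2)) * kern s (x - y)"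
          unfolding p frac_integrand_kern using two True by (intro mult_right_mono) auto
        also have "\<dots> = A * density s u p + B * ((u y * u y) * (norm (x - y) ^ 2 * kern s (x - y)))"
          unfolding p frac_integrand_kern by (simp add: algebra_simps)
        finally have "ennreal (density s ?h p) \<le> ennreal (A * density s u p + B * ((u y * u y) * (norm (x - y) ^ 2 * kern s (x - y))))"
          by (rule ennreal_leI)
        also have "\<dots> = ennreal A * ennreal (density s u p) + ennreal B * (ennreal (u y * u y) * ennreal (norm (x - y) ^ 2 * kern s (x - y)))"
          using AB by (subst ennreal_plus) (simp_all add: frac_integrand_nonneg ennreal_mult')
        finally show ?thesis using nx by (simp add: p g_def)
      qed
    qed
    have "(\<integral>\<^sup>+p. ennreal (density s ?h p) \<partial>lborel) \<le>
       (\<integral>\<^sup>+p. ennreal A * ennreal (density s u p) + ennreal B * (ennreal (u (snd p) * u (snd p)) * g (fst p - snd p)) \<partial>lborel)"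
      by (rule nn_integral_mono_AE[OF pw])
    also have "\<dots> = ennreal A * ennreal (energy s u) + ennreal B * ((\<integral>\<^sup>+x. ennreal (u x * u x) \<partial>lborel) * (\<integral>\<^sup>+z. g z \<partial>lborel))"
      using nn_integral_convolution_snd[of g "\<lambda>x. ennreal (u x * u x)"] even
      by (simp add: nn_integral_add nn_integral_cmult nn_integral_frac_integrand[OF u(1)])
    also have "\<dots> \<le> ennreal A * ennreal (energy s u) + ennreal B * (ennreal (P * energy s u) * ennreal k)"
    proof -
      have "(\<integral>\<^sup>+x. ennreal (u x * u x) \<partial>lborel) \<le> ennreal (P * energy s u)"
        using P(2)[OF u] by (subst nn_integral_eq_integral) (auto intro: ennreal_leI)
      then show ?thesis using k by (intro add_mono mult_mono mult_left_mono) auto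
    qed
    also have "\<dots> = ennreal ((A + B * P * k) * energy s u)"
      using AB P(1) k(2) en_nonneg[of s u] by (simp add: ennreal_mult'[symmetric] ennreal_plus[symmetric] algebra_simps del: ennreal_plus)
    finally have b: "(\<integral>\<^sup>+p. ennreal (density s ?h p) \<partial>lborel) \<le> ennreal ((A + B * P * k) * energy s u)" .
    have f: "fin_en s ?h" by (rule fin_enI) (use b in \<open>auto intro: le_less_trans\<close>)
    then show ?thesis using AB P(1) k(2) en_nonneg[of s u] by (auto intro!: en_leI b)
  qed
  moreover have "A + B * P * k \<ge> 0" using AB P(1) k(2) by simp
  ultimately show ?thesis by blast
qed

text \<open>The constant of \<open>fin_en_mult_inner\<close> does not depend on the function, so the
  products with approximating test functions converge.\<close>

lemma H_mult_inner:
  assumes u: "u \<in> H"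
  shows "(\<lambda>x. (x \<bullet> c) * u x) \<in> H"
proof -
  obtain C where C: "C \<ge> 0" "\<And>u. fin_en s u \<Longrightarrow> vanishing u \<Longrightarrow> fin_en s (\<lambda>x. (x \<bullet> c) * u x) \<and>
    energy s (\<lambda>x. (x \<bullet> c) * u x) \<le> C * energy s u"
    using fin_en_mult_inner by blast
  obtain v where v: "\<And>k::nat. v k \<in> tf" "(\<lambda>k. energy s (\<lambda>x. v k x - u x)) \<longlonglongrightarrow> 0"
    using u unfolding H_iff by blast
  have vu: "fin_en s (\<lambda>x. v k x - u x)" "vanishing (\<lambda>x. v k x - u x)" for k
    by (rule fin_en_diff[OF tf_fin_en[OF v(1)] H_fin_en[OF u]], rule vanishing_diff[OF tf_vanishing[OF v(1)] H_vanishing[OF u]])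
  have le: "energy s (\<lambda>x. (x \<bullet> c) * v k x - (x \<bullet> c) * u x) \<le> C * energy s (\<lambda>x. v k x - u x)" for k
    using C(2)[OF vu, of k] by (simp add: right_diff_distrib)
  have "(\<lambda>k. energy s (\<lambda>x. (x \<bullet> c) * v k x - (x \<bullet> c) * u x)) \<longlonglongrightarrow> 0"
  proof (rule tendsto_sandwich[OF _ _ tendsto_const])
    show "(\<lambda>k. C * energy s (\<lambda>x. v k x - u x)) \<longlonglongrightarrow> 0"
      using tendsto_mult_left[OF v(2), of C] by simp
  qed (auto simp: en_nonneg le)
  with H_limit[OF conjunct1[OF C(2)[OF H_fin_en[OF u] H_vanishing[OF u]]] vanishing_mult[OF H_vanishing[OF u]]
      tf_H[OF test_functions_mult[OF v(1) C_order_inner]]]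
  show ?thesis .
qed

lemma H_reflect:
  assumes u: "u \<in> H" and sym: "\<And>x. x \<in> \<Omega> \<Longrightarrow> - x \<in> \<Omega>"
  shows "(\<lambda>x. u (- x)) \<in> H"
proof -
  obtain v where v: "\<And>k::nat. v k \<in> tf" "(\<lambda>k. energy s (\<lambda>x. v k x - u x)) \<longlonglongrightarrow> 0"
    using u unfolding H_iff by blast
  have "fin_en s (\<lambda>x. v k x - u x)" for k
    by (rule fin_en_diff[OF tf_fin_en[OF v(1)] H_fin_en[OF u]])
  then have "energy s (\<lambda>x. v k (- x) - u (- x)) = energy s (\<lambda>x. v k x - u x)" for k
    using en_reflect[of "\<lambda>x. v k x - u x" "\<lambda>x. v k x - u x" s] fin_en_measurable by blast
  then have lim: "(\<lambda>k. energy s (\<lambda>x. v k (- x) - u (- x))) \<longlonglongrightarrow> 0"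
    using v(2) by simp
  have van: "vanishing (\<lambda>x. u (- x))"
    using AE_lborel_reflect[OF H_vanishing[OF u, unfolded vanishing_def]] unfolding vanishing_def
    by (rule eventually_mono) (use sym in force)
  show ?thesis
    by (rule H_limit[OF fin_en_reflect[OF H_fin_en[OF u]] van tf_H[OF test_functions_reflect[OF v(1) sym]] lim])
qed

end

section \<open>Compactness and completeness\<close>

text \<open>The integer index of the half-open grid cube of side \<open>h\<close> containing
  \<open>x\<close>, encoded as a lattice point of the same space. The cubes themselves are the
  fibres of this map.\<close>

definition cell :: "real \<Rightarrow> 'a::euclidean_space \<Rightarrow> 'a" where
  "cell h x = (\<Sum>b\<in>Basis. of_int \<lfloor>(x \<bullet> b) / h\<rfloor> *\<^sub>R b)"

lemma cell_inner: "b \<in> Basis \<Longrightarrow> cell h x \<bullet> b = of_int \<lfloor>(x \<bullet> b) / h\<rfloor>"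
  unfolding cell_def by (simp add: inner_sum_left_Basis)

lemma cell_eq_iff: "cell h x = cell h y \<longleftrightarrow> (\<forall>b\<in>Basis. \<lfloor>(x \<bullet> b) / h\<rfloor> = \<lfloor>(y \<bullet> b) / h\<rfloor>)"
  unfolding euclidean_eq_iff[where 'a='a] by (auto simp: cell_inner)

lemma cell_measurable [measurable]: "cell h \<in> borel_measurable borel"
  unfolding cell_def by measurable

lemma finite_cell_image:
  fixes \<Omega> :: "'a::euclidean_space set"
  assumes "h > 0" "bounded \<Omega>"
  shows "finite (cell h ` \<Omega>)"
proof -
  obtain \<rho> where \<rho>: "\<Omega> \<subseteq> ball 0 \<rho>" using assms bounded_subset_ballD by blast
  define m where "m = \<lceil>\<rho> / h\<rceil> + 1"
  let ?F = "(\<lambda>f::'a \<Rightarrow> int. \<Sum>b\<in>Basis. of_int (f b) *\<^sub>R b) ` (Basis \<rightarrow>\<^sub>E {-m..m})"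
  have "cell h x \<in> ?F" if x: "x \<in> \<Omega>" for x
  proof (rule image_eqI)
    show "cell h x = (\<Sum>b\<in>Basis. of_int (restrict (\<lambda>b. \<lfloor>(x \<bullet> b) / h\<rfloor>) Basis b) *\<^sub>R b)"
      unfolding cell_def by (rule sum.cong) auto
    have "\<lfloor>(x \<bullet> b) / h\<rfloor> \<in> {-m..m}" if b: "b \<in> Basis" for b
    proof -
      have "\<bar>x \<bullet> b\<bar> \<le> \<rho>" using Basis_le_norm[OF b, of x] x \<rho> by (auto simp: dist_norm intro: order_trans less_imp_le)
      then have "\<bar>(x \<bullet> b) / h\<bar> \<le> \<rho> / h" using assms by (simp add: divide_right_mono)
      then show ?thesis unfolding m_def atLeastAtMost_iff by linarith
    qed
    then show "restrict (\<lambda>b. \<lfloor>(x \<bullet> b) / h\<rfloor>) Basis \<in> Basis \<rightarrow>\<^sub>E {-m..m}" by auto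
  qed
  then have "cell h ` \<Omega> \<subseteq> ?F" by auto
  moreover have "finite ?F" by (intro finite_imageI finite_PiE) auto
  ultimately show ?thesis by (rule finite_subset)
qed

lemma cell_norm_diff:
  fixes x y :: "'a::euclidean_space"
  assumes "h > 0" "cell h x = cell h y"
  shows "norm (x - y) \<le> real DIM('a) * h"
proof -
  have "\<bar>(x - y) \<bullet> b\<bar> \<le> h" if "b \<in> Basis" for b
  proof -
    have "\<lfloor>(x \<bullet> b) / h\<rfloor> = \<lfloor>(y \<bullet> b) / h\<rfloor>" using assms(2) that by (simp add: cell_eq_iff)
    then have "\<bar>(x \<bullet> b) / h - (y \<bullet> b) / h\<bar> \<le> 1" by linarith
    then show ?thesis using assms(1) by (simp add: diff_divide_distrib[symmetric] inner_diff_left)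
  qed
  then have "(\<Sum>b\<in>Basis. \<bar>(x - y) \<bullet> b\<bar>) \<le> (\<Sum>b\<in>(Basis::'a set). h)" by (intro sum_mono)
  then show ?thesis using norm_le_l1[of "x - y"] by simp
qed

text \<open>The open cube with lower corner \<open>h *\<^sub>R cell h x0\<close> lies inside the
  cell. Finiteness and this lower bound on the volume are what the averaging argument asks
  for.\<close>

lemma measure_cell:
  fixes x0 :: "'a::euclidean_space"
  assumes h: "h > 0"
  shows "emeasure lborel {x. cell h x = cell h x0} < \<infinity>" "h ^ DIM('a) \<le> measure lborel {x. cell h x = cell h x0}"
proof -
  let ?Q = "{x. cell h x = cell h x0}"
  have [measurable]: "?Q \<in> sets borel" by measurable
  have "?Q \<subseteq> cball x0 (real DIM('a) * h)" using cell_norm_diff[OF h, of _ x0] by (auto simp: dist_norm norm_minus_commute[of x0])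
  then have "bounded ?Q" using bounded_cball bounded_subset by blast
  then show fin: "emeasure lborel ?Q < \<infinity>" by (rule emeasure_bounded_finite)
  define l where "l = h *\<^sub>R cell h x0"
  define w where "w = (\<Sum>b\<in>Basis. h *\<^sub>R b :: 'a)"
  have lb: "l \<bullet> b = h * of_int \<lfloor>(x0 \<bullet> b) / h\<rfloor>" if "b \<in> Basis" for b
    using that by (simp add: l_def cell_inner)
  have wb: "w \<bullet> b = h" if "b \<in> Basis" for b
    using that by (simp add: w_def inner_sum_left_Basis)
  have "box l (l + w) \<subseteq> ?Q"
  proof
    fix x assume x: "x \<in> box l (l + w)"
    have "\<lfloor>(x \<bullet> b) / h\<rfloor> = \<lfloor>(x0 \<bullet> b) / h\<rfloor>" if b: "b \<in> Basis" for b
    proof -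
      have "l \<bullet> b < x \<bullet> b" "x \<bullet> b < (l + w) \<bullet> b" using x b by (auto simp: box_def)
      then have "of_int \<lfloor>(x0 \<bullet> b) / h\<rfloor> < (x \<bullet> b) / h" "(x \<bullet> b) / h < of_int \<lfloor>(x0 \<bullet> b) / h\<rfloor> + 1"
        using h b by (auto simp: lb wb inner_add_left field_simps)
      then show ?thesis by linarith
    qed
    then show "x \<in> ?Q" by (simp add: cell_eq_iff)
  qed
  then have "measure lborel (box l (l + w)) \<le> measure lborel ?Q"
    using fin by (intro measure_mono_fmeasurable) (auto simp: fmeasurable_def)
  moreover have "measure lborel (box l (l + w)) = h ^ DIM('a)"
    by (subst measure_lborel_box_eq) (use h in \<open>auto simp: inner_add_left wb prod_constant\<close>)
  ultimately show "h ^ DIM('a) \<le> measure lborel ?Q" by simp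
qed

lemma indicator_Times_mult_measurable [measurable]:
  fixes Q :: "'a::euclidean_space set" and f :: "'a \<times> 'a \<Rightarrow> ennreal"
  assumes [measurable]: "Q \<in> sets borel" "f \<in> borel_measurable borel"
  shows "(\<lambda>p. indicator (Q \<times> Q) p * f p) \<in> borel_measurable lborel"
  unfolding indicator_times by measurable

text \<open>With \<open>m\<close> the volume of \<open>Q\<close>, \<open>S\<close> the integral of
  the square and \<open>I\<close> that of \<open>u\<close> over it, the double integral of
  \<open>(u x - u y)^2\<close> over \<open>Q \<times> Q\<close> is
  \<open>2 * m * S - 2 * I^2\<close>. Points of a cell are at distance at most \<open>N * h\<close>,
  which bounds the kernel from below and the double integral by the local energy.\<close>

lemma cell_poincare:
  fixes u :: "'a::euclidean_space \<Rightarrow> real"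
  assumes h: "h > 0" and s: "0 < s" and [measurable]: "u \<in> borel_measurable borel"
    and u2: "integrable lborel (\<lambda>x. u x * u x)"
    and Q_def: "Q = {x. cell h x = cell h x0}"
  shows "ennreal (LINT x|lborel. indicator Q x * (u x * u x)) \<le>
     ennreal ((LINT x|lborel. indicator Q x * u x)\<^sup>2 / h ^ DIM('a)) +
     ennreal ((real DIM('a) * h) powr (real DIM('a) + 2 * s) / (2 * h ^ DIM('a))) *
       (\<integral>\<^sup>+p. indicator (Q \<times> Q) p * ennreal (density s u p) \<partial>lborel)"
proof -
  let ?N = "DIM('a)" let ?a = "real ?N + 2 * s"
  have Q [measurable]: "Q \<in> sets borel" unfolding Q_def by measurable
  define m where "m = measure lborel Q"
  have Qf: "emeasure lborel Q < \<infinity>" and mh: "h ^ ?N \<le> m" using measure_cell[OF h] by (auto simp: Q_def m_def)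
  have hN: "h ^ ?N > 0" using h by simp
  then have m: "m > 0" using mh by simp
  have i1: "integrable lborel (\<lambda>x. indicator Q x :: real)" using Qf by simp
  have i2: "integrable lborel (\<lambda>x. indicator Q x * (u x * u x))"
    using integrable_mult_indicator[OF _ u2, of Q] by simp
  have i3: "integrable lborel (\<lambda>x. indicator Q x * u x)"
  proof -
    have "integrable lborel (\<lambda>x. indicator Q x * (indicator Q x * u x))"
    proof (rule integrable_mult_of_squares)
      show "integrable lborel (\<lambda>x. indicator Q x * indicator Q x :: real)"
        using i1 by (simp flip: indicator_inter_arith)
      have "(\<lambda>x. indicator Q x * u x * (indicator Q x * u x)) = (\<lambda>x. indicator Q x * (u x * u x))"
        by (auto simp: indicator_def)
      then show "integrable lborel (\<lambda>x. indicator Q x * u x * (indicator Q x * u x))" using i2 by simp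
    qed measurable
    moreover have "(\<lambda>x. indicator Q x * (indicator Q x * u x)) = (\<lambda>x. indicator Q x * u x)" by (auto simp: indicator_def)
    ultimately show ?thesis by simp
  qed
  define I where "I = (LINT x|lborel. indicator Q x * u x)"
  define S where "S = (LINT x|lborel. indicator Q x * (u x * u x))"
  have in1: "(\<integral>\<^sup>+y. ennreal (indicator Q y * ((u x - u y) * (u x - u y))) \<partial>lborel) = ennreal (m * (u x * u x) - 2 * I * u x + S)" for x
  proof -
    have e: "indicator Q y * ((u x - u y) * (u x - u y)) = (u x * u x) * indicator Q y - 2 * u x * (indicator Q y * u y) + indicator Q y * (u y * u y)" for y
      by (simp add: algebra_simps)
    have "integrable lborel (\<lambda>y. indicator Q y * ((u x - u y) * (u x - u y)))"
      unfolding e using i1 i2 i3 by (intro Bochner_Integration.integrable_add Bochner_Integration.integrable_diff integrable_mult_right) auto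
    moreover have "(LINT y|lborel. indicator Q y * ((u x - u y) * (u x - u y))) = m * (u x * u x) - 2 * I * u x + S"
      unfolding e using i1 i2 i3 by (simp add: m_def I_def S_def)
    ultimately show ?thesis by (subst nn_integral_eq_integral) auto
  qed
  have nonneg: "0 \<le> m * (u x * u x) - 2 * I * u x + S" for x
  proof -
    have e: "indicator Q y * ((u x - u y) * (u x - u y)) = (u x * u x) * indicator Q y - 2 * u x * (indicator Q y * u y) + indicator Q y * (u y * u y)" for y
      by (simp add: algebra_simps)
    have "(LINT y|lborel. indicator Q y * ((u x - u y) * (u x - u y))) = m * (u x * u x) - 2 * I * u x + S"
      unfolding e using i1 i2 i3 by (simp add: m_def I_def S_def)
    moreover have "0 \<le> (LINT y|lborel. indicator Q y * ((u x - u y) * (u x - u y)))" by (rule integral_nonneg_AE) simp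
    ultimately show ?thesis by simp
  qed
  have in2: "(\<integral>\<^sup>+x. ennreal (indicator Q x * (m * (u x * u x) - 2 * I * u x + S)) \<partial>lborel) = ennreal (2 * m * S - 2 * I\<^sup>2)"
  proof -
    have e: "indicator Q x * (m * (u x * u x) - 2 * I * u x + S) = m * (indicator Q x * (u x * u x)) - 2 * I * (indicator Q x * u x) + S * indicator Q x" for x
      by (simp add: algebra_simps)
    have "integrable lborel (\<lambda>x. indicator Q x * (m * (u x * u x) - 2 * I * u x + S))"
      unfolding e using i1 i2 i3 by (intro Bochner_Integration.integrable_add Bochner_Integration.integrable_diff integrable_mult_right) auto
    moreover have "(LINT x|lborel. indicator Q x * (m * (u x * u x) - 2 * I * u x + S)) = 2 * m * S - 2 * I\<^sup>2"
      unfolding e using i1 i2 i3 by (simp add: m_def[symmetric] I_def[symmetric] S_def[symmetric] power2_eq_square)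
    ultimately show ?thesis by (subst nn_integral_eq_integral) (auto simp: nonneg)
  qed
  let ?G = "\<integral>\<^sup>+p. indicator (Q \<times> Q) p * ennreal (density s u p) \<partial>lborel"
  let ?D = "(real ?N * h) powr ?a"
  have "ennreal (2 * m * S - 2 * I\<^sup>2) = (\<integral>\<^sup>+x. ennreal (indicator Q x) * (\<integral>\<^sup>+y. ennreal (indicator Q y * ((u x - u y) * (u x - u y))) \<partial>lborel) \<partial>lborel)"
    unfolding in1 in2[symmetric] by (rule nn_integral_cong) (simp add: ennreal_mult'[symmetric])
  also have "\<dots> = (\<integral>\<^sup>+x. \<integral>\<^sup>+y. ennreal (indicator Q x * indicator Q y * ((u x - u y) * (u x - u y))) \<partial>lborel \<partial>lborel)"
    by (simp add: nn_integral_cmult[symmetric] ennreal_mult'[symmetric] mult.assoc)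
  also have "\<dots> = (\<integral>\<^sup>+p. ennreal (indicator Q (fst p) * indicator Q (snd p) * ((u (fst p) - u (snd p)) * (u (fst p) - u (snd p)))) \<partial>lborel)"
    by (subst nn_integral_lborel_pair) auto
  also have "\<dots> \<le> (\<integral>\<^sup>+p. ennreal ?D * (indicator (Q \<times> Q) p * ennreal (density s u p)) \<partial>lborel)"
  proof (rule nn_integral_mono)
    fix p :: "'a \<times> 'a"
    obtain x y where p: "p = (x, y)" by (cases p)
    show "ennreal (indicator Q (fst p) * indicator Q (snd p) * ((u (fst p) - u (snd p)) * (u (fst p) - u (snd p))))
      \<le> ennreal ?D * (indicator (Q \<times> Q) p * ennreal (density s u p))"
    proof (cases "x \<in> Q \<and> y \<in> Q \<and> x \<noteq> y")
      case True
      then have "cell h x = cell h y" by (auto simp: Q_def)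
      then have n: "norm (x - y) \<le> real ?N * h" by (rule cell_norm_diff[OF h])
      have n0: "norm (x - y) > 0" using True by simp
      have "norm (x - y) powr ?a \<le> ?D" using n s by (intro powr_mono2) auto
      moreover have "norm (x - y) powr ?a > 0" using n0 by simp
      ultimately have "1 \<le> ?D / norm (x - y) powr ?a" by (simp only: le_divide_eq_1_pos)
      then have "1 \<le> ?D * kern s (x - y)"
        unfolding kern_def powr_minus divide_inverse .
      then have "(u x - u y) * (u x - u y) \<le> ?D * kern s (x - y) * ((u x - u y) * (u x - u y))"
        using mult_right_mono[of 1 _ "(u x - u y) * (u x - u y)"] by simp
      then show ?thesis using True unfolding p
        by (simp add: frac_integrand_kern ennreal_mult'[symmetric] mult_ac ennreal_leI)
    next
      case False
      then show ?thesis unfolding p by (auto simp: indicator_def)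
    qed
  qed
  also have "\<dots> = ennreal ?D * ?G"
    by (intro nn_integral_cmult indicator_Times_mult_measurable) measurable
  finally have key: "ennreal (2 * m * S - 2 * I\<^sup>2) \<le> ennreal ?D * ?G" .
  have S0: "S \<ge> 0" unfolding S_def by (rule integral_nonneg_AE) simp
  have "ennreal S \<le> ennreal (I\<^sup>2 / h ^ ?N) + ennreal (?D / (2 * h ^ ?N)) * ?G"
  \<comment> \<open>Coercion to \<open>ennreal\<close> truncates negative reals to 0, so the sign of
    the variance term is split off before passing to it.\<close>
  proof (cases "2 * m * S - 2 * I\<^sup>2 \<le> 0")
    case True
    then have "S \<le> I\<^sup>2 / m" using m by (simp add: field_simps)
    also have "\<dots> \<le> I\<^sup>2 / h ^ ?N" using mh hN by (intro divide_left_mono) (auto simp: m)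
    finally show ?thesis by (intro add_increasing2) (auto intro: ennreal_leI)
  next
    case False
    have "S - I\<^sup>2 / m = (2 * m * S - 2 * I\<^sup>2) / (2 * m)" using m by (simp add: field_simps)
    also have "\<dots> \<le> (2 * m * S - 2 * I\<^sup>2) / (2 * h ^ ?N)" using False mh hN m by (intro divide_left_mono) auto
    finally have "S \<le> I\<^sup>2 / m + (2 * m * S - 2 * I\<^sup>2) / (2 * h ^ ?N)" by simp
    also have "I\<^sup>2 / m \<le> I\<^sup>2 / h ^ ?N" using mh hN by (intro divide_left_mono) (auto simp: m)
    finally have "ennreal S \<le> ennreal (I\<^sup>2 / h ^ ?N + (2 * m * S - 2 * I\<^sup>2) / (2 * h ^ ?N))" by (auto intro: ennreal_leI)
    also have "\<dots> = ennreal (I\<^sup>2 / h ^ ?N) + ennreal (1 / (2 * h ^ ?N)) * ennreal (2 * m * S - 2 * I\<^sup>2)"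
      using False hN by (subst ennreal_plus) (auto simp: ennreal_mult'[symmetric])
    also have "\<dots> \<le> ennreal (I\<^sup>2 / h ^ ?N) + ennreal (1 / (2 * h ^ ?N)) * (ennreal ?D * ?G)"
      by (intro add_left_mono mult_left_mono key) simp
    also have "\<dots> = ennreal (I\<^sup>2 / h ^ ?N) + ennreal (?D / (2 * h ^ ?N)) * ?G"
      using hN by (simp add: mult.assoc[symmetric] ennreal_mult'[symmetric])
    finally show ?thesis .
  qed
  then show ?thesis unfolding S_def I_def .
qed

context frac_domain
begin

text \<open>The products \<open>Q \<times> Q\<close> of distinct cells are disjoint, so the local
  energies add up to at most the full one. The power \<open>h powr (2 * s)\<close> is what remains
  of \<open>h powr (N + 2 * s)\<close> after division by \<open>h ^ N\<close>; it makes the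
  remainder small on fine grids.\<close>

lemma square_integral_le_cells:
  assumes h: "h > 0" and u: "fin_en s u" "vanishing u"
  shows "(LINT x|lborel. u x * u x) \<le>
     (\<Sum>z\<in>cell h ` \<Omega>. (LINT x|lborel. indicator {x. cell h x = z} x * u x)\<^sup>2 / h ^ DIM('a))
     + real DIM('a) powr (real DIM('a) + 2 * s) * h powr (2 * s) / 2 * energy s u"
proof -
  let ?Z = "cell h ` \<Omega>" let ?Q = "\<lambda>z. {x. cell h x = z}" let ?N = "DIM('a)"
  let ?c = "(real ?N * h) powr (real ?N + 2 * s) / (2 * h ^ ?N)"
  have finZ: "finite ?Z" by (rule finite_cell_image[OF h bounded_dom])
  have [measurable]: "u \<in> borel_measurable borel" by (rule fin_en_measurable[OF u(1)])
  have [measurable]: "?Q z \<in> sets borel" for z by measurable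
  have u2: "integrable lborel (\<lambda>x. u x * u x)" using poincare u by blast
  have i2: "integrable lborel (\<lambda>x. indicator (?Q z) x * (u x * u x))" for z
    using integrable_mult_indicator[OF _ u2, of "?Q z"] by simp
  have "(LINT x|lborel. u x * u x) = (LINT x|lborel. (\<Sum>z\<in>?Z. indicator (?Q z) x * (u x * u x)))"
  proof (rule integral_cong_AE)
    show "AE x in lborel. u x * u x = (\<Sum>z\<in>?Z. indicator (?Q z) x * (u x * u x))"
      using u(2)[unfolded vanishing_def]
    proof eventually_elim
      fix x assume "x \<notin> \<Omega> \<longrightarrow> u x = 0"
      then show "u x * u x = (\<Sum>z\<in>?Z. indicator (?Q z) x * (u x * u x))"
        using finZ by (cases "x \<in> \<Omega>") (auto simp: indicator_def sum.delta if_distrib[of "\<lambda>t. t * _"] cong: if_cong)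
    qed
  qed measurable
  also have "\<dots> = (\<Sum>z\<in>?Z. (LINT x|lborel. indicator (?Q z) x * (u x * u x)))"
    by (rule Bochner_Integration.integral_sum) (rule i2)
  finally have "ennreal (LINT x|lborel. u x * u x) = (\<Sum>z\<in>?Z. ennreal (LINT x|lborel. indicator (?Q z) x * (u x * u x)))"
    by (subst sum_ennreal) (auto intro!: integral_nonneg_AE)
  also have "\<dots> \<le> (\<Sum>z\<in>?Z. ennreal ((LINT x|lborel. indicator (?Q z) x * u x)\<^sup>2 / h ^ ?N) +
       ennreal ?c * (\<integral>\<^sup>+p. indicator (?Q z \<times> ?Q z) p * ennreal (density s u p) \<partial>lborel))"
  proof (rule sum_mono)
    fix z assume "z \<in> ?Z"
    then obtain x0 where "z = cell h x0" by blast
    then show "ennreal (LINT x|lborel. indicator (?Q z) x * (u x * u x)) \<le> ennreal ((LINT x|lborel. indicator (?Q z) x * u x)\<^sup>2 / h ^ ?N) +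
       ennreal ?c * (\<integral>\<^sup>+p. indicator (?Q z \<times> ?Q z) p * ennreal (density s u p) \<partial>lborel)"
      using cell_poincare[OF h s_pos _ u2, of "?Q z" x0] by simp
  qed
  also have "\<dots> = (\<Sum>z\<in>?Z. ennreal ((LINT x|lborel. indicator (?Q z) x * u x)\<^sup>2 / h ^ ?N)) +
     ennreal ?c * (\<integral>\<^sup>+p. (\<Sum>z\<in>?Z. indicator (?Q z \<times> ?Q z) p * ennreal (density s u p)) \<partial>lborel)"
  proof -
    have "(\<integral>\<^sup>+p. (\<Sum>z\<in>?Z. indicator (?Q z \<times> ?Q z) p * ennreal (density s u p)) \<partial>lborel)
      = (\<Sum>z\<in>?Z. \<integral>\<^sup>+p. indicator (?Q z \<times> ?Q z) p * ennreal (density s u p) \<partial>lborel)"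
      by (intro nn_integral_sum indicator_Times_mult_measurable) measurable
    then show ?thesis by (simp only: sum.distrib sum_distrib_left)
  qed
  also have "\<dots> \<le> (\<Sum>z\<in>?Z. ennreal ((LINT x|lborel. indicator (?Q z) x * u x)\<^sup>2 / h ^ ?N)) +
     ennreal ?c * (\<integral>\<^sup>+p. ennreal (density s u p) \<partial>lborel)"
  proof (intro add_left_mono mult_left_mono nn_integral_mono)
    fix p :: "'a \<times> 'a"
    have "(\<Sum>z\<in>?Z. indicator (?Q z \<times> ?Q z) p * ennreal (density s u p))
      \<le> (\<Sum>z\<in>?Z. if cell h (fst p) = z then ennreal (density s u p) else 0)"
      by (rule sum_mono) (auto simp: indicator_def)
    also have "\<dots> \<le> ennreal (density s u p)" using finZ by (simp add: sum.delta)
    finally show "(\<Sum>z\<in>?Z. indicator (?Q z \<times> ?Q z) p * ennreal (density s u p)) \<le> ennreal (density s u p)" .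
  qed simp
  also have "\<dots> = ennreal ((\<Sum>z\<in>?Z. (LINT x|lborel. indicator (?Q z) x * u x)\<^sup>2 / h ^ ?N) + ?c * energy s u)"
    using h en_nonneg[of s u] by (subst ennreal_plus) (auto simp: sum_ennreal nn_integral_frac_integrand[OF u(1)] ennreal_mult''[symmetric] intro!: sum_nonneg)
  finally have "(LINT x|lborel. u x * u x) \<le> (\<Sum>z\<in>?Z. (LINT x|lborel. indicator (?Q z) x * u x)\<^sup>2 / h ^ ?N) + ?c * energy s u"
    using h en_nonneg[of s u] by (subst (asm) ennreal_le_iff) (auto intro!: add_nonneg_nonneg sum_nonneg)
  moreover have "?c = real ?N powr (real ?N + 2 * s) * h powr (2 * s) / 2"
    using h by (simp add: powr_mult powr_add powr_realpow)
  ultimately show ?thesis by (simp only:)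
qed

end

lemma Cauchy_Schwarz_integral:
  fixes f g :: "'b \<Rightarrow> real"
  assumes [measurable]: "f \<in> borel_measurable M" "g \<in> borel_measurable M"
    and i: "integrable M (\<lambda>x. f x * f x)" "integrable M (\<lambda>x. g x * g x)"
  shows "(LINT x|M. f x * g x)\<^sup>2 \<le> (LINT x|M. f x * f x) * (LINT x|M. g x * g x)"
proof -
  have fg: "integrable M (\<lambda>x. f x * g x)" by (rule integrable_mult_of_squares) (use i in auto)
  let ?F = "LINT x|M. f x * f x" and ?G = "LINT x|M. g x * g x" and ?I = "LINT x|M. f x * g x"
  have q: "0 \<le> t * t * ?F + 2 * t * r * ?I + r * r * ?G" for t r
  proof -
    have "0 \<le> (LINT x|M. (t * f x + r * g x) * (t * f x + r * g x))" by (rule integral_nonneg_AE) simp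
    also have "(\<lambda>x. (t * f x + r * g x) * (t * f x + r * g x)) = (\<lambda>x. t * t * (f x * f x) + 2 * t * r * (f x * g x) + r * r * (g x * g x))"
      by (auto simp: algebra_simps)
    finally show ?thesis using i fg by simp
  qed
  have F0: "0 \<le> ?F" by (rule integral_nonneg_AE) simp
  show ?thesis
  proof (cases "?F = 0")
    case True
    have "?I = 0"
    proof (rule ccontr)
      assume ne: "?I \<noteq> 0"
      have "0 \<le> 2 * t * ?I + ?G" for t using q[of t 1] True by simp
      \<comment> \<open>This value makes the affine function of \<open>t\<close> equal to
        -1.\<close>
      from this[of "- (?G + 1) / (2 * ?I)"] show False using ne by (simp add: field_simps)
    qed
    then show ?thesis using True by simp
  next
    case False
    then have Fp: "?F > 0" using F0 by linarith
    have "0 \<le> ?I * ?I * ?F - 2 * ?I * ?F * ?I + ?F * ?F * ?G" using q[of "- ?I" ?F] by (simp add: algebra_simps)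
    then have "0 \<le> ?F * (?F * ?G - ?I\<^sup>2)" by (simp add: algebra_simps power2_eq_square)
    then show ?thesis using Fp by (simp add: zero_le_mult_iff)
  qed
qed

lemma finite_common_convergent_subseq:
  fixes a :: "'i \<Rightarrow> nat \<Rightarrow> real"
  assumes "finite Z" "\<And>z. z \<in> Z \<Longrightarrow> bounded (range (a z))"
  shows "\<exists>r. strict_mono r \<and> (\<forall>z\<in>Z. convergent (\<lambda>k. a z (r k)))"
  using assms
proof (induction Z rule: finite_induct)
  case empty
  show ?case by (intro exI[of _ id]) (auto simp: strict_mono_def)
next
  case (insert z Z)
  then obtain r where r: "strict_mono r" "\<forall>z\<in>Z. convergent (\<lambda>k. a z (r k))" by auto
  have "bounded (range (\<lambda>k. a z (r k)))"
    by (rule bounded_subset[of "range (a z)"]) (use insert in auto)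
  then obtain l r' where r': "strict_mono r'" "((\<lambda>k. a z (r k)) \<circ> r') \<longlonglongrightarrow> l"
    using bounded_imp_convergent_subsequence by blast
  have "convergent (\<lambda>k. a y ((r \<circ> r') k))" if "y \<in> insert z Z" for y
  proof (cases "y = z")
    case True then show ?thesis using r'(2) by (auto simp: convergent_def o_def)
  next
    case False
    then have "convergent (\<lambda>k. a y (r k))" using r(2) that by blast
    from convergent_subseq_convergent[OF this r'(1)] show ?thesis by (simp add: o_def)
  qed
  then show ?case using strict_mono_o[OF r(1) r'(1)] by blast
qed

section \<open>The L^2 inner product, compact embedding and almost everywhere limits\<close>

context frac_domain
begin

definition ip :: "('a \<Rightarrow> real) \<Rightarrow> ('a \<Rightarrow> real) \<Rightarrow> real" where
  "ip u v = (LINT x|lborel. u x * v x)"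

abbreviation sqnorm :: "('a \<Rightarrow> real) \<Rightarrow> real" where
  "sqnorm u \<equiv> ip u u"

lemma ip_commute: "ip u v = ip v u"
  by (simp add: ip_def mult.commute)

lemma ip_nonneg: "0 \<le> sqnorm u"
  unfolding ip_def by (rule integral_nonneg_AE) simp

lemma ip_add_left: "u \<in> H \<Longrightarrow> v \<in> H \<Longrightarrow> w \<in> H \<Longrightarrow> ip (\<lambda>x. u x + v x) w = ip u w + ip v w"
  unfolding ip_def by (simp add: distrib_right H_integrable_mult)

lemma ip_diff_left: "u \<in> H \<Longrightarrow> v \<in> H \<Longrightarrow> w \<in> H \<Longrightarrow> ip (\<lambda>x. u x - v x) w = ip u w - ip v w"
  unfolding ip_def by (simp add: left_diff_distrib H_integrable_mult)

lemma ip_cmult_left: "ip (\<lambda>x. c * u x) w = c * ip u w"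
  unfolding ip_def by (simp add: mult.assoc)

lemma ip_add_right: "u \<in> H \<Longrightarrow> v \<in> H \<Longrightarrow> w \<in> H \<Longrightarrow> ip w (\<lambda>x. u x + v x) = ip w u + ip w v"
  by (subst (1 2 3) ip_commute) (rule ip_add_left)

lemma ip_diff_right: "u \<in> H \<Longrightarrow> v \<in> H \<Longrightarrow> w \<in> H \<Longrightarrow> ip w (\<lambda>x. u x - v x) = ip w u - ip w v"
  by (subst (1 2 3) ip_commute) (rule ip_diff_left)

lemma ip_cmult_right: "ip w (\<lambda>x. c * u x) = c * ip w u"
  by (subst (1 2) ip_commute) (rule ip_cmult_left)

lemma ip_add_self: "u \<in> H \<Longrightarrow> v \<in> H \<Longrightarrow> sqnorm (\<lambda>x. u x + v x) = sqnorm u + sqnorm v + 2 * ip u v"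
  by (simp add: ip_add_left ip_add_right H_add ip_commute[of v u])

lemma ip_diff_self: "u \<in> H \<Longrightarrow> v \<in> H \<Longrightarrow> sqnorm (\<lambda>x. u x - v x) = sqnorm u + sqnorm v - 2 * ip u v"
  by (simp add: ip_diff_left ip_diff_right H_diff ip_commute[of v u])

lemma ip_Cauchy_Schwarz: "u \<in> H \<Longrightarrow> v \<in> H \<Longrightarrow> (ip u v)\<^sup>2 \<le> sqnorm u * sqnorm v"
  unfolding ip_def by (rule Cauchy_Schwarz_integral) (auto intro: H_measurable H_integrable_square)

lemma ip_eq_0_iff: "u \<in> H \<Longrightarrow> sqnorm u = 0 \<longleftrightarrow> (AE x in lborel. u x = 0)"
  unfolding ip_def using H_integrable_square[of u] by (subst integral_nonneg_eq_0_iff_AE) auto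

lemma ip_poincare: "\<exists>C>0. \<forall>u\<in>H. sqnorm u \<le> C * energy s u"
  using poincare H_fin_en H_vanishing unfolding ip_def by blast

text \<open>On each grid the finitely many cell integrals form bounded sequences. Along a diagonal
  subsequence all of them converge, for every side \<open>1 / Suc n\<close>; on a fine grid the
  remaining term of \<open>square_integral_le_cells\<close> is small by the energy bound. The
  conclusion is stated as a Cauchy property, as the limit is built later.\<close>

lemma rellich:
  fixes w :: "nat \<Rightarrow> 'a \<Rightarrow> real"
  assumes w: "\<And>k. w k \<in> H" and M: "\<And>k. energy s (w k) \<le> M"
  shows "\<exists>r::nat \<Rightarrow> nat. strict_mono r \<and> (\<forall>\<epsilon>>0. \<exists>K. \<forall>j\<ge>K. \<forall>l\<ge>K.
    sqnorm (\<lambda>x. w (r j) x - w (r l) x) \<le> \<epsilon>)"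
proof -
  define h where "h n = 1 / real (Suc n)" for n
  have hpos: "h n > 0" for n by (simp add: h_def)
  define Z where "Z n = cell (h n) ` \<Omega>" for n
  define a where "a n z k = (LINT x|lborel. indicator {x. cell (h n) x = z} x * w k x)" for n z k
  have finZ: "finite (Z n)" for n unfolding Z_def by (rule finite_cell_image[OF hpos bounded_dom])
  have [measurable]: "w k \<in> borel_measurable borel" for k by (rule H_measurable[OF w])
  have Qm [measurable]: "{x :: 'a. cell (h n) x = z} \<in> sets borel" for n z by measurable
  have iQ: "integrable lborel (\<lambda>x. indicator {x. cell (h n) x = z} x * w k x)"
   and aB: "\<bar>a n z k\<bar> \<le> measure lborel {x. cell (h n) x = z} + sqnorm (w k)" if zZ: "z \<in> Z n" for n z k
  proof -
    obtain x0 where x0: "z = cell (h n) x0" using zZ by (auto simp: Z_def)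
    have fin: "emeasure lborel {x. cell (h n) x = z} < \<infinity>" using measure_cell(1)[OF hpos, of n x0] x0 by simp
    have i1: "integrable lborel (indicator {x. cell (h n) x = z} :: 'a \<Rightarrow> real)" using fin by simp
    have i2: "integrable lborel (\<lambda>x. indicator {x. cell (h n) x = z} x + w k x * w k x)"
      by (rule Bochner_Integration.integrable_add[OF i1 H_integrable_square[OF w]])
    have le: "\<bar>indicator {x. cell (h n) x = z} x * w k x\<bar> \<le> indicator {x. cell (h n) x = z} x + w k x * w k x" for x
    proof -
      have "2 * \<bar>w k x\<bar> \<le> 1 + w k x * w k x" using sum_squares_bound[of 1 "\<bar>w k x\<bar>"] by (simp add: power2_eq_square)
      then show ?thesis by (auto simp: indicator_def)
    qed
    show i3: "integrable lborel (\<lambda>x. indicator {x. cell (h n) x = z} x * w k x)"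
      by (rule Bochner_Integration.integrable_bound[OF i2])
         (use le in \<open>auto intro!: AE_I2 order_trans[OF _ abs_ge_self]\<close>)
    have "\<bar>a n z k\<bar> \<le> (LINT x|lborel. \<bar>indicator {x. cell (h n) x = z} x * w k x\<bar>)"
      unfolding a_def by (rule integral_abs_bound)
    also have "\<dots> \<le> (LINT x|lborel. indicator {x. cell (h n) x = z} x + w k x * w k x)"
      by (rule integral_mono) (use i3 i2 le in auto)
    also have "\<dots> = measure lborel {x. cell (h n) x = z} + sqnorm (w k)"
      using i1 H_integrable_square[OF w, of k] by (simp add: ip_def)
    finally show "\<bar>a n z k\<bar> \<le> measure lborel {x. cell (h n) x = z} + sqnorm (w k)" .
  qed
  obtain C where C: "C > 0" "\<And>u. u \<in> H \<Longrightarrow> sqnorm u \<le> C * energy s u" using ip_poincare by blast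
  have ipB: "sqnorm (w k) \<le> C * M" for k
    by (rule order_trans[OF C(2)[OF w] mult_left_mono[OF M less_imp_le[OF C(1)]]])
  have bnd: "bounded (range (a n z))" if "z \<in> Z n" for n z
    unfolding bounded_iff
    by (intro exI[of _ "measure lborel {x. cell (h n) x = z} + C * M"])
       (auto intro!: order_trans[OF aB[OF that] add_left_mono[OF ipB]])
  interpret sub: subseqs "\<lambda>n r. \<forall>z\<in>Z n. convergent (\<lambda>k. a n z (r k))"
  proof
    fix n and q :: "nat \<Rightarrow> nat" assume "strict_mono q"
    have "bounded (range (\<lambda>k. a n z (q k)))" if "z \<in> Z n" for z
      by (rule bounded_subset[OF bnd[OF that]]) auto
    then show "\<exists>r'. strict_mono r' \<and> (\<forall>z\<in>Z n. convergent (\<lambda>k. a n z ((q \<circ> r') k)))"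
      using finite_common_convergent_subseq[OF finZ, of n "\<lambda>z k. a n z (q k)"] by (simp add: o_def)
  qed
  define d where "d = sub.diagseq"
  have r: "strict_mono d" unfolding d_def by (rule sub.subseq_diagseq)
  have conv: "convergent (\<lambda>k. a n z (d k))" if z: "z \<in> Z n" for n z
  proof -
    have "\<forall>z\<in>Z n. convergent (\<lambda>k. a n z ((d \<circ> (+) (Suc n)) k))"
      unfolding d_def
    proof (rule sub.diagseq_holds)
      fix r q :: "nat \<Rightarrow> nat" and n assume "strict_mono r" and c: "\<forall>z\<in>Z n. convergent (\<lambda>k. a n z (q k))"
      show "\<forall>z\<in>Z n. convergent (\<lambda>k. a n z ((q \<circ> r) k))"
      proof
        fix z assume "z \<in> Z n"
        then have "convergent (\<lambda>k. a n z (q k))" using c by blast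
        from convergent_subseq_convergent[OF this \<open>strict_mono r\<close>]
        show "convergent (\<lambda>k. a n z ((q \<circ> r) k))" by (simp add: o_def)
      qed
    qed
    then obtain L where L: "(\<lambda>k. a n z (d (Suc n + k))) \<longlonglongrightarrow> L" using z by (auto simp: convergent_def)
    \<comment> \<open>The diagonal sequence is known to refine the \<open>n\<close>-th extraction
      only from index \<open>Suc n\<close> on; convergence ignores the initial segment.\<close>
    have "(\<lambda>k. a n z (d k)) \<longlonglongrightarrow> L"
      by (rule LIMSEQ_offset[where k = "Suc n"]) (use L in \<open>simp add: add.commute\<close>)
    then show ?thesis by (auto simp: convergent_def)
  qed
  have M0: "M \<ge> 0" using M[of 0] en_nonneg[of s "w 0"] by linarith
  have kk: "\<exists>K. \<forall>j\<ge>K. \<forall>l\<ge>K. sqnorm (\<lambda>x. w (d j) x - w (d l) x) \<le> \<epsilon>" if e: "\<epsilon> > 0" for \<epsilon>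
  proof -
    \<comment> \<open>\<open>4 * M\<close> bounds the energy of a difference of two members of the
      sequence.\<close>
    let ?c = "real DIM('a) powr (real DIM('a) + 2 * s) / 2 * (4 * M)"
    have c0: "?c \<ge> 0" using M0 by simp
    have "(\<lambda>n. ?c * h n powr (2 * s)) \<longlonglongrightarrow> ?c * 0"
    proof (intro tendsto_intros)
      have "h \<longlonglongrightarrow> 0" using LIMSEQ_inverse_real_of_nat by (simp add: h_def[abs_def] inverse_eq_divide)
      then show "(\<lambda>n. h n powr (2 * s)) \<longlonglongrightarrow> 0"
        using tendsto_zero_powrI[of h sequentially "\<lambda>_. 2 * s" "2 * s"] hpos s_pos by (simp add: less_imp_le)
    qed
    then have "eventually (\<lambda>n. ?c * h n powr (2 * s) < \<epsilon> / 2) sequentially"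
      using e by (intro order_tendstoD(2)) auto
    then obtain n where n: "?c * h n powr (2 * s) < \<epsilon> / 2" by (auto simp: eventually_sequentially)
    define L where "L z = lim (\<lambda>k. a n z (d k))" for z
    have L: "(\<lambda>k. a n z (d k)) \<longlonglongrightarrow> L z" if "z \<in> Z n" for z
      using conv[OF that] by (simp add: L_def convergent_LIMSEQ_iff)
    define g where "g k = (\<Sum>z\<in>Z n. 2 * (a n z (d k) - L z)\<^sup>2 / h n ^ DIM('a))" for k
    have "g \<longlonglongrightarrow> (\<Sum>z\<in>Z n. 2 * (L z - L z)\<^sup>2 / h n ^ DIM('a))"
      unfolding g_def[abs_def] using hpos[of n] by (intro tendsto_intros L) auto
    then have "eventually (\<lambda>k. g k < \<epsilon> / 4) sequentially" using e by (intro order_tendstoD(2)) auto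
    then obtain K where K: "\<And>k. k \<ge> K \<Longrightarrow> g k < \<epsilon> / 4" by (auto simp: eventually_sequentially)
    have "sqnorm (\<lambda>x. w (d j) x - w (d l) x) \<le> \<epsilon>" if jl: "j \<ge> K" "l \<ge> K" for j l
    proof -
      let ?u = "\<lambda>x. w (d j) x - w (d l) x"
      have uH: "?u \<in> H" by (rule H_diff[OF w w])
      have enu: "energy s ?u \<le> 4 * M"
        using en_diff_le[OF H_fin_en[OF w] H_fin_en[OF w], of "d j" "d l"] M[of "d j"] M[of "d l"] by linarith
      have "sqnorm ?u \<le> (\<Sum>z\<in>Z n. (LINT x|lborel. indicator {x. cell (h n) x = z} x * ?u x)\<^sup>2 / h n ^ DIM('a))
         + real DIM('a) powr (real DIM('a) + 2 * s) * h n powr (2 * s) / 2 * energy s ?u"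
        unfolding ip_def Z_def by (rule square_integral_le_cells[OF hpos H_fin_en[OF uH] H_vanishing[OF uH]])
      also have "real DIM('a) powr (real DIM('a) + 2 * s) * h n powr (2 * s) / 2 * energy s ?u
         \<le> real DIM('a) powr (real DIM('a) + 2 * s) * h n powr (2 * s) / 2 * (4 * M)"
        by (rule mult_left_mono[OF enu]) simp
      also have "\<dots> = ?c * h n powr (2 * s)" by simp
      also have "\<dots> \<le> \<epsilon> / 2" using n by simp
      also have "(\<Sum>z\<in>Z n. (LINT x|lborel. indicator {x. cell (h n) x = z} x * ?u x)\<^sup>2 / h n ^ DIM('a)) \<le> g j + g l"
        unfolding g_def sum.distrib[symmetric]
      proof (rule sum_mono)
        fix z assume z: "z \<in> Z n"
        have "(LINT x|lborel. indicator {x. cell (h n) x = z} x * ?u x) = a n z (d j) - a n z (d l)"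
          unfolding a_def using iQ[OF z] by (simp add: right_diff_distrib)
        moreover have "(a n z (d j) - a n z (d l))\<^sup>2 \<le> 2 * (a n z (d j) - L z)\<^sup>2 + 2 * (a n z (d l) - L z)\<^sup>2"
          using zero_le_power2[of "(a n z (d j) - L z) + (a n z (d l) - L z)"] by (simp add: power2_eq_square algebra_simps)
        ultimately have "(LINT x|lborel. indicator {x. cell (h n) x = z} x * ?u x)\<^sup>2 / h n ^ DIM('a)
           \<le> (2 * (a n z (d j) - L z)\<^sup>2 + 2 * (a n z (d l) - L z)\<^sup>2) / h n ^ DIM('a)"
          using hpos[of n] by (simp add: divide_right_mono)
        then show "(LINT x|lborel. indicator {x. cell (h n) x = z} x * ?u x)\<^sup>2 / h n ^ DIM('a)
           \<le> 2 * (a n z (d j) - L z)\<^sup>2 / h n ^ DIM('a) + 2 * (a n z (d l) - L z)\<^sup>2 / h n ^ DIM('a)"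
          by (simp add: add_divide_distrib)
      qed
      finally show ?thesis using K[OF jl(1)] K[OF jl(2)] by linarith
    qed
    then show ?thesis by blast
  qed
  show ?thesis
  proof (rule exI[where x = d], intro conjI allI impI)
    show "strict_mono d" by (rule r)
  qed (rule kk)
qed

text \<open>Along a fast subsequence the increments have summable integrals over
  \<open>\<Omega>\<close>, so their series converges absolutely at almost every point.\<close>

lemma H_Cauchy_AE_subseq:
  fixes w :: "nat \<Rightarrow> 'a \<Rightarrow> real"
  assumes w: "\<And>k. w k \<in> H"
    and cau: "\<And>\<epsilon>. \<epsilon> > 0 \<Longrightarrow> \<exists>K. \<forall>j\<ge>K. \<forall>l\<ge>K. energy s (\<lambda>x. w j x - w l x) \<le> \<epsilon>"
  shows "\<exists>r. strict_mono r \<and> (AE x in lborel. convergent (\<lambda>k. w (r k) x))"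
proof -
  have "\<exists>K. \<forall>n. (\<forall>j\<ge>K n. \<forall>l\<ge>K n. energy s (\<lambda>x. w j x - w l x) \<le> (1/4) ^ n)"
    by (rule choice) (use cau in simp)
  then obtain K where K: "\<And>n j l. j \<ge> K n \<Longrightarrow> l \<ge> K n \<Longrightarrow> energy s (\<lambda>x. w j x - w l x) \<le> (1/4) ^ n" by blast
  \<comment> \<open>The partial sums dominate each \<open>K n\<close>, and the added
    \<open>n\<close> makes the sequence strictly increasing.\<close>
  define r where "r n = (\<Sum>i\<le>n. K i) + n" for n
  have r: "strict_mono r" by (rule strict_monoI_Suc) (simp add: r_def)
  have rK: "r n \<ge> K n" for n unfolding r_def by (intro trans_le_add1 member_le_sum) auto
  have rK': "r (Suc n) \<ge> K n" for n using rK[of n] strict_monoD[OF r, of n "Suc n"] by simp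
  define g where "g n x = w (r (Suc n)) x - w (r n) x" for n x
  have gH: "g n \<in> H" for n unfolding g_def by (rule H_diff[OF w w])
  have [measurable]: "g n \<in> borel_measurable borel" for n by (rule H_measurable[OF gH])
  have gen: "energy s (g n) \<le> (1/4) ^ n" for n unfolding g_def using K[OF rK' rK] .
  obtain C where C: "C > 0" "\<And>u. u \<in> H \<Longrightarrow> sqnorm u \<le> C * energy s u" using ip_poincare by blast
  define m where "m = measure lborel \<Omega>"
  have bound: "(\<integral>\<^sup>+x. indicator \<Omega> x * ennreal \<bar>g n x\<bar> \<partial>lborel) \<le> ennreal ((m + C) * (1/2) ^ n)" for n
  proof -
    \<comment> \<open>A weighted mean inequality: the weights \<open>2 ^ n\<close> and
      \<open>(1/2) ^ n\<close> balance against the energy bound \<open>(1/4) ^ n\<close>, and both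
      terms become of order \<open>(1/2) ^ n\<close>.\<close>
    have le: "indicator \<Omega> x * ennreal \<bar>g n x\<bar> \<le> ennreal ((1/2) ^ n) * indicator \<Omega> x + ennreal (2 ^ n) * ennreal (g n x * g n x)" for x
    proof -
      have "2 * (1 * (2 ^ n * \<bar>g n x\<bar>)) \<le> 1 + (2 ^ n * \<bar>g n x\<bar>)\<^sup>2"
        using sum_squares_bound[of 1 "2 ^ n * \<bar>g n x\<bar>"] by simp
      moreover have "(2 ^ n * \<bar>g n x\<bar>)\<^sup>2 = 2 ^ n * (2 ^ n * (g n x * g n x))"
        by (simp only: power_mult_distrib power2_abs) (simp add: power2_eq_square)
      moreover have "0 \<le> 2 ^ n * \<bar>g n x\<bar>" by simp
      ultimately have "2 ^ n * \<bar>g n x\<bar> \<le> 1 + 2 ^ n * (2 ^ n * (g n x * g n x))"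
        by linarith
      then have "(1/2) ^ n * (2 ^ n * \<bar>g n x\<bar>) \<le> (1/2) ^ n * (1 + 2 ^ n * (2 ^ n * (g n x * g n x)))"
        by (rule mult_left_mono) simp
      then have "\<bar>g n x\<bar> \<le> (1/2) ^ n + 2 ^ n * (g n x * g n x)"
        by (simp add: distrib_left power_divide)
      then have "ennreal \<bar>g n x\<bar> \<le> ennreal ((1/2) ^ n) + ennreal (2 ^ n) * ennreal (g n x * g n x)"
        by (simp add: ennreal_mult'[symmetric] ennreal_plus[symmetric] ennreal_leI del: ennreal_plus)
      then show ?thesis by (auto simp: indicator_def)
    qed
    have "(\<integral>\<^sup>+x. indicator \<Omega> x * ennreal \<bar>g n x\<bar> \<partial>lborel) \<le> (\<integral>\<^sup>+x. ennreal ((1/2) ^ n) * indicator \<Omega> x + ennreal (2 ^ n) * ennreal (g n x * g n x) \<partial>lborel)"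
      by (rule nn_integral_mono) (rule le)
    also have "\<dots> = ennreal ((1/2) ^ n) * emeasure lborel \<Omega> + ennreal (2 ^ n) * ennreal (sqnorm (g n))"
      using nn_integral_eq_integral[OF H_integrable_square[OF gH, of n]]
      by (simp add: nn_integral_add nn_integral_cmult ip_def)
    also have "emeasure lborel \<Omega> = ennreal m" unfolding m_def using emeasure_dom_finite by (simp add: emeasure_eq_ennreal_measure)
    also have "ennreal ((1/2) ^ n) * ennreal m + ennreal (2 ^ n) * ennreal (sqnorm (g n)) = ennreal ((1/2) ^ n * m + 2 ^ n * sqnorm (g n))"
      using ip_nonneg[of "g n"] by (simp add: ennreal_mult'[symmetric] ennreal_plus[symmetric] m_def del: ennreal_plus)
    also have "\<dots> \<le> ennreal ((m + C) * (1/2) ^ n)"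
    proof (rule ennreal_leI)
      have "sqnorm (g n) \<le> C * (1/4) ^ n" 
        by (rule order_trans[OF C(2)[OF gH] mult_left_mono[OF gen less_imp_le[OF C(1)]]])
      then have "2 ^ n * sqnorm (g n) \<le> 2 ^ n * (C * (1/4) ^ n)" by (rule mult_left_mono) simp
      also have "\<dots> = C * (1/2) ^ n" by (simp add: power_mult_distrib[symmetric] mult.left_commute)
      finally show "(1/2) ^ n * m + 2 ^ n * sqnorm (g n) \<le> (m + C) * (1/2) ^ n" by (simp add: algebra_simps)
    qed
    finally show ?thesis .
  qed
  have sm: "summable (\<lambda>n. (m + C) * (1/2 :: real) ^ n)" by (intro summable_mult summable_geometric) simp
  have mC: "m + C \<ge> 0" using C(1) by (simp add: m_def)
  have "(\<integral>\<^sup>+x. (\<Sum>n. indicator \<Omega> x * ennreal \<bar>g n x\<bar>) \<partial>lborel) = (\<Sum>n. \<integral>\<^sup>+x. indicator \<Omega> x * ennreal \<bar>g n x\<bar> \<partial>lborel)"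
    by (rule nn_integral_suminf) measurable
  also have "\<dots> \<le> (\<Sum>n. ennreal ((m + C) * (1/2) ^ n))"
    by (intro suminf_le bound) auto
  also have "\<dots> < \<infinity>" using mC by (subst suminf_ennreal2[OF _ sm]) auto
  finally have "AE x in lborel. (\<Sum>n. indicator \<Omega> x * ennreal \<bar>g n x\<bar>) \<noteq> \<infinity>"
    by (intro nn_integral_PInf_AE) auto
  moreover have "AE x in lborel. \<forall>k. x \<notin> \<Omega> \<longrightarrow> w k x = 0"
    unfolding AE_all_countable using H_vanishing[OF w] by (simp add: vanishing_def)
  ultimately have "AE x in lborel. convergent (\<lambda>k. w (r k) x)"
  proof eventually_elim
    fix x assume f: "(\<Sum>n. indicator \<Omega> x * ennreal \<bar>g n x\<bar>) \<noteq> \<infinity>" and z: "\<forall>k. x \<notin> \<Omega> \<longrightarrow> w k x = 0"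
    show "convergent (\<lambda>k. w (r k) x)"
    proof (cases "x \<in> \<Omega>")
      case True
      then have "(\<Sum>n. ennreal \<bar>g n x\<bar>) \<noteq> \<infinity>" using f by simp
      then have "summable (\<lambda>n. \<bar>g n x\<bar>)" by (intro summable_suminf_not_top) auto
      then have "summable (\<lambda>n. g n x)" by (rule summable_rabs_cancel)
      then have "convergent (\<lambda>n. \<Sum>i<n. g i x)" by (simp add: summable_iff_convergent)
      moreover have "(\<Sum>i<n. g i x) = w (r n) x - w (r 0) x" for n
        unfolding g_def by (rule sum_lessThan_telescope)
      ultimately have "convergent (\<lambda>n. w (r n) x - w (r 0) x)" by simp
      then show ?thesis by (simp add: convergent_diff_const_right_iff)
    qed (use z in \<open>simp add: convergent_const\<close>)
  qed
  then show ?thesis using r by blast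
qed

end

section \<open>Constrained minimisers\<close>

context frac_domain
begin

text \<open>The limit must be an actual function, so it is taken pointwise along a subsequence;
  Fatou's lemma on the product space bounds the energy of \<open>w j - f\<close> by the Cauchy bound
  of the whole sequence.\<close>

lemma H_complete:
  fixes w :: "nat \<Rightarrow> 'a \<Rightarrow> real"
  assumes w: "\<And>k. w k \<in> H"
    and cau: "\<And>\<epsilon>. \<epsilon> > 0 \<Longrightarrow> \<exists>K. \<forall>j\<ge>K. \<forall>l\<ge>K. energy s (\<lambda>x. w j x - w l x) \<le> \<epsilon>"
  shows "\<exists>f\<in>H. (\<lambda>k. energy s (\<lambda>x. w k x - f x)) \<longlonglongrightarrow> 0"
proof -
  obtain r where r: "strict_mono r" "AE x in lborel. convergent (\<lambda>k. w (r k) x)"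
    using H_Cauchy_AE_subseq[where w = w, OF w cau] by blast
  have [measurable]: "w k \<in> borel_measurable borel" for k by (rule H_measurable[OF w])
  \<comment> \<open>\<open>lim\<close> is an arbitrary value on the null set where the subsequence
    diverges, yet the function so defined is measurable.\<close>
  define f where "f x = lim (\<lambda>k. w (r k) x)" for x
  have [measurable]: "f \<in> borel_measurable borel" unfolding f_def by measurable
  have lim: "AE x in lborel. (\<lambda>k. w (r k) x) \<longlonglongrightarrow> f x"
    using r(2) by (rule eventually_mono) (simp add: f_def convergent_LIMSEQ_iff)
  have fatou: "(\<integral>\<^sup>+p. ennreal (density s (\<lambda>x. w j x - f x) p) \<partial>lborel) \<le> ennreal \<epsilon>"
    if K: "\<And>l. l \<ge> K \<Longrightarrow> energy s (\<lambda>x. w j x - w l x) \<le> \<epsilon>" for j K \<epsilon>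
  proof -
    let ?F = "\<lambda>k p. ennreal (density s (\<lambda>x. w j x - w (r k) x) p)"
    have "AE p in lborel. ennreal (density s (\<lambda>x. w j x - f x) p) = liminf (\<lambda>k. ?F k p)"
      using AE_lborel_fst[OF lim] AE_lborel_snd[OF lim]
    proof eventually_elim
      fix p :: "'a \<times> 'a"
      assume a: "(\<lambda>k. w (r k) (fst p)) \<longlonglongrightarrow> f (fst p)" "(\<lambda>k. w (r k) (snd p)) \<longlonglongrightarrow> f (snd p)"
      obtain x y where p: "p = (x, y)" by (cases p)
      have a': "(\<lambda>k. w (r k) x) \<longlonglongrightarrow> f x" "(\<lambda>k. w (r k) y) \<longlonglongrightarrow> f y" using a p by auto
      have "(\<lambda>k. ?F k p) \<longlonglongrightarrow> ennreal (density s (\<lambda>x. w j x - f x) p)"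
        unfolding p frac_integrand_kern by (intro tendsto_intros a')
      then show "ennreal (density s (\<lambda>x. w j x - f x) p) = liminf (\<lambda>k. ?F k p)"
        by (rule lim_imp_Liminf[OF sequentially_bot, symmetric])
    qed
    then have "(\<integral>\<^sup>+p. ennreal (density s (\<lambda>x. w j x - f x) p) \<partial>lborel)
       = (\<integral>\<^sup>+p. liminf (\<lambda>k. ?F k p) \<partial>lborel)"
      by (rule nn_integral_cong_AE)
    also have "\<dots> \<le> liminf (\<lambda>k. \<integral>\<^sup>+p. ?F k p \<partial>lborel)"
      by (rule nn_integral_liminf) measurable
    also have "\<dots> \<le> liminf (\<lambda>k. ennreal \<epsilon>)"
    proof (rule Liminf_mono)
      show "\<forall>\<^sub>F k in sequentially. (\<integral>\<^sup>+p. ?F k p \<partial>lborel) \<le> ennreal \<epsilon>"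
        unfolding eventually_sequentially
      proof (intro exI[of _ K] allI impI)
        fix k assume "K \<le> k"
        then have "K \<le> r k" using seq_suble[OF r(1), of k] by linarith
        then show "(\<integral>\<^sup>+p. ?F k p \<partial>lborel) \<le> ennreal \<epsilon>"
          using K by (subst nn_integral_frac_integrand[OF fin_en_diff[OF H_fin_en[OF w] H_fin_en[OF w]]]) (auto intro: ennreal_leI)
      qed
    qed
    also have "\<dots> = ennreal \<epsilon>" by (simp add: Liminf_const)
    finally show ?thesis .
  qed
  have fe: "fin_en s f"
  proof -
    obtain K where K: "\<And>l. l \<ge> K \<Longrightarrow> energy s (\<lambda>x. w K x - w l x) \<le> 1" using cau[of 1] by auto
    have "fin_en s (\<lambda>x. w K x - f x)"
      by (rule fin_enI) (use fatou[where K = K, OF K] in \<open>auto intro: le_less_trans\<close>)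
    from fin_en_diff[OF H_fin_en[OF w[of K]] this] show ?thesis by simp
  qed
  have "AE x in lborel. \<forall>k. x \<notin> \<Omega> \<longrightarrow> w k x = 0"
    unfolding AE_all_countable using H_vanishing[OF w] by (simp add: vanishing_def)
  with lim have van: "vanishing f"
    unfolding vanishing_def
  proof eventually_elim
    fix x assume l: "(\<lambda>k. w (r k) x) \<longlonglongrightarrow> f x" and z: "\<forall>k. x \<notin> \<Omega> \<longrightarrow> w k x = 0"
    show "x \<notin> \<Omega> \<longrightarrow> f x = 0"
    proof
      assume "x \<notin> \<Omega>"
      then have "(\<lambda>k. 0) \<longlonglongrightarrow> f x" using l z by simp
      then show "f x = 0" using LIMSEQ_unique tendsto_const by blast
    qed
  qed
  have ed: "(\<lambda>k. energy s (\<lambda>x. w k x - f x)) \<longlonglongrightarrow> 0"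
  proof (rule LIMSEQ_I)
    fix \<epsilon> :: real assume e: "0 < \<epsilon>"
    obtain K where K: "\<forall>j\<ge>K. \<forall>l\<ge>K. energy s (\<lambda>x. w j x - w l x) \<le> \<epsilon> / 2" using cau[of "\<epsilon> / 2"] e by auto
    have le: "energy s (\<lambda>x. w j x - f x) \<le> \<epsilon> / 2" if "j \<ge> K" for j
      by (rule en_leI[OF fin_en_diff[OF H_fin_en[OF w] fe] _ fatou[where K = K]]) (use e K that in auto)
    show "\<exists>no. \<forall>k\<ge>no. norm (energy s (\<lambda>x. w k x - f x) - 0) < \<epsilon>"
    proof (intro exI[of _ K] allI impI)
      fix k assume "K \<le> k"
      then have "energy s (\<lambda>x. w k x - f x) \<le> \<epsilon> / 2" by (rule le)
      then show "norm (energy s (\<lambda>x. w k x - f x) - 0) < \<epsilon>"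
        using e en_nonneg[of s "\<lambda>x. w k x - f x"] by simp
    qed
  qed
  show ?thesis
  proof (rule bexI)
    show "(\<lambda>k. energy s (\<lambda>x. w k x - f x)) \<longlonglongrightarrow> 0" by (rule ed)
    show "f \<in> H" by (rule H_limit[where w = w, OF fe van w ed])
  qed
qed

lemma zero_of_nonneg_quadratic:
  fixes A B :: real
  assumes "\<And>t. 0 \<le> A * t\<^sup>2 + 2 * B * t"
  shows "B = 0"
proof (rule ccontr)
  assume B: "B \<noteq> 0"
  \<comment> \<open>Dividing by \<open>\<bar>A\<bar> + 1\<close> keeps the step so small that the
    linear term wins, whatever the size of \<open>A\<close>.\<close>
  define t where "t = - B / (\<bar>A\<bar> + 1)"
  have n: "\<bar>A\<bar> + 1 > 0" by simp
  have "A * t\<^sup>2 + 2 * B * t = B\<^sup>2 * (A - 2 * (\<bar>A\<bar> + 1)) / (\<bar>A\<bar> + 1)\<^sup>2"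
    using n unfolding t_def by (simp add: power_divide power2_eq_square divide_simps) (simp add: algebra_simps)
  also have "\<dots> < 0" using B n by (intro divide_neg_pos mult_pos_neg) auto
  finally show False using assms[of t] by simp
qed

lemma ip_tendsto_0:
  assumes w: "\<And>k::nat. w k \<in> H" and v: "v \<in> H" and lim: "(\<lambda>k. energy s (w k)) \<longlonglongrightarrow> 0"
  shows "(\<lambda>k. ip (w k) v) \<longlonglongrightarrow> 0"
proof -
  obtain C where C: "C > 0" "\<And>u. u \<in> H \<Longrightarrow> sqnorm u \<le> C * energy s u" using ip_poincare by blast
  have "(\<lambda>k. (ip (w k) v)\<^sup>2) \<longlonglongrightarrow> 0"
  proof (rule tendsto_sandwich[OF _ _ tendsto_const])
    show "(\<lambda>k. C * sqnorm v * energy s (w k)) \<longlonglongrightarrow> 0" using tendsto_mult_left[OF lim, of "C * sqnorm v"] by simp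
    show "\<forall>\<^sub>F k in sequentially. (ip (w k) v)\<^sup>2 \<le> C * sqnorm v * energy s (w k)"
    proof (intro always_eventually allI)
      fix k
      have "(ip (w k) v)\<^sup>2 \<le> sqnorm (w k) * sqnorm v" by (rule ip_Cauchy_Schwarz[OF w v])
      also have "\<dots> \<le> C * energy s (w k) * sqnorm v" by (rule mult_right_mono[OF C(2)[OF w] ip_nonneg])
      finally show "(ip (w k) v)\<^sup>2 \<le> C * sqnorm v * energy s (w k)" by (simp add: mult_ac)
    qed
  qed simp
  from tendsto_real_sqrt[OF this] show ?thesis by (simp add: tendsto_rabs_zero_iff)
qed

text \<open>The direct method on the L^2 orthogonal complement of \<open>G\<close>, with
  \<open>f0\<close> witnessing that it is nontrivial. \<open>G\<close> is an arbitrary set, so that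
  it can be a single eigenfunction or all even or all odd functions. The Euler-Lagrange equation is
  obtained against the complement; where a full weak solution is wanted, symmetry extends
  it.\<close>

lemma constrained_minimiser:
  assumes G: "G \<subseteq> H" and f0: "f0 \<in> H" "\<And>v. v \<in> G \<Longrightarrow> ip f0 v = 0" "sqnorm f0 > 0"
  shows "\<exists>f \<mu>. f \<in> H \<and> (\<forall>v\<in>G. ip f v = 0) \<and> sqnorm f = 1 \<and> energy s f = \<mu> \<and>
     (\<forall>g\<in>H. (\<forall>v\<in>G. ip g v = 0) \<longrightarrow> en s f g = \<mu> * ip f g \<and> \<mu> * sqnorm g \<le> energy s g)"
proof -
  define V where "V = {g \<in> H. \<forall>v\<in>G. ip g v = 0}"
  have VH: "g \<in> H" if "g \<in> V" for g using that by (simp add: V_def)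
  have V_cmult: "(\<lambda>x. c * g x) \<in> V" if "g \<in> V" for c g
    using that by (simp add: V_def H_cmult ip_cmult_left)
  have V_add: "(\<lambda>x. g x + h x) \<in> V" if "g \<in> V" "h \<in> V" for g h
    using that G by (auto simp: V_def H_add ip_add_left subset_iff)
  have scale: "sqnorm (\<lambda>x. c * g x) = c\<^sup>2 * sqnorm g" "energy s (\<lambda>x. c * g x) = c\<^sup>2 * energy s g" for c g
    by (simp_all add: ip_cmult_left ip_cmult_right en_cmult_left en_cmult_right power2_eq_square)
  define X where "X = {energy s g |g. g \<in> V \<and> sqnorm g = 1}"
  have normalise: "energy s g / sqnorm g \<in> X" if g: "g \<in> V" "sqnorm g > 0" for g
  proof -
    let ?c = "1 / sqrt (sqnorm g)"
    have "?c\<^sup>2 = 1 / sqnorm g" using g(2) by (simp add: power_divide)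
    then have "sqnorm (\<lambda>x. ?c * g x) = 1" "energy s (\<lambda>x. ?c * g x) = energy s g / sqnorm g"
      using scale[of ?c g] g(2) by simp_all
    then show ?thesis unfolding X_def using V_cmult[OF g(1), of ?c] by force
  qed
  have f0V: "f0 \<in> V" using f0 by (simp add: V_def)
  have Xne: "X \<noteq> {}" using normalise[OF f0V f0(3)] by blast
  have Xbdd: "bdd_below X" unfolding X_def by (rule bdd_belowI[of _ 0]) (auto simp: en_nonneg)
  define \<mu> where "\<mu> = Inf X"
  have \<mu>0: "\<mu> \<ge> 0" unfolding \<mu>_def by (rule cInf_greatest[OF Xne]) (auto simp: X_def en_nonneg)
  have low: "\<mu> * sqnorm g \<le> energy s g" if g: "g \<in> V" for g
  proof (cases "sqnorm g = 0")
    case True then show ?thesis by (simp add: en_nonneg)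
  next
    case False
    then have p: "sqnorm g > 0" using ip_nonneg[of g] by linarith
    have "\<mu> \<le> energy s g / sqnorm g" unfolding \<mu>_def by (rule cInf_lower[OF normalise[OF g p] Xbdd])
    then show ?thesis using p by (simp add: field_simps)
  qed
  have "\<exists>g. g \<in> V \<and> sqnorm g = 1 \<and> energy s g < \<mu> + 1 / real (Suc k)" for k
  proof -
    have "\<exists>t\<in>X. t < \<mu> + 1 / real (Suc k)"
      using cInf_less_iff[OF Xne Xbdd, of "\<mu> + 1 / real (Suc k)"] unfolding \<mu>_def by simp
    then show ?thesis unfolding X_def by blast
  qed
  then obtain g where g: "\<And>k. g k \<in> V" "\<And>k. sqnorm (g k) = 1" "\<And>k. energy s (g k) < \<mu> + 1 / real (Suc k)" by metis
  have gH: "g k \<in> H" for k by (rule VH[OF g(1)])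
  have "energy s (g k) \<le> \<mu> + 1" for k
  proof -
    have "1 / real (Suc k) \<le> 1" by simp
    then show ?thesis using g(3)[of k] by linarith
  qed
  from rellich[where w = g, OF gH this] obtain r :: "nat \<Rightarrow> nat" where r: "strict_mono r" and
    rC: "\<forall>\<epsilon>>0. \<exists>K. \<forall>j\<ge>K. \<forall>l\<ge>K. sqnorm (\<lambda>x. g (r j) x - g (r l) x) \<le> \<epsilon>"
    by (elim exE conjE) (rule that)
  define w where "w k = g (r k)" for k
  have wV: "w k \<in> V" and wH: "w k \<in> H" and w1: "sqnorm (w k) = 1" for k using g(1,2) gH by (auto simp: w_def)
  have wen: "energy s (w k) < \<mu> + 1 / real (Suc k)" for k
  proof -
    have "1 / real (Suc (r k)) \<le> 1 / real (Suc k)" using seq_suble[OF r, of k] by (simp add: frac_le)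
    then show ?thesis unfolding w_def using g(3)[of "r k"] by linarith
  qed
  \<comment> \<open>The parallelogram law turns smallness of the \<open>L\<^sup>2\<close> distance into smallness of the energy distance.\<close>
  have para: "energy s (\<lambda>x. w j x - w l x) \<le> 2 / real (Suc j) + 2 / real (Suc l)
     + \<mu> * sqnorm (\<lambda>x. w j x - w l x)" for j l
  proof -
    have "\<mu> * sqnorm (\<lambda>x. w j x + w l x) \<le> energy s (\<lambda>x. w j x + w l x)"
      by (rule low[OF V_add[OF wV wV]])
    then have "\<mu> * (2 + 2 * ip (w j) (w l)) \<le> energy s (w j) + energy s (w l) + 2 * en s (w j) (w l)"
      by (simp add: ip_add_self en_add_self H_fin_en wH w1)
    then show ?thesis
      using wen[of j] wen[of l] by (simp add: ip_diff_self en_diff_self H_fin_en wH w1 algebra_simps)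
  qed
  have cau: "\<exists>K. \<forall>j\<ge>K. \<forall>l\<ge>K. energy s (\<lambda>x. w j x - w l x) \<le> \<epsilon>" if e: "\<epsilon> > 0" for \<epsilon>
  proof -
    \<comment> \<open>The term multiplied by \<open>\<mu>\<close> in \<open>para\<close> then costs
      at most half of \<open>\<epsilon>\<close>; with \<open>K2\<close> below, each of the other two
      costs at most a quarter.\<close>
    have e': "\<epsilon> / (2 * (\<mu> + 1)) > 0" using e \<mu>0 by simp
    have "\<exists>K1. \<forall>j\<ge>K1. \<forall>l\<ge>K1. sqnorm (\<lambda>x. w j x - w l x) \<le> \<epsilon> / (2 * (\<mu> + 1))"
      using rC[THEN spec, THEN mp, OF e'] by (simp only: w_def)
    then obtain K1 where K1: "\<forall>j\<ge>K1. \<forall>l\<ge>K1. sqnorm (\<lambda>x. w j x - w l x) \<le> \<epsilon> / (2 * (\<mu> + 1))"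
      by (elim exE)
    obtain K2 :: nat where K2: "inverse (real (Suc K2)) < \<epsilon> / 8" using reals_Archimedean[of "\<epsilon> / 8"] e by auto
    have "energy s (\<lambda>x. w j x - w l x) \<le> \<epsilon>" if jl: "j \<ge> max K1 K2" "l \<ge> max K1 K2" for j l
    proof -
      have s2: "2 / real (Suc i) \<le> \<epsilon> / 4" if "i \<ge> K2" for i
      proof -
        have "1 / real (Suc i) \<le> 1 / real (Suc K2)" using that by (intro divide_left_mono) auto
        then show ?thesis using K2 by (simp add: inverse_eq_divide)
      qed
      have "\<mu> * sqnorm (\<lambda>x. w j x - w l x) \<le> \<mu> * (\<epsilon> / (2 * (\<mu> + 1)))"
        using K1 jl \<mu>0 by (intro mult_left_mono) auto
      also have "\<dots> \<le> \<epsilon> / 2" using e \<mu>0 by (simp add: field_simps)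
      finally show ?thesis using para[of j l] s2[of j] s2[of l] jl by simp
    qed
    then show ?thesis by (intro exI[of _ "max K1 K2"]) blast
  qed
  obtain f where f: "f \<in> H" "(\<lambda>k. energy s (\<lambda>x. w k x - f x)) \<longlonglongrightarrow> 0"
    using H_complete[where w = w, OF wH cau] by blast
  have dH: "(\<lambda>x. w k x - f x) \<in> H" for k by (rule H_diff[OF wH f(1)])
  have ipl: "(\<lambda>k. ip (w k) v) \<longlonglongrightarrow> ip f v" if v: "v \<in> H" for v
  proof -
    have "(\<lambda>k. ip (\<lambda>x. w k x - f x) v) \<longlonglongrightarrow> 0" by (rule ip_tendsto_0[OF dH v f(2)])
    then show ?thesis by (simp add: ip_diff_left wH f(1) v LIM_zero_iff)
  qed
  have fV: "f \<in> V"
    unfolding V_def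
  proof (intro CollectI conjI f ballI)
    fix v assume v: "v \<in> G"
    then have "(\<lambda>k. ip (w k) v) \<longlonglongrightarrow> ip f v" using G by (intro ipl) auto
    moreover have "ip (w k) v = 0" for k using wV v by (auto simp: V_def)
    ultimately have "(\<lambda>k. 0) \<longlonglongrightarrow> ip f v" by simp
    then show "ip f v = 0" by (rule LIMSEQ_unique[OF _ tendsto_const])
  qed
  obtain C where C: "C > 0" "\<And>u. u \<in> H \<Longrightarrow> sqnorm u \<le> C * energy s u" using ip_poincare by blast
  have dd: "(\<lambda>k. sqnorm (\<lambda>x. w k x - f x)) \<longlonglongrightarrow> 0"
  proof (rule tendsto_sandwich[OF _ _ tendsto_const])
    show "(\<lambda>k. C * energy s (\<lambda>x. w k x - f x)) \<longlonglongrightarrow> 0" using tendsto_mult_left[OF f(2), of C] by simp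
  qed (simp_all add: ip_nonneg C(2)[OF dH])
  have f1: "sqnorm f = 1"
  proof -
    have "sqnorm (\<lambda>x. w k x - f x) = 1 + sqnorm f - 2 * ip (w k) f" for k
      by (simp add: ip_diff_self wH f(1) w1)
    moreover have "(\<lambda>k. 1 + sqnorm f - 2 * ip (w k) f) \<longlonglongrightarrow> 1 + sqnorm f - 2 * sqnorm f"
      by (intro tendsto_intros ipl f)
    ultimately have "(\<lambda>k. sqnorm (\<lambda>x. w k x - f x)) \<longlonglongrightarrow> 1 + sqnorm f - 2 * sqnorm f" by simp
    then have "1 + sqnorm f - 2 * sqnorm f = 0" by (rule LIMSEQ_unique[OF _ dd])
    then show ?thesis by simp
  qed
  have fen: "energy s f \<le> \<mu>"
  proof -
    \<comment> \<open>Expanding the nonnegative energy of \<open>t * w k + (w k - f)\<close> and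
      dividing by \<open>t\<close> controls the mixed term. Letting \<open>k\<close> grow and then
      \<open>t\<close> shrink gives lower semicontinuity.\<close>
    have le: "energy s f \<le> (1 + t) * energy s (w k) + (1 + 1 / t) * energy s (\<lambda>x. w k x - f x)" if t: "t > 0" for t k
    proof -
      let ?d = "\<lambda>x. w k x - f x"
      have fe: "fin_en s (w k)" "fin_en s ?d" by (intro H_fin_en wH dH)+
      have "energy s f = energy s (\<lambda>x. w k x - ?d x)" by simp
      also have "\<dots> = energy s (w k) + energy s ?d - 2 * en s (w k) ?d" by (rule en_diff_self[OF fe])
      finally have e1: "energy s f = energy s (w k) + energy s ?d - 2 * en s (w k) ?d" .
      have "0 \<le> energy s (\<lambda>x. t * w k x + ?d x)" by (rule en_nonneg)
      also have "\<dots> = t * t * energy s (w k) + energy s ?d + 2 * t * en s (w k) ?d"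
        using en_add_self[OF fin_en_cmult[OF fe(1), of t] fe(2)]
        by (simp add: en_cmult_left en_cmult_right)
      finally have "0 \<le> (t * t * energy s (w k) + energy s ?d + 2 * t * en s (w k) ?d) / t" using t by simp
      also have "\<dots> = t * energy s (w k) + energy s ?d / t + 2 * en s (w k) ?d" using t by (simp add: add_divide_distrib)
      finally show ?thesis using e1 by (simp add: algebra_simps)
    qed
    have le2: "energy s f \<le> (1 + t) * \<mu>" if t: "t > 0" for t
    proof (rule LIMSEQ_le_const)
      have "(\<lambda>k. (1 + t) * (\<mu> + 1 / real (Suc k)) + (1 + 1 / t) * energy s (\<lambda>x. w k x - f x)) \<longlonglongrightarrow> (1 + t) * (\<mu> + 0) + (1 + 1 / t) * 0"
        using LIMSEQ_inverse_real_of_nat by (intro tendsto_intros f) (simp add: inverse_eq_divide)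
      then show "(\<lambda>k. (1 + t) * (\<mu> + 1 / real (Suc k)) + (1 + 1 / t) * energy s (\<lambda>x. w k x - f x)) \<longlonglongrightarrow> (1 + t) * \<mu>" by simp
      show "\<exists>N. \<forall>k\<ge>N. energy s f \<le> (1 + t) * (\<mu> + 1 / real (Suc k)) + (1 + 1 / t) * energy s (\<lambda>x. w k x - f x)"
      proof (intro exI[of _ 0] allI impI)
        fix k
        have "(1 + t) * energy s (w k) \<le> (1 + t) * (\<mu> + 1 / real (Suc k))" using wen[of k] t by (intro mult_left_mono) auto
        then show "energy s f \<le> (1 + t) * (\<mu> + 1 / real (Suc k)) + (1 + 1 / t) * energy s (\<lambda>x. w k x - f x)"
          using le[OF t, of k] by linarith
      qed
    qed
    show ?thesis
    proof (rule field_le_epsilon)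
      fix e :: real assume e: "e > 0"
      have "energy s f \<le> (1 + e / (\<mu> + 1)) * \<mu>" using e \<mu>0 by (intro le2) simp
      also have "\<dots> \<le> \<mu> + e" using e \<mu>0 by (simp add: field_simps)
      finally show "energy s f \<le> \<mu> + e" .
    qed
  qed
  have fen': "energy s f = \<mu>" using fen low[OF fV] f1 by simp
  have el: "en s f v = \<mu> * ip f v" if v: "v \<in> V" for v
  proof -
    \<comment> \<open>First variation: the quotient is minimal at \<open>f\<close>, so this
      quadratic in \<open>t\<close> never becomes negative and its linear coefficient must
      vanish.\<close>
    have "0 \<le> (energy s v - \<mu> * sqnorm v) * t\<^sup>2 + 2 * (en s f v - \<mu> * ip f v) * t" for t
    proof -
      have "\<mu> * sqnorm (\<lambda>x. f x + t * v x) \<le> energy s (\<lambda>x. f x + t * v x)"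
        by (rule low[OF V_add[OF fV V_cmult[OF v]]])
      moreover have "sqnorm (\<lambda>x. f x + t * v x) = 1 + t\<^sup>2 * sqnorm v + 2 * (t * ip f v)"
        using ip_add_self[OF f(1) H_cmult[OF VH[OF v], of t]] by (simp add: scale f1 ip_cmult_right)
      moreover have "energy s (\<lambda>x. f x + t * v x) = \<mu> + t\<^sup>2 * energy s v + 2 * (t * en s f v)"
        using en_add_self[OF H_fin_en[OF f(1)] fin_en_cmult[OF H_fin_en[OF VH[OF v]], of t]] by (simp add: fen' en_cmult_right en_cmult_left power2_eq_square)
      ultimately show ?thesis by (simp add: algebra_simps)
    qed
    from zero_of_nonneg_quadratic[OF this] show ?thesis by simp
  qed
  have "\<forall>g\<in>H. (\<forall>v\<in>G. ip g v = 0) \<longrightarrow> en s f g = \<mu> * ip f g \<and> \<mu> * sqnorm g \<le> energy s g"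
    using el low unfolding V_def by blast
  then show ?thesis using fV f1 fen' unfolding V_def by blast
qed

end

section \<open>Eigenvalues\<close>

text \<open>The kernel is positive off the diagonal and the diagonal is null, so
  \<open>a (fst p) * b (snd p)\<close> vanishes almost everywhere; its absolute integral
  factorises.\<close>

lemma null_product:
  fixes a b :: "'a::euclidean_space \<Rightarrow> real"
  assumes [measurable]: "a \<in> borel_measurable borel" "b \<in> borel_measurable borel"
    and ae: "AE p in lborel. a (fst p) * b (snd p) * kern s (fst p - snd p) = 0"
  shows "(AE x in lborel. a x = 0) \<or> (AE x in lborel. b x = 0)"
proof -
  have "AE p in lborel. fst p \<noteq> (snd p :: 'a)"
  proof -
    have in0: "(\<integral>\<^sup>+y. indicator {p :: 'a \<times> 'a. fst p = snd p} (x, y) \<partial>lborel) = 0" for x :: 'a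
    proof -
      have "(\<integral>\<^sup>+y. indicator {p :: 'a \<times> 'a. fst p = snd p} (x, y) \<partial>lborel) = (\<integral>\<^sup>+y. indicator {x} y \<partial>lborel)"
        by (rule nn_integral_cong) (auto simp: indicator_def)
      then show ?thesis by simp
    qed
    have "(\<integral>\<^sup>+p. indicator {p :: 'a \<times> 'a. fst p = snd p} p \<partial>lborel) = 0"
      by (subst nn_integral_lborel_pair) (measurable, simp only: in0 nn_integral_const mult_zero_left)
    then have "emeasure lborel {p :: 'a \<times> 'a. fst p = snd p} = 0" by (subst (asm) nn_integral_indicator) auto
    then show ?thesis by (intro AE_I[where N = "{p. fst p = snd p}"]) auto
  qed
  with ae have "AE p in lborel. ennreal \<bar>a (fst p)\<bar> * ennreal \<bar>b (snd p)\<bar> = 0"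
    by eventually_elim (auto simp: kern_def)
  then have "(\<integral>\<^sup>+p. ennreal \<bar>a (fst p)\<bar> * ennreal \<bar>b (snd p)\<bar> \<partial>lborel) = 0"
    by (subst nn_integral_0_iff_AE) auto
  also have "(\<integral>\<^sup>+p. ennreal \<bar>a (fst p)\<bar> * ennreal \<bar>b (snd p)\<bar> \<partial>lborel) = (\<integral>\<^sup>+x. ennreal \<bar>a x\<bar> \<partial>lborel) * (\<integral>\<^sup>+x. ennreal \<bar>b x\<bar> \<partial>lborel)"
    by (subst nn_integral_lborel_pair) (auto simp: nn_integral_cmult nn_integral_multc)
  finally have "(\<integral>\<^sup>+x. ennreal \<bar>a x\<bar> \<partial>lborel) = 0 \<or> (\<integral>\<^sup>+x. ennreal \<bar>b x\<bar> \<partial>lborel) = 0" by simp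
  then show ?thesis by (auto simp: nn_integral_0_iff_AE)
qed

section \<open>Sign structure of the form, weak solutions and the second eigenvalue\<close>

context frac_domain
begin

text \<open>For \<open>a\<close> and \<open>b\<close> with disjoint supports this is the negative of
  the integrand of \<open>en s a b\<close>: the products at a common point drop out and the mixed
  ones remain.\<close>

definition cross :: "('a \<Rightarrow> real) \<Rightarrow> ('a \<Rightarrow> real) \<Rightarrow> 'a \<times> 'a \<Rightarrow> real" where
  "cross a b p = (a (fst p) * b (snd p) + a (snd p) * b (fst p)) * kern s (fst p - snd p)"

lemma en_disjoint:
  assumes a: "a \<in> H" and b: "b \<in> H" and ab: "AE x in lborel. a x * b x = 0"
  shows "integrable lborel (cross a b)" "en s a b = - (LINT p|lborel. cross a b p)"
proof -
  have [measurable]: "a \<in> borel_measurable borel" "b \<in> borel_measurable borel" using a b by (auto intro: H_measurable)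
  have [measurable]: "cross a b \<in> borel_measurable borel" unfolding cross_def[abs_def] by measurable
  have ae: "AE p in lborel. frac_integrand s a b p = - cross a b p"
    using AE_lborel_fst[OF ab] AE_lborel_snd[OF ab]
  proof eventually_elim
    fix p :: "'a \<times> 'a" assume z: "a (fst p) * b (fst p) = 0" "a (snd p) * b (snd p) = 0"
    obtain x y where p: "p = (x, y)" by (cases p)
    have z': "a x * b x = 0" "a y * b y = 0" using z p by simp_all
    have "(a x - a y) * (b x - b y) = (a x * b x + a y * b y) - (a x * b y + a y * b x)" by (simp add: algebra_simps)
    then have "(a x - a y) * (b x - b y) = - (a x * b y + a y * b x)" unfolding z' by simp
    then show "frac_integrand s a b p = - cross a b p" unfolding p frac_integrand_kern cross_def by (simp only: fst_conv snd_conv mult_minus_left)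
  qed
  have i: "integrable lborel (frac_integrand s a b)" by (rule integrable_frac_integrand[OF H_fin_en[OF a] H_fin_en[OF b]])
  have "integrable lborel (\<lambda>p. - cross a b p)"
    using i ae by (subst integrable_cong_AE[of _ _ "frac_integrand s a b"]) (auto elim: eventually_mono)
  then show i2: "integrable lborel (cross a b)" by simp
  have "en s a b = (LINT p|lborel. - cross a b p)" unfolding en_def by (rule integral_cong_AE) (use ae in auto)
  then show "en s a b = - (LINT p|lborel. cross a b p)" by simp
qed

text \<open>Every pair of distinct points interacts, so two nonnegative nontrivial functions with
  disjoint supports have strictly negative mutual energy. This stands in for the strong maximum
  principle.\<close>

lemma en_disjoint_eq_0:
  assumes a: "a \<in> H" and b: "b \<in> H" and ab: "AE x in lborel. a x * b x = 0"
    and a0: "AE x in lborel. 0 \<le> a x" and b0: "AE x in lborel. 0 \<le> b x"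
  shows "en s a b \<le> 0" "en s a b = 0 \<Longrightarrow> (AE x in lborel. a x = 0) \<or> (AE x in lborel. b x = 0)"
proof -
  note i = en_disjoint[OF a b ab]
  have [measurable]: "a \<in> borel_measurable borel" "b \<in> borel_measurable borel" using a b by (auto intro: H_measurable)
  have nn: "AE p in lborel. 0 \<le> a (fst p) * b (snd p) * kern s (fst p - snd p) \<and> 0 \<le> a (snd p) * b (fst p) * kern s (fst p - snd p)"
    using AE_lborel_fst[OF a0] AE_lborel_snd[OF a0] AE_lborel_fst[OF b0] AE_lborel_snd[OF b0] by eventually_elim auto
  then have nn': "AE p in lborel. 0 \<le> cross a b p" by (rule eventually_mono) (auto simp: cross_def distrib_right)
  show "en s a b \<le> 0" using i(2) integral_nonneg_AE[OF nn'] by simp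
  assume "en s a b = 0"
  then have "AE p in lborel. cross a b p = 0"
    using i(2) integral_nonneg_eq_0_iff_AE[OF i(1) nn'] by simp
  with nn have "AE p in lborel. a (fst p) * b (snd p) * kern s (fst p - snd p) = 0"
    by eventually_elim (simp only: cross_def distrib_right, linarith)
  then show "(AE x in lborel. a x = 0) \<or> (AE x in lborel. b x = 0)" by (intro null_product) auto
qed

text \<open>Passing to the absolute value flips the sign of the mutual energy of the two parts, a
  change from \<open>-2\<close> to \<open>+2\<close> times a nonpositive number; hence equality of
  energies forces one sign.\<close>

lemma en_abs:
  assumes g: "g \<in> H"
  shows "energy s (\<lambda>x. \<bar>g x\<bar>) = energy s g + 4 * en s (\<lambda>x. max 0 (g x)) (\<lambda>x. max 0 (- g x))"
proof -
  let ?p = "\<lambda>x. max 0 (g x)" and ?q = "\<lambda>x. max 0 (- g x)"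
  have p: "fin_en s ?p" by (rule H_fin_en[OF H_pos_part[OF g]])
  have q: "fin_en s ?q" using H_fin_en[OF H_pos_part[OF H_cmult[OF g, of "-1"]]] by simp
  have "(\<lambda>x. \<bar>g x\<bar>) = (\<lambda>x. ?p x + ?q x)" "g = (\<lambda>x. ?p x - ?q x)" by (auto simp: max_def)
  then have "energy s (\<lambda>x. \<bar>g x\<bar>) = energy s ?p + energy s ?q + 2 * en s ?p ?q"
    "energy s g = energy s ?p + energy s ?q - 2 * en s ?p ?q"
    using en_add_self[OF p q] en_diff_self[OF p q] by (simp_all only:)
  then show ?thesis by simp
qed

lemma ip_abs: "sqnorm (\<lambda>x. \<bar>g x\<bar>) = sqnorm g"
  by (simp add: ip_def)

lemma ip_set_integral:
  assumes "u \<in> H" "v \<in> H"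
  shows "(LINT x:\<Omega>|lborel. u x * v x) = ip u v"
proof -
  have [measurable]: "u \<in> borel_measurable borel" "v \<in> borel_measurable borel" using assms by (auto intro: H_measurable)
  show ?thesis
    unfolding set_lebesgue_integral_def ip_def
  proof (rule integral_cong_AE)
    show "AE x in lborel. indicator \<Omega> x *\<^sub>R (u x * v x) = u x * v x"
      using H_vanishing[OF assms(1)] unfolding vanishing_def by (rule eventually_mono) (auto simp: indicator_def)
  qed measurable
qed

text \<open>Members of \<open>H\<close> vanish off \<open>\<Omega>\<close> almost everywhere, so the
  set integral can be traded for \<open>ip\<close>.\<close>

lemma weak_solution_iff:
  "weak_solution s \<Omega> \<nu> u \<longleftrightarrow> u \<in> H \<and> (\<forall>v\<in>H. cst * en s u v = \<nu> * ip u v)"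
  unfolding weak_solution_def by (auto simp: frac_form_cst ip_set_integral)

lemma nontrivial_ip: "u \<in> H \<Longrightarrow> nontrivial u \<longleftrightarrow> sqnorm u > 0"
  using ip_eq_0_iff[of u] ip_nonneg[of u] by (auto simp: nontrivial_def less_le)

lemma eigenvalue_nonneg:
  assumes "is_eigenvalue s \<Omega> \<nu>"
  shows "0 \<le> \<nu>"
proof -
  obtain u where u: "weak_solution s \<Omega> \<nu> u" "nontrivial u" using assms by (auto simp: is_eigenvalue_def)
  then have "u \<in> H" "cst * energy s u = \<nu> * sqnorm u" "sqnorm u > 0" by (auto simp: weak_solution_iff nontrivial_ip)
  moreover have "0 \<le> cst * energy s u" using cst_pos en_nonneg[of s u] by simp
  ultimately show ?thesis by (simp add: zero_le_mult_iff)
qed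

text \<open>The set under the infimum in \<open>eigenvalue 2\<close>. \<open>Inf\<close> on the
  reals is informative only for a nonempty set that is bounded below; the lower bound is next,
  nonemptiness comes from odd test functions.\<close>

definition spec2 :: "real set" where
  "spec2 = {\<mu>. \<exists>F. finite F \<and> (\<forall>\<nu>\<in>F. is_eigenvalue s \<Omega> \<nu> \<and> \<nu> \<le> \<mu>) \<and> enat 2 \<le> (\<Sum>\<nu>\<in>F. multiplicity_ev s \<Omega> \<nu>)}"

lemma eigenvalue_2: "eigenvalue 2 s \<Omega> = Inf spec2"
  unfolding eigenvalue_def spec2_def ..

lemma spec2_bdd_below: "bdd_below spec2"
proof (rule bdd_belowI)
  fix \<mu> assume "\<mu> \<in> spec2"
  then obtain F where F: "finite F" "\<forall>\<nu>\<in>F. is_eigenvalue s \<Omega> \<nu> \<and> \<nu> \<le> \<mu>" "enat 2 \<le> (\<Sum>\<nu>\<in>F. multiplicity_ev s \<Omega> \<nu>)"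
    unfolding spec2_def by blast
  have "F \<noteq> {}" using F(3) by (auto simp: enat_0_iff zero_enat_def)
  then obtain \<nu> where "\<nu> \<in> F" by blast
  then show "0 \<le> \<mu>" using F(2) eigenvalue_nonneg by (meson order_trans)
qed

lemma multiplicity_ge:
  assumes "\<And>i. i < m \<Longrightarrow> weak_solution s \<Omega> \<nu> (f i)" "lin_indep_ae m f"
  shows "enat m \<le> multiplicity_ev s \<Omega> \<nu>"
  unfolding multiplicity_ev_def by (rule SUP_upper) (use assms in auto)

lemma multiplicity_ge_1:
  assumes "weak_solution s \<Omega> \<nu> u" "nontrivial u"
  shows "1 \<le> multiplicity_ev s \<Omega> \<nu>"
proof -
  have "lin_indep_ae 1 (\<lambda>_. u)"
    using assms(2) by (auto simp: lin_indep_ae_def nontrivial_def)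
  from multiplicity_ge[OF _ this, of \<nu>] assms(1) show ?thesis by (simp add: one_enat_def)
qed

text \<open>The minimum over the orthogonal complement of \<open>u\<close> exceeds \<open>\<nu>\<close>, and bounds all other eigenvalues from below.\<close>

lemma one_signed_eigenfunction:
  assumes u: "weak_solution s \<Omega> \<nu> u" "nontrivial u" "AE x in lborel. 0 \<le> u x"
    and f0: "f0 \<in> H" "ip f0 u = 0" "sqnorm f0 > 0" and ne: "spec2 \<noteq> {}"
  shows "\<nu> < eigenvalue 2 s \<Omega>"
proof -
  have uH: "u \<in> H" and ueq: "\<And>v. v \<in> H \<Longrightarrow> cst * en s u v = \<nu> * ip u v" using u(1) by (auto simp: weak_solution_iff)
  define l where "l = \<nu> / cst"
  have uen: "en s u v = l * ip u v" if "v \<in> H" for v using ueq[OF that] cst_pos by (simp add: l_def field_simps)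
  define U where "U = sqnorm u"
  have Up: "U > 0" using u(2) uH by (simp add: U_def nontrivial_ip)
  obtain g m where g: "g \<in> H" "ip g u = 0" "sqnorm g = 1" "energy s g = m"
    and low: "\<And>k. k \<in> H \<Longrightarrow> ip k u = 0 \<Longrightarrow> m * sqnorm k \<le> energy s k"
    using constrained_minimiser[of "{u}" f0] uH f0 by auto
  let ?a = "\<lambda>x. \<bar>g x\<bar>"
  have aH: "?a \<in> H" by (rule H_abs[OF g(1)])
  \<comment> \<open>Both factors are nonnegative, so orthogonality makes them disjoint, and the
    equation for \<open>u\<close> makes their mutual energy 0. One of them would be null.\<close>
  have no_disjoint: False if 0: "ip ?a u = 0"
  proof -
    have "AE x in lborel. ?a x * u x = 0"
    proof -
      have "AE x in lborel. 0 \<le> ?a x * u x" using u(3) by (rule eventually_mono) simp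
      from integral_nonneg_eq_0_iff_AE[OF H_integrable_mult[OF aH uH] this] show ?thesis using 0 by (simp add: ip_def)
    qed
    moreover have "en s ?a u = 0" using uen[OF aH] 0 by (simp add: en_commute ip_commute)
    ultimately have "(AE x in lborel. ?a x = 0) \<or> (AE x in lborel. u x = 0)"
      using en_disjoint_eq_0(2)[OF aH uH] u(3) by auto
    then show False
    proof
      assume "AE x in lborel. ?a x = 0"
      then have "sqnorm ?a = 0" using ip_eq_0_iff[OF aH] by simp
      then show False using g(3) by (simp add: ip_abs)
    qed (use u(2) in \<open>simp add: nontrivial_def\<close>)
  qed
  \<comment> \<open>If \<open>m \<le> l\<close>, splitting the absolute value of \<open>g\<close>
    into its component along \<open>u\<close> and an orthogonal rest gives it energy at least
    \<open>m\<close>. Taking absolute values cannot raise the energy, so \<open>g\<close> has one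
    sign; its absolute value is then orthogonal to \<open>u\<close> as well, contradicting
    \<open>no_disjoint\<close>.\<close>
  have lm: "l < m"
  proof (rule ccontr)
    assume "\<not> l < m"
    then have ml: "m \<le> l" by simp
    define t where "t = ip ?a u / U"
    define k where "k x = ?a x - t * u x" for x
    have tuH: "(\<lambda>x. t * u x) \<in> H" by (rule H_cmult[OF uH])
    have kH: "k \<in> H" unfolding k_def by (rule H_diff[OF aH tuH])
    have "ip k u = ip ?a u - t * sqnorm u" unfolding k_def by (simp only: ip_diff_left[OF aH tuH uH] ip_cmult_left)
    then have ku: "ip k u = 0" using Up by (simp add: t_def U_def)
    have aeq: "?a = (\<lambda>x. t * u x + k x)" by (simp add: k_def)
    have "sqnorm ?a = t\<^sup>2 * U + sqnorm k"
      unfolding aeq using ip_add_self[OF tuH kH] ku by (simp add: ip_cmult_left ip_cmult_right ip_commute[of u k] U_def power2_eq_square)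
    then have i1: "t\<^sup>2 * U + sqnorm k = 1" using g(3) by (simp add: ip_abs)
    have "energy s ?a = t\<^sup>2 * (l * U) + energy s k"
      unfolding aeq using en_add_self[OF H_fin_en[OF tuH] H_fin_en[OF kH]] uen[OF kH] uen[OF uH] ku
      by (simp add: en_cmult_left en_cmult_right ip_commute[of u k] U_def power2_eq_square)
    also have "\<dots> \<ge> t\<^sup>2 * (l * U) + m * sqnorm k" using low[OF kH ku] by simp
    also have "t\<^sup>2 * (l * U) + m * sqnorm k = m + t\<^sup>2 * U * (l - m)"
    proof -
      have "sqnorm k = 1 - t\<^sup>2 * U" using i1 by simp
      then show ?thesis by (simp only:) (simp add: algebra_simps)
    qed
    finally have e1: "m + t\<^sup>2 * U * (l - m) \<le> energy s ?a" .
    let ?p = "\<lambda>x. max 0 (g x)" and ?q = "\<lambda>x. max 0 (- g x)"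
    have p: "?p \<in> H" by (rule H_pos_part[OF g(1)])
    have q: "?q \<in> H" using H_pos_part[OF H_cmult[OF g(1), of "-1"]] by simp
    have pq: "AE x in lborel. ?p x * ?q x = 0" by (auto simp: max_def)
    have e2: "energy s ?a = m + 4 * en s ?p ?q" using en_abs[OF g(1)] g(4) by simp
    have pq0: "en s ?p ?q \<le> 0" by (rule en_disjoint_eq_0(1)[OF p q pq]) auto
    have "0 \<le> t\<^sup>2 * U * (l - m)" using ml Up by simp
    then have z: "en s ?p ?q = 0" using e1 e2 pq0 by linarith
    then have "(AE x in lborel. ?p x = 0) \<or> (AE x in lborel. ?q x = 0)" by (intro en_disjoint_eq_0(2)[OF p q pq]) auto
    then show False
    proof
      assume "AE x in lborel. ?p x = 0"
      then have "AE x in lborel. ?a x * u x = - 1 * (g x * u x)" by (rule eventually_mono) (auto simp: max_def split: if_splits)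
      then have "ip ?a u = (LINT x|lborel. -1 * (g x * u x))"
        unfolding ip_def using H_measurable[OF g(1)] H_measurable[OF uH] by (intro integral_cong_AE) auto
      then show False using g(2) no_disjoint by (simp add: ip_def)
    next
      assume "AE x in lborel. ?q x = 0"
      then have "AE x in lborel. ?a x * u x = g x * u x" by (rule eventually_mono) (auto simp: max_def split: if_splits)
      then have "ip ?a u = ip g u"
        unfolding ip_def using H_measurable[OF g(1)] H_measurable[OF uH] by (intro integral_cong_AE) auto
      then show False using g(2) no_disjoint by simp
    qed
  qed
  have orth: "\<nu>' \<ge> cst * m" if w: "weak_solution s \<Omega> \<nu>' w" "nontrivial w" "ip w u = 0" for \<nu>' w
  proof -
    have wH: "w \<in> H" and weq: "cst * energy s w = \<nu>' * sqnorm w" using w(1) by (auto simp: weak_solution_iff)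
    have wp: "sqnorm w > 0" using w(2) wH by (simp add: nontrivial_ip)
    have "cst * (m * sqnorm w) \<le> cst * energy s w" using low[OF wH w(3)] cst_pos by (intro mult_left_mono) auto
    then have "cst * m * sqnorm w \<le> \<nu>' * sqnorm w" using weq by (simp add: mult.assoc)
    then show ?thesis using wp by simp
  qed
  have lnu: "\<nu> < cst * m" using lm cst_pos by (simp add: l_def field_simps)
  \<comment> \<open>Symmetry of both forms makes eigenfunctions of different eigenvalues
    orthogonal.\<close>
  have other: "\<nu>' \<ge> cst * m" if w: "is_eigenvalue s \<Omega> \<nu>'" "\<nu>' \<noteq> \<nu>" for \<nu>'
  proof -
    obtain w where w': "weak_solution s \<Omega> \<nu>' w" "nontrivial w" using w(1) by (auto simp: is_eigenvalue_def)
    then have wH: "w \<in> H" and "cst * en s w u = \<nu>' * ip w u" using uH by (auto simp: weak_solution_iff)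
    moreover have "cst * en s u w = \<nu> * ip u w" by (rule ueq[OF wH])
    ultimately have "(\<nu>' - \<nu>) * ip w u = 0" by (auto simp: en_commute[of s w u] ip_commute[of w u] algebra_simps)
    then have "ip w u = 0" using w(2) by simp
    then show ?thesis by (rule orth[OF w'])
  qed
  \<comment> \<open>Two independent eigenfunctions would have a nontrivial combination orthogonal to
    \<open>u\<close>, whose eigenvalue \<open>orth\<close> pushes above
    \<open>\<nu>\<close>.\<close>
  have mult1: "multiplicity_ev s \<Omega> \<nu> \<le> 1"
    unfolding multiplicity_ev_def
  proof (rule SUP_least)
    fix n assume "n \<in> {m. \<exists>f. (\<forall>i<m. weak_solution s \<Omega> \<nu> (f i)) \<and> lin_indep_ae m f}"
    then obtain f where f: "\<And>i. i < n \<Longrightarrow> weak_solution s \<Omega> \<nu> (f i)" "lin_indep_ae n f" by blast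
    have "\<not> 2 \<le> n"
    proof
      assume n: "2 \<le> n"
      have fH: "f i \<in> H" and feq: "\<And>v. v \<in> H \<Longrightarrow> cst * en s (f i) v = \<nu> * ip (f i) v" if "i < n" for i
        using f(1)[OF that] by (auto simp: weak_solution_iff)
      have key: "c 0 = 0 \<and> c 1 = 0" if c: "ip (\<lambda>x. c 0 * f 0 x + c 1 * f 1 x) u = 0" for c :: "nat \<Rightarrow> real"
      proof -
        let ?w = "\<lambda>x. c 0 * f 0 x + c 1 * f 1 x"
        have fH01: "f 0 \<in> H" "f 1 \<in> H" using fH n by auto
        have cH: "(\<lambda>x. c 0 * f 0 x) \<in> H" "(\<lambda>x. c 1 * f 1 x) \<in> H" using fH01 by (auto intro: H_cmult)
        have wH: "?w \<in> H" by (rule H_add[OF cH])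
        have "weak_solution s \<Omega> \<nu> ?w"
          unfolding weak_solution_iff
        proof (intro conjI wH ballI)
          fix v assume v: "v \<in> H"
          have "cst * en s ?w v = c 0 * (cst * en s (f 0) v) + c 1 * (cst * en s (f 1) v)"
            using en_add_left[OF H_fin_en[OF cH(1)] H_fin_en[OF cH(2)] H_fin_en[OF v]] by (simp add: en_cmult_left algebra_simps)
          also have "\<dots> = \<nu> * (c 0 * ip (f 0) v + c 1 * ip (f 1) v)" using feq[of 0 v] feq[of 1 v] v n
            by (simp add: algebra_simps)
          also have "\<dots> = \<nu> * ip ?w v" by (simp only: ip_add_left[OF cH v] ip_cmult_left)
          finally show "cst * en s ?w v = \<nu> * ip ?w v" .
        qed
        then have "\<not> nontrivial ?w" using orth[of \<nu> ?w] c lnu by force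
        then have ae: "AE x in lborel. ?w x = 0" by (simp add: nontrivial_def)
        \<comment> \<open>Independence concerns all \<open>n\<close> functions, so the two
          coefficients are extended by 0.\<close>
        define d where "d i = (if i < 2 then c i else 0)" for i
        have "(\<Sum>i<n. d i * f i x) = ?w x" for x
        proof -
          have "(\<Sum>i<n. d i * f i x) = (\<Sum>i<2. d i * f i x)"
            using n by (intro sum.mono_neutral_right) (auto simp: d_def)
          also have "\<dots> = ?w x" by (simp add: d_def numeral_2_eq_2)
          finally show ?thesis .
        qed
        then have "\<forall>i<n. d i = 0" using f(2) ae unfolding lin_indep_ae_def by simp
        then have "d 0 = 0" "d 1 = 0" using n by auto
        then show ?thesis by (simp add: d_def)
      qed
      have fH01: "f 0 \<in> H" "f 1 \<in> H" using fH n by auto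
      \<comment> \<open>The combination \<open>ip (f 1) u * f 0 - ip (f 0) u * f 1\<close> is always
        orthogonal to \<open>u\<close>, so its coefficients vanish. Then \<open>f 0\<close> alone is
        orthogonal to \<open>u\<close>, and its coefficient 1 would have to be 0.\<close>
      have "ip (f 0) u = 0"
        using key[of "\<lambda>i. if i = 0 then ip (f 1) u else - ip (f 0) u"] fH01
        by (simp add: ip_diff_left ip_cmult_left H_cmult uH)
      then have "(1::real) = 0" using key[of "\<lambda>i. if i = 0 then 1 else 0"] by simp
      then show False by simp
    qed
    then show "enat n \<le> 1" by (simp add: one_enat_def)
  qed
  have "cst * m \<le> \<mu>" if \<mu>: "\<mu> \<in> spec2" for \<mu>
  proof -
    obtain F where F: "finite F" "\<forall>\<nu>\<in>F. is_eigenvalue s \<Omega> \<nu> \<and> \<nu> \<le> \<mu>" "enat 2 \<le> (\<Sum>\<nu>\<in>F. multiplicity_ev s \<Omega> \<nu>)"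
      using \<mu> unfolding spec2_def by blast
    have "\<not> F \<subseteq> {\<nu>}"
    proof
      assume "F \<subseteq> {\<nu>}"
      then have "(\<Sum>\<nu>\<in>F. multiplicity_ev s \<Omega> \<nu>) \<le> (\<Sum>\<nu>\<in>{\<nu>}. multiplicity_ev s \<Omega> \<nu>)" by (intro sum_mono2) auto
      also have "\<dots> \<le> 1" using mult1 by simp
      finally have "enat 2 \<le> 1" using F(3) by (rule order_trans[rotated])
      then show False by (simp add: one_enat_def)
    qed
    then obtain \<nu>' where "\<nu>' \<in> F" "\<nu>' \<noteq> \<nu>" by blast
    then show ?thesis using other F(2) by (meson order_trans)
  qed
  then have "cst * m \<le> Inf spec2" by (intro cInf_greatest ne)
  then show ?thesis using lnu unfolding eigenvalue_2 by linarith
qed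

end

section \<open>Odd and even functions on a domain symmetric about the origin\<close>

locale frac_symmetric_domain = frac_domain +
  assumes sym: "x \<in> \<Omega> \<Longrightarrow> - x \<in> \<Omega>"
begin

definition odd_fn :: "('a \<Rightarrow> real) \<Rightarrow> bool" where "odd_fn f \<longleftrightarrow> (AE x in lborel. f (- x) = - f x)"
definition even_fn :: "('a \<Rightarrow> real) \<Rightarrow> bool" where "even_fn f \<longleftrightarrow> (AE x in lborel. f (- x) = f x)"

lemma reflect_H: "f \<in> H \<Longrightarrow> (\<lambda>x. f (- x)) \<in> H"
  by (rule H_reflect) (use sym in auto)

lemma ip_reflect:
  assumes "f \<in> H" "g \<in> H"
  shows "ip (\<lambda>x. f (- x)) (\<lambda>x. g (- x)) = ip f g"
  unfolding ip_def using integral_lborel_reflect[of "\<lambda>x. f x * g x"] H_measurable[OF assms(1)] H_measurable[OF assms(2)] by simp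

lemma odd_even_orthogonal:
  assumes f: "f \<in> H" "odd_fn f" and g: "g \<in> H" "even_fn g"
  shows "ip f g = 0" "en s f g = 0"
proof -
  note [measurable] = H_measurable[OF f(1)] H_measurable[OF g(1)] H_measurable[OF reflect_H[OF f(1)]] H_measurable[OF reflect_H[OF g(1)]]
  have "ip (\<lambda>x. f (- x)) (\<lambda>x. g (- x)) = (LINT x|lborel. - (f x * g x))"
    unfolding ip_def
  proof (rule integral_cong_AE)
    show "AE x in lborel. f (- x) * g (- x) = - (f x * g x)"
      using f(2) g(2) unfolding odd_fn_def even_fn_def by eventually_elim simp
  qed measurable
  then show "ip f g = 0" using ip_reflect[OF f(1) g(1)] by (simp add: ip_def)
  have "en s f g = en s (\<lambda>x. f (- x)) (\<lambda>x. g (- x))" by (rule en_reflect[symmetric]) measurable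
  also have "\<dots> = en s (\<lambda>x. -1 * f x) g"
    by (rule en_cong_AE) (use f(2) g(2) in \<open>auto simp: odd_fn_def even_fn_def\<close>)
  also have "\<dots> = -1 * en s f g" by (rule en_cmult_left)
  finally show "en s f g = 0" by simp
qed

lemma H_decompose:
  assumes f: "f \<in> H"
  shows "\<exists>g h. g \<in> H \<and> h \<in> H \<and> odd_fn g \<and> even_fn h \<and> f = (\<lambda>x. g x + h x)"
proof -
  let ?g = "\<lambda>x. 1/2 * (f x - f (- x))" and ?h = "\<lambda>x. 1/2 * (f x + f (- x))"
  have "?g \<in> H" "?h \<in> H" by (intro H_cmult H_diff H_add f reflect_H[OF f])+
  moreover have "odd_fn ?g" "even_fn ?h" by (auto simp: odd_fn_def even_fn_def field_simps)
  moreover have "f = (\<lambda>x. ?g x + ?h x)" by (auto simp: field_simps)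
  ultimately show ?thesis by blast
qed

lemma H_self_orth_zero:
  assumes "h \<in> H" "sqnorm h = 0"
  shows "AE x in lborel. h x = 0" "AE x in lborel. h (- x) = 0"
  using AE_lborel_reflect[of "\<lambda>x. h x = 0"] assms by (simp_all add: ip_eq_0_iff)

text \<open>Being odd is expressed as orthogonality to all even functions of \<open>H\<close>: the
  even part of the minimiser is orthogonal to itself, hence null. The equation extends from odd to
  all test functions because the even part of a test function contributes 0 to both sides.\<close>

lemma odd_minimiser:
  assumes f0: "f0 \<in> H" "odd_fn f0" "sqnorm f0 > 0"
  shows "\<exists>f \<mu>. f \<in> H \<and> odd_fn f \<and> sqnorm f = 1 \<and> energy s f = \<mu> \<and> weak_solution s \<Omega> (cst * \<mu>) f \<and> \<mu> * sqnorm f0 \<le> energy s f0"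
proof -
  define G where "G = {h \<in> H. even_fn h}"
  have GH: "G \<subseteq> H" by (auto simp: G_def)
  have orth: "ip f0 v = 0" if "v \<in> G" for v
    using odd_even_orthogonal(1)[OF f0(1,2), of v] that by (simp add: G_def)
  obtain f \<mu> where f: "f \<in> H" "\<forall>v\<in>G. ip f v = 0" "sqnorm f = 1" "energy s f = \<mu>"
    and m: "\<And>g. g \<in> H \<Longrightarrow> (\<forall>v\<in>G. ip g v = 0) \<Longrightarrow> en s f g = \<mu> * ip f g \<and> \<mu> * sqnorm g \<le> energy s g"
    using constrained_minimiser[OF GH f0(1) _ f0(3)] orth by blast
  obtain g h where gh: "g \<in> H" "h \<in> H" "odd_fn g" "even_fn h" and fgh: "f = (\<lambda>x. g x + h x)"
    using H_decompose[OF f(1)] by blast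
  have "ip f h = 0" using f(2) gh by (auto simp: G_def)
  then have "sqnorm h = 0" using odd_even_orthogonal(1)[OF gh(1,3,2,4)] by (simp add: fgh ip_add_left gh)
  from H_self_orth_zero[OF gh(2) this] have odd: "odd_fn f"
    using gh(3) unfolding odd_fn_def fgh by eventually_elim simp
  have "weak_solution s \<Omega> (cst * \<mu>) f"
    unfolding weak_solution_iff
  proof (intro conjI f ballI)
    fix v assume v: "v \<in> H"
    obtain a b where ab: "a \<in> H" "b \<in> H" "odd_fn a" "even_fn b" and vab: "v = (\<lambda>x. a x + b x)"
      using H_decompose[OF v] by blast
    have "en s f v = en s f a + en s f b" "ip f v = ip f a + ip f b"
      unfolding vab by (auto intro!: en_add_right ip_add_right H_fin_en f ab)
    moreover have "en s f a = \<mu> * ip f a" using m[OF ab(1)] odd_even_orthogonal(1)[OF ab(1,3)] by (auto simp: G_def)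
    ultimately show "cst * en s f v = cst * \<mu> * ip f v"
      using odd_even_orthogonal[OF f(1) odd ab(2,4)] by simp
  qed
  moreover have "\<mu> * sqnorm f0 \<le> energy s f0" using m[OF f0(1)] odd_even_orthogonal(1)[OF f0(1,2)] by (auto simp: G_def)
  ultimately show ?thesis using f odd by blast
qed

lemma even_minimiser:
  assumes f0: "f0 \<in> H" "even_fn f0" "sqnorm f0 > 0"
  shows "\<exists>f \<mu>. f \<in> H \<and> even_fn f \<and> sqnorm f = 1 \<and> energy s f = \<mu> \<and> weak_solution s \<Omega> (cst * \<mu>) f \<and> \<mu> * sqnorm f0 \<le> energy s f0"
proof -
  define G where "G = {h \<in> H. odd_fn h}"
  have GH: "G \<subseteq> H" by (auto simp: G_def)
  have orth: "ip g v = 0" if "g \<in> H" "even_fn g" "v \<in> G" for g v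
    using odd_even_orthogonal(1)[of v g] that by (simp add: G_def ip_commute)
  obtain f \<mu> where f: "f \<in> H" "\<forall>v\<in>G. ip f v = 0" "sqnorm f = 1" "energy s f = \<mu>"
    and m: "\<And>g. g \<in> H \<Longrightarrow> (\<forall>v\<in>G. ip g v = 0) \<Longrightarrow> en s f g = \<mu> * ip f g \<and> \<mu> * sqnorm g \<le> energy s g"
    using constrained_minimiser[OF GH f0(1) _ f0(3)] orth[OF f0(1,2)] by blast
  obtain g h where gh: "g \<in> H" "h \<in> H" "odd_fn g" "even_fn h" and fgh: "f = (\<lambda>x. g x + h x)"
    using H_decompose[OF f(1)] by blast
  have "ip f g = 0" using f(2) gh by (auto simp: G_def)
  then have "sqnorm g = 0" using odd_even_orthogonal(1)[OF gh(1,3,2,4)] by (simp add: fgh ip_add_left gh ip_commute[of h g])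
  from H_self_orth_zero[OF gh(1) this] have even: "even_fn f"
    using gh(4) unfolding even_fn_def fgh by eventually_elim simp
  have "weak_solution s \<Omega> (cst * \<mu>) f"
    unfolding weak_solution_iff
  proof (intro conjI f ballI)
    fix v assume v: "v \<in> H"
    obtain a b where ab: "a \<in> H" "b \<in> H" "odd_fn a" "even_fn b" and vab: "v = (\<lambda>x. a x + b x)"
      using H_decompose[OF v] by blast
    have "en s f v = en s f a + en s f b" "ip f v = ip f a + ip f b"
      unfolding vab by (auto intro!: en_add_right ip_add_right H_fin_en f ab)
    moreover have "en s f b = \<mu> * ip f b" using m[OF ab(2)] orth[OF ab(2,4)] by auto
    ultimately show "cst * en s f v = cst * \<mu> * ip f v"
      using odd_even_orthogonal[OF ab(1,3) f(1) even] by (simp add: en_commute[of s f a] ip_commute[of f a])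
  qed
  moreover have "\<mu> * sqnorm f0 \<le> energy s f0" using m[OF f0(1)] orth[OF f0(1,2)] by auto
  ultimately show ?thesis using f even by blast
qed

text \<open>\<open>spec2\<close> counts multiplicities over a finite set of eigenvalues, so
  coinciding odd and even minima need separate treatment: then a single eigenvalue has multiplicity
  at least two, since odd and even functions are orthogonal.\<close>

lemma odd_Rayleigh_spec2:
  assumes f0: "f0 \<in> H" "odd_fn f0" "sqnorm f0 > 0"
  shows "\<exists>\<mu>\<in>spec2. \<mu> * sqnorm f0 \<le> cst * energy s f0"
proof -
  obtain f \<mu> where f: "f \<in> H" "odd_fn f" "sqnorm f = 1" "energy s f = \<mu>" "weak_solution s \<Omega> (cst * \<mu>) f" "\<mu> * sqnorm f0 \<le> energy s f0"
    using odd_minimiser[OF f0] by blast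
  have "even_fn (\<lambda>x. \<bar>f x\<bar>)" using f(2) unfolding odd_fn_def even_fn_def by (rule eventually_mono) simp
  then obtain g \<mu>' where g: "g \<in> H" "even_fn g" "sqnorm g = 1" "energy s g = \<mu>'" "weak_solution s \<Omega> (cst * \<mu>') g"
     "\<mu>' * sqnorm (\<lambda>x. \<bar>f x\<bar>) \<le> energy s (\<lambda>x. \<bar>f x\<bar>)"
    using even_minimiser[OF H_abs[OF f(1)]] f(3) by (auto simp: ip_abs)
  have nt: "nontrivial f" "nontrivial g" using f g by (simp_all add: nontrivial_ip)
  have "energy s (\<lambda>x. \<bar>f x\<bar>) \<le> energy s f"
  proof (rule fin_en_contraction(2)[OF H_fin_en[OF f(1)]])
    show "(\<lambda>x. \<bar>f x\<bar>) \<in> borel_measurable borel" by (rule H_measurable[OF H_abs[OF f(1)]])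
  qed (rule abs_triangle_ineq3)
  then have mm: "\<mu>' \<le> \<mu>" using g(6) f(3,4) by (simp add: ip_abs)
  have ev: "is_eigenvalue s \<Omega> (cst * \<mu>)" "is_eigenvalue s \<Omega> (cst * \<mu>')" using nt f g by (auto simp: is_eigenvalue_def)
  have "cst * \<mu> \<in> spec2"
  proof (cases "\<mu>' = \<mu>")
    case False
    then have ne: "cst * \<mu> \<noteq> cst * \<mu>'" using cst_pos by simp
    have "enat 2 = 1 + 1" by (simp add: one_enat_def numeral_eq_enat)
    also have "\<dots> \<le> multiplicity_ev s \<Omega> (cst * \<mu>) + multiplicity_ev s \<Omega> (cst * \<mu>')"
      using multiplicity_ge_1 nt f(5) g(5) by (intro add_mono) auto
    also have "\<dots> = (\<Sum>\<nu>\<in>{cst * \<mu>, cst * \<mu>'}. multiplicity_ev s \<Omega> \<nu>)" using ne by simp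
    finally show ?thesis unfolding spec2_def using ev mm cst_pos
      by (intro CollectI exI[of _ "{cst * \<mu>, cst * \<mu>'}"]) auto
  next
    case True
    define F where "F i = (if i = (0::nat) then f else g)" for i
    have "lin_indep_ae 2 F"
      unfolding lin_indep_ae_def
    proof (intro allI impI)
      fix c :: "nat \<Rightarrow> real" and i :: nat assume ae: "AE x in lborel. (\<Sum>i<2. c i * F i x) = 0" and i: "i < 2"
      let ?w = "\<lambda>x. c 0 * f x + c 1 * g x"
      have ae': "AE x in lborel. ?w x = 0" using ae by (rule eventually_mono) (simp add: F_def numeral_2_eq_2)
      have cH: "(\<lambda>x. c 0 * f x) \<in> H" "(\<lambda>x. c 1 * g x) \<in> H" using f g by (auto intro: H_cmult)
      have z: "ip ?w v = 0" if "v \<in> H" for v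
      proof -
        have "ip ?w v = (LINT x|(lborel :: 'a measure). 0)"
          unfolding ip_def using H_measurable[OF H_add[OF cH]] H_measurable[OF that] ae'
          by (intro integral_cong_AE) (auto elim: eventually_mono)
        then show ?thesis by simp
      qed
      have "ip ?w f = c 0 * sqnorm f + c 1 * ip g f" by (simp only: ip_add_left[OF cH f(1)] ip_cmult_left)
      then have "ip ?w f = c 0" using odd_even_orthogonal(1)[OF f(1,2) g(1,2)] f(3) by (simp add: ip_commute[of g f])
      moreover have "ip ?w g = c 0 * ip f g + c 1 * sqnorm g" by (simp only: ip_add_left[OF cH g(1)] ip_cmult_left)
      then have "ip ?w g = c 1" using odd_even_orthogonal(1)[OF f(1,2) g(1,2)] g(3) by simp
      ultimately have "c 0 = 0" "c 1 = 0" using z[OF f(1)] z[OF g(1)] by auto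
      then show "c i = 0" using i by (cases i) (auto simp: less_Suc_eq numeral_2_eq_2)
    qed
    then have "enat 2 \<le> multiplicity_ev s \<Omega> (cst * \<mu>)"
      using f(5) g(5) True by (intro multiplicity_ge[where f = F]) (auto simp: F_def)
    then show ?thesis unfolding spec2_def using ev by (intro CollectI exI[of _ "{cst * \<mu>}"]) auto
  qed
  moreover have "cst * \<mu> * sqnorm f0 \<le> cst * energy s f0" using f(6) cst_pos by (simp add: mult.assoc)
  ultimately show ?thesis by blast
qed

lemma eigenvalue_2_le_odd:
  assumes "f0 \<in> H" "odd_fn f0" "sqnorm f0 > 0"
  shows "eigenvalue 2 s \<Omega> * sqnorm f0 \<le> cst * energy s f0"
proof -
  obtain \<mu> where \<mu>: "\<mu> \<in> spec2" "\<mu> * sqnorm f0 \<le> cst * energy s f0" using odd_Rayleigh_spec2[OF assms] by blast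
  have "eigenvalue 2 s \<Omega> \<le> \<mu>" unfolding eigenvalue_2 by (rule cInf_lower[OF \<mu>(1) spec2_bdd_below])
  then have "eigenvalue 2 s \<Omega> * sqnorm f0 \<le> \<mu> * sqnorm f0" using assms(3) by (intro mult_right_mono) auto
  then show ?thesis using \<mu>(2) by simp
qed

end

section \<open>Radial functions on large annuli\<close>

context frac_domain
begin

text \<open>On a set of finite measure \<open>a \<le> 1 + a * a\<close> suffices. It lets total
  masses be handled as real numbers and cancelled.\<close>

lemma H_nn_integral_finite:
  assumes a: "a \<in> H"
  shows "(\<integral>\<^sup>+x. ennreal (a x) \<partial>lborel) < \<infinity>"
proof -
  have [measurable]: "a \<in> borel_measurable borel" by (rule H_measurable[OF a])
  have "AE x in lborel. ennreal (a x) \<le> indicator \<Omega> x + ennreal (a x * a x)"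
    using H_vanishing[OF a] unfolding vanishing_def
  proof eventually_elim
    fix x assume "x \<notin> \<Omega> \<longrightarrow> a x = 0"
    moreover have "2 * a x \<le> 1 + a x * a x"
      using sum_squares_bound[of 1 "a x"] by (simp add: power2_eq_square)
    then have "a x \<le> 1 + a x * a x" using zero_le_square[of "a x"] by linarith
    then have "ennreal (a x) \<le> 1 + ennreal (a x * a x)"
      by (metis ennreal_1 ennreal_leI ennreal_plus zero_le_one zero_le_square)
    ultimately show "ennreal (a x) \<le> indicator \<Omega> x + ennreal (a x * a x)" by (auto simp: indicator_def)
  qed
  then have "(\<integral>\<^sup>+x. ennreal (a x) \<partial>lborel) \<le> (\<integral>\<^sup>+x. indicator \<Omega> x + ennreal (a x * a x) \<partial>lborel)"
    by (rule nn_integral_mono_AE)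
  also have "\<dots> = emeasure lborel \<Omega> + ennreal (sqnorm a)"
    using nn_integral_eq_integral[OF H_integrable_square[OF a]] by (simp add: nn_integral_add ip_def)
  also have "\<dots> < \<infinity>" using emeasure_dom_finite by simp
  finally show ?thesis .
qed

text \<open>A local form of the Nash inequality.\<close>

lemma local_self_interaction:
  assumes a: "a \<in> H" "\<And>x. 0 \<le> a x" and en: "energy s a \<le> \<Lambda> * sqnorm a"
    and r: "0 < r" and rs: "r powr (2 * s) * \<Lambda> \<le> unit_ball_vol (real DIM('a))"
  shows "ennreal (unit_ball_vol (real DIM('a)) * r ^ DIM('a) * sqnorm a) \<le>
    2 * (\<integral>\<^sup>+x. ennreal (a x) * (\<integral>\<^sup>+y. ennreal (a y) * indicator (ball x r) y \<partial>lborel) \<partial>lborel)"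
proof -
  have [measurable]: "a \<in> borel_measurable borel" by (rule H_measurable[OF a(1)])
  let ?N = "DIM('a)" let ?a = "real ?N + 2 * s"
  define W where "W = unit_ball_vol (real ?N) * r ^ ?N"
  have W0: "W \<ge> 0" using r by (simp add: W_def)
  define g :: "'a \<Rightarrow> ennreal" where "g = indicator (ball 0 r)"
  have [measurable]: "ball x r \<in> sets borel" for x :: 'a by simp
  have [measurable]: "g \<in> borel_measurable borel" unfolding g_def by measurable
  have even: "g (- z) = g z" for z by (simp add: g_def indicator_def)
  have gint: "(\<integral>\<^sup>+z. g z \<partial>lborel) = ennreal W" using r by (simp add: g_def emeasure_ball W_def)
  define X where "X = (\<integral>\<^sup>+p. ennreal (a (fst p)) * ennreal (a (snd p)) * g (fst p - snd p) \<partial>lborel)"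
  have a2: "(\<integral>\<^sup>+x. ennreal (a x * a x) \<partial>lborel) = ennreal (sqnorm a)"
    using nn_integral_eq_integral[OF H_integrable_square[OF a(1)]] by (simp add: ip_def)
  have c1: "(\<integral>\<^sup>+p. ennreal (a (fst p) * a (fst p)) * g (fst p - snd p) \<partial>lborel) = ennreal (sqnorm a) * ennreal W"
    using nn_integral_convolution_fst[of g "\<lambda>x. ennreal (a x * a x)"] even a2 gint by simp
  have c2: "(\<integral>\<^sup>+p. ennreal (a (snd p) * a (snd p)) * g (fst p - snd p) \<partial>lborel) = ennreal (sqnorm a) * ennreal W"
    using nn_integral_convolution_snd[of g "\<lambda>x. ennreal (a x * a x)"] even a2 gint by simp
  have "ennreal (sqnorm a) * ennreal W + ennreal (sqnorm a) * ennreal W =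
    (\<integral>\<^sup>+p. ennreal (a (fst p) * a (fst p)) * g (fst p - snd p) + ennreal (a (snd p) * a (snd p)) * g (fst p - snd p) \<partial>lborel)"
    by (subst nn_integral_add) (simp_all add: c1 c2)
  also have "\<dots> \<le> (\<integral>\<^sup>+p. ennreal (r powr ?a) * ennreal (density s a p) + 2 * (ennreal (a (fst p)) * ennreal (a (snd p)) * g (fst p - snd p)) \<partial>lborel)"
  proof (rule nn_integral_mono)
    fix p :: "'a \<times> 'a"
    obtain x y where p: "p = (x, y)" by (cases p)
    show "ennreal (a (fst p) * a (fst p)) * g (fst p - snd p) + ennreal (a (snd p) * a (snd p)) * g (fst p - snd p)
      \<le> ennreal (r powr ?a) * ennreal (density s a p) + 2 * (ennreal (a (fst p)) * ennreal (a (snd p)) * g (fst p - snd p))"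
    proof (cases "norm (x - y) < r")
      case False
      then show ?thesis by (simp add: p g_def)
    next
      case True
      have "(a x - a y) * (a x - a y) \<le> r powr ?a * density s a p"
      proof (cases "x = y")
        case False
        then have n0: "norm (x - y) powr ?a > 0" by simp
        have "norm (x - y) powr ?a \<le> r powr ?a" using True s_pos by (intro powr_mono2) auto
        then have "1 \<le> r powr ?a / norm (x - y) powr ?a" using n0 by (simp only: le_divide_eq_1_pos)
        then have "1 \<le> r powr ?a * kern s (x - y)" unfolding kern_def powr_minus divide_inverse .
        then have "1 * ((a x - a y) * (a x - a y)) \<le> r powr ?a * kern s (x - y) * ((a x - a y) * (a x - a y))"
          by (rule mult_right_mono) simp
        then show ?thesis by (simp add: p frac_integrand_kern mult_ac)
      qed (simp add: p frac_integrand_kern)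
      then have "a x * a x + a y * a y \<le> r powr ?a * density s a p + 2 * (a x * a y)" by (simp add: algebra_simps)
      then have "ennreal (a x * a x + a y * a y) \<le> ennreal (r powr ?a * density s a p + 2 * (a x * a y))" by (rule ennreal_leI)
      also have "\<dots> = ennreal (r powr ?a) * ennreal (density s a p) + 2 * (ennreal (a x) * ennreal (a y))"
        using a(2) by (simp add: ennreal_plus frac_integrand_nonneg ennreal_mult)
      finally show ?thesis using True a(2) by (simp add: p g_def ennreal_plus)
    qed
  qed
  also have "\<dots> = ennreal (r powr ?a) * ennreal (energy s a) + 2 * X"
    unfolding X_def by (simp add: nn_integral_add nn_integral_cmult nn_integral_frac_integrand[OF H_fin_en[OF a(1)]])
  finally have A: "ennreal (sqnorm a) * ennreal W + ennreal (sqnorm a) * ennreal W \<le> ennreal (r powr ?a) * ennreal (energy s a) + 2 * X" .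
  \<comment> \<open>The smallness of \<open>r\<close> enters here: the energy term is at most one of
    the two equal terms on the left of \<open>A\<close> and is absorbed.\<close>
  have B: "ennreal (r powr ?a) * ennreal (energy s a) \<le> ennreal (sqnorm a) * ennreal W"
  proof -
    have "r powr ?a * energy s a \<le> r powr ?a * (\<Lambda> * sqnorm a)" by (rule mult_left_mono[OF en]) simp
    also have "\<dots> = r ^ ?N * (r powr (2 * s) * \<Lambda>) * sqnorm a" using r by (simp add: powr_add powr_realpow)
    also have "\<dots> \<le> r ^ ?N * unit_ball_vol (real ?N) * sqnorm a"
      using r rs by (intro mult_right_mono mult_left_mono ip_nonneg) auto
    finally have "r powr ?a * energy s a \<le> sqnorm a * W" by (simp add: W_def mult_ac)
    then show ?thesis
      unfolding ennreal_mult'[OF ip_nonneg, symmetric] ennreal_mult'[OF powr_ge_zero, symmetric] by (rule ennreal_leI)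
  qed
  have "ennreal (sqnorm a) * ennreal W + ennreal (sqnorm a) * ennreal W \<le> ennreal (sqnorm a) * ennreal W + 2 * X"
    by (rule order_trans[OF A add_right_mono[OF B]])
  then have "ennreal (sqnorm a) * ennreal W \<le> 2 * X"
    by (simp add: ennreal_add_left_cancel_le ennreal_mult_eq_top_iff)
  moreover have "X = (\<integral>\<^sup>+x. ennreal (a x) * (\<integral>\<^sup>+y. ennreal (a y) * indicator (ball x r) y \<partial>lborel) \<partial>lborel)"
  proof -
    have "X = (\<integral>\<^sup>+x. \<integral>\<^sup>+y. ennreal (a x) * ennreal (a y) * g (x - y) \<partial>lborel \<partial>lborel)"
      unfolding X_def by (subst nn_integral_lborel_pair) auto
    also have "\<dots> = (\<integral>\<^sup>+x. ennreal (a x) * (\<integral>\<^sup>+y. ennreal (a y) * indicator (ball x r) y \<partial>lborel) \<partial>lborel)"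
    proof (rule nn_integral_cong)
      fix x :: 'a
      have "ennreal (a x) * ennreal (a y) * g (x - y) = ennreal (a x) * (ennreal (a y) * indicator (ball x r) y)" for y
        by (simp add: g_def indicator_def dist_norm mult.assoc norm_minus_commute[of y x])
      then show "(\<integral>\<^sup>+y. ennreal (a x) * ennreal (a y) * g (x - y) \<partial>lborel) = ennreal (a x) * (\<integral>\<^sup>+y. ennreal (a y) * indicator (ball x r) y \<partial>lborel)"
        by (simp add: nn_integral_cmult)
    qed
    finally show ?thesis .
  qed
  ultimately show ?thesis using W0 ip_nonneg[of a] by (simp add: W_def[symmetric] ennreal_mult' mult.commute)
qed

lemma cross_commute: "cross a b = cross b a"
  by (simp add: cross_def fun_eq_iff mult.commute add.commute)

text \<open>The self-interaction of \<open>a\<close> at distance below 1 is averaged against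
  \<open>b\<close>, and \<open>spread\<close> moves each ball from a point carrying \<open>a\<close>
  to one carrying \<open>b\<close>. The masses of \<open>a\<close> and \<open>b\<close> stay on
  opposite sides, since nothing is known about their ratio. The factor
  \<open>2 powr (- (N + 2 * s))\<close> is the least value of the kernel at distances below 2, the
  final 1/2 undoes the 2 of \<open>local_self_interaction\<close>.\<close>

lemma mass_inequality:
  assumes a: "a \<in> H" "\<And>x. 0 \<le> a x" and b: "b \<in> H" "\<And>x. 0 \<le> b x" and en: "energy s a \<le> \<Lambda> * sqnorm a"
    and r: "0 < r" "r \<le> 1" and rs: "r powr (2 * s) * \<Lambda> \<le> unit_ball_vol (real DIM('a))"
    and spread: "\<And>x x'. x \<in> \<Omega> \<Longrightarrow> x' \<in> \<Omega> \<Longrightarrow>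
       (\<integral>\<^sup>+y. ennreal (a y) * indicator (ball x 1) y \<partial>lborel) \<le> (\<integral>\<^sup>+y. ennreal (a y) * indicator (ball x' 2) y \<partial>lborel)"
  shows "(\<integral>\<^sup>+x. ennreal (b x) \<partial>lborel) * ennreal (2 powr (- (real DIM('a) + 2 * s)) * (unit_ball_vol (real DIM('a)) * r ^ DIM('a)) / 2 * sqnorm a)
    \<le> (\<integral>\<^sup>+x. ennreal (a x) \<partial>lborel) * (\<integral>\<^sup>+p. ennreal (cross a b p) \<partial>lborel)"
proof -
  have [measurable]: "a \<in> borel_measurable borel" "b \<in> borel_measurable borel" using a b by (auto intro: H_measurable)
  let ?W = "unit_ball_vol (real DIM('a)) * r ^ DIM('a)" let ?t = "2 powr (- (real DIM('a) + 2 * s))"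
  let ?A = "\<integral>\<^sup>+x. ennreal (a x) \<partial>lborel" and ?B = "\<integral>\<^sup>+x. ennreal (b x) \<partial>lborel"
  have bm: "(\<lambda>p. indicator (ball (fst p) c) (snd p) :: ennreal) \<in> borel_measurable (borel :: ('a \<times> 'a) measure)" for c
  proof -
    have "{p :: 'a \<times> 'a. dist (fst p) (snd p) < c} \<in> sets borel" by measurable
    then have "(indicator {p :: 'a \<times> 'a. dist (fst p) (snd p) < c} :: _ \<Rightarrow> ennreal) \<in> borel_measurable borel" by simp
    moreover have "indicator {p :: 'a \<times> 'a. dist (fst p) (snd p) < c} = (\<lambda>p. indicator (ball (fst p) c) (snd p) :: ennreal)"
      by (auto simp: indicator_def)
    ultimately show ?thesis by simp
  qed
  have [measurable]: "ball x c \<in> sets borel" for x :: 'a and c by simp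
  define M where "M c x = (\<integral>\<^sup>+y. ennreal (a y) * indicator (ball x c) y \<partial>lborel)" for c x
  have [measurable]: "M c \<in> borel_measurable borel" for c
  proof -
    have "(\<lambda>p. ennreal (a (snd p)) * indicator (ball (fst p) c) (snd p)) \<in> borel_measurable (borel \<Otimes>\<^sub>M (lborel :: 'a measure))"
      using bm[of c] by (subst measurable_cong_sets[OF sets_pair_measure_cong[OF refl sets_lborel] refl]) (simp add: borel_prod)
    then have "(\<lambda>(x, y). ennreal (a y) * indicator (ball x c) y) \<in> borel_measurable (borel \<Otimes>\<^sub>M (lborel :: 'a measure))"
      by (simp add: case_prod_beta)
    from lborel.borel_measurable_nn_integral[OF this] show ?thesis by (simp add: M_def[abs_def])
  qed
  have Mmono: "M r x \<le> M 1 x" for x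
    unfolding M_def by (intro nn_integral_mono mult_left_mono) (use r in \<open>auto simp: indicator_def\<close>)
  have "ennreal (?W * sqnorm a) \<le> 2 * (\<integral>\<^sup>+x. ennreal (a x) * M r x \<partial>lborel)"
    unfolding M_def using local_self_interaction[OF a en r(1) rs] by simp
  also have "\<dots> \<le> 2 * (\<integral>\<^sup>+x. ennreal (a x) * M 1 x \<partial>lborel)"
    by (intro mult_left_mono nn_integral_mono Mmono) auto
  finally have s1: "ennreal (?W * sqnorm a) \<le> 2 * (\<integral>\<^sup>+x. ennreal (a x) * M 1 x \<partial>lborel)" .
  have s2: "?B * (\<integral>\<^sup>+x. ennreal (a x) * M 1 x \<partial>lborel) \<le> ?A * (\<integral>\<^sup>+x. ennreal (b x) * M 2 x \<partial>lborel)"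
  proof -
    have "?B * (\<integral>\<^sup>+x. ennreal (a x) * M 1 x \<partial>lborel) = (\<integral>\<^sup>+x'. \<integral>\<^sup>+x. ennreal (b x') * (ennreal (a x) * M 1 x) \<partial>lborel \<partial>lborel)"
      by (simp add: nn_integral_cmult nn_integral_multc)
    also have "\<dots> \<le> (\<integral>\<^sup>+x'. \<integral>\<^sup>+x. ennreal (b x') * M 2 x' * ennreal (a x) \<partial>lborel \<partial>lborel)"
    proof (rule nn_integral_mono_AE)
      have va: "AE x in lborel. x \<notin> \<Omega> \<longrightarrow> a x = 0" and vb: "AE x in lborel. x \<notin> \<Omega> \<longrightarrow> b x = 0"
        using H_vanishing a(1) b(1) by (auto simp: vanishing_def)
      show "AE x' in lborel. (\<integral>\<^sup>+x. ennreal (b x') * (ennreal (a x) * M 1 x) \<partial>lborel) \<le> (\<integral>\<^sup>+x. ennreal (b x') * M 2 x' * ennreal (a x) \<partial>lborel)"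
        using vb
      proof eventually_elim
        fix x' assume x': "x' \<notin> \<Omega> \<longrightarrow> b x' = 0"
        have "AE x in lborel. ennreal (b x') * (ennreal (a x) * M 1 x) \<le> ennreal (b x') * M 2 x' * ennreal (a x)"
          using va
        proof eventually_elim
          fix x assume x: "x \<notin> \<Omega> \<longrightarrow> a x = 0"
          show "ennreal (b x') * (ennreal (a x) * M 1 x) \<le> ennreal (b x') * M 2 x' * ennreal (a x)"
          proof (cases "x \<in> \<Omega> \<and> x' \<in> \<Omega>")
            case True
            then have "M 1 x \<le> M 2 x'" unfolding M_def using spread by blast
            then have "ennreal (b x') * (ennreal (a x) * M 1 x) \<le> ennreal (b x') * (ennreal (a x) * M 2 x')"
              by (intro mult_left_mono) auto
            then show ?thesis by (simp add: mult_ac)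
          next
            case False
            then show ?thesis using x x' by auto
          qed
        qed
        then show "(\<integral>\<^sup>+x. ennreal (b x') * (ennreal (a x) * M 1 x) \<partial>lborel) \<le> (\<integral>\<^sup>+x. ennreal (b x') * M 2 x' * ennreal (a x) \<partial>lborel)"
          by (rule nn_integral_mono_AE)
      qed
    qed
    also have "\<dots> = ?A * (\<integral>\<^sup>+x. ennreal (b x) * M 2 x \<partial>lborel)"
      by (simp add: nn_integral_cmult nn_integral_multc mult.commute)
    finally show ?thesis .
  qed
  \<comment> \<open>Of the two summands of \<open>cross\<close> only \<open>b x * a y\<close> is
    kept. The point \<open>y = x\<close> is excluded because the kernel is 0 there.\<close>
  have s3: "ennreal ?t * (\<integral>\<^sup>+x. ennreal (b x) * M 2 x \<partial>lborel) \<le> (\<integral>\<^sup>+p. ennreal (cross a b p) \<partial>lborel)"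
  proof -
    have "ennreal ?t * (\<integral>\<^sup>+x. ennreal (b x) * M 2 x \<partial>lborel) = (\<integral>\<^sup>+x. ennreal ?t * (ennreal (b x) * M 2 x) \<partial>lborel)"
      by (simp add: nn_integral_cmult)
    also have "\<dots> \<le> (\<integral>\<^sup>+x. \<integral>\<^sup>+y. ennreal (cross a b (x, y)) \<partial>lborel \<partial>lborel)"
    proof (rule nn_integral_mono)
      fix x :: 'a
      have "ennreal ?t * (ennreal (b x) * M 2 x) = (\<integral>\<^sup>+y. ennreal ?t * (ennreal (b x) * (ennreal (a y) * indicator (ball x 2) y)) \<partial>lborel)"
        unfolding M_def by (simp add: nn_integral_cmult)
      also have "\<dots> \<le> (\<integral>\<^sup>+y. ennreal (cross a b (x, y)) \<partial>lborel)"
      proof (rule nn_integral_mono_AE)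
        have "AE y in lborel. y \<noteq> x" by (rule AE_lborel_singleton)
        then show "AE y in lborel. ennreal ?t * (ennreal (b x) * (ennreal (a y) * indicator (ball x 2) y)) \<le> ennreal (cross a b (x, y))"
        proof eventually_elim
          fix y assume y: "y \<noteq> x"
          show "ennreal ?t * (ennreal (b x) * (ennreal (a y) * indicator (ball x 2) y)) \<le> ennreal (cross a b (x, y))"
          proof (cases "y \<in> ball x 2")
            case True
            have "?t \<le> kern s (x - y)" unfolding kern_def using True y s_pos by (intro powr_mono2') (auto simp: dist_norm)
            then have "?t * (b x * a y) \<le> kern s (x - y) * (b x * a y)" using a b by (intro mult_right_mono) auto
            also have "\<dots> \<le> cross a b (x, y)" using a b by (simp add: cross_def algebra_simps)
            finally have "ennreal (?t * (b x * a y)) \<le> ennreal (cross a b (x, y))" by (rule ennreal_leI)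
            then show ?thesis using True a b by (simp add: ennreal_mult)
          qed simp
        qed
      qed
      finally show "ennreal ?t * (ennreal (b x) * M 2 x) \<le> (\<integral>\<^sup>+y. ennreal (cross a b (x, y)) \<partial>lborel)" .
    qed
    also have "\<dots> = (\<integral>\<^sup>+p. ennreal (cross a b p) \<partial>lborel)"
      by (subst nn_integral_lborel_pair) (auto simp: cross_def[abs_def])
    finally show ?thesis .
  qed
  have "?B * ennreal (?t * ?W / 2 * sqnorm a) = ennreal (?t / 2) * (?B * ennreal (?W * sqnorm a))"
  proof -
    have "?t * ?W / 2 * sqnorm a = ?t / 2 * (?W * sqnorm a)" by simp
    then show ?thesis by (simp only:) (subst ennreal_mult', simp, simp add: mult_ac)
  qed
  also have "\<dots> \<le> ennreal (?t / 2) * (?B * (2 * (\<integral>\<^sup>+x. ennreal (a x) * M 1 x \<partial>lborel)))"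
    by (intro mult_left_mono s1) auto
  also have "\<dots> = ennreal ?t * (?B * (\<integral>\<^sup>+x. ennreal (a x) * M 1 x \<partial>lborel))"
  proof -
    have "ennreal ?t = ennreal (?t / 2) * 2" by (subst ennreal_numeral[symmetric], subst ennreal_mult'[symmetric]) auto
    then show ?thesis by (simp only: mult_ac)
  qed
  also have "\<dots> \<le> ennreal ?t * (?A * (\<integral>\<^sup>+x. ennreal (b x) * M 2 x \<partial>lborel))" by (intro mult_left_mono s2) auto
  also have "\<dots> = ?A * (ennreal ?t * (\<integral>\<^sup>+x. ennreal (b x) * M 2 x \<partial>lborel))" by (simp only: mult_ac)
  also have "\<dots> \<le> ?A * (\<integral>\<^sup>+p. ennreal (cross a b p) \<partial>lborel)" by (intro mult_left_mono s3) auto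
  finally show ?thesis .
qed

end

context frac_symmetric_domain
begin

text \<open>Testing the variational characterisation with the odd functions \<open>x\<^sub>i p\<close>.\<close>

lemma coordinate_inequality:
  assumes p: "p \<in> H" "even_fn p" and q: "q \<in> H" and pq: "AE x in lborel. p x * q x = 0"
    and u: "weak_solution s \<Omega> (eigenvalue 2 s \<Omega>) (\<lambda>x. p x - q x)"
  shows "integrable lborel (\<lambda>z. p (fst z) * p (snd z) * norm (fst z - snd z) ^ 2 * kern s (fst z - snd z))"
    "integrable lborel (\<lambda>z. (q (fst z) * (p (snd z) * norm (snd z) ^ 2) + q (snd z) * (p (fst z) * norm (fst z) ^ 2)) * kern s (fst z - snd z))"
    "(LINT z|lborel. (q (fst z) * (p (snd z) * norm (snd z) ^ 2) + q (snd z) * (p (fst z) * norm (fst z) ^ 2)) * kern s (fst z - snd z))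
      \<le> (LINT z|lborel. p (fst z) * p (snd z) * norm (fst z - snd z) ^ 2 * kern s (fst z - snd z))"
proof -
  define L where "L = eigenvalue 2 s \<Omega> / cst"
  have uen: "en s (\<lambda>x. p x - q x) v = L * ip (\<lambda>x. p x - q x) v" if "v \<in> H" for v
    using u that cst_pos unfolding weak_solution_iff L_def by (simp add: field_simps)
  define T where "T b z = p (fst z) * p (snd z) * ((fst z - snd z) \<bullet> b)\<^sup>2 * kern s (fst z - snd z)" for b and z :: "'a \<times> 'a"
  define h2 where "h2 b x = (x \<bullet> b) * ((x \<bullet> b) * p x)" for b x
  have fH: "(\<lambda>x. (x \<bullet> b) * p x) \<in> H" for b by (rule H_mult_inner[OF p(1)])
  have h2H: "h2 b \<in> H" for b unfolding h2_def by (rule H_mult_inner[OF fH])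
  have qh2: "AE x in lborel. q x * h2 b x = 0" for b using pq by (rule eventually_mono) (auto simp: h2_def)
  \<comment> \<open>The algebraic identity behind the argument:
    \<open>(s f - t g)^2 - (f - g) (s^2 f - t^2 g) = f g (s - t)^2\<close>, with \<open>s\<close>
    and \<open>t\<close> the coordinates of the two points.\<close>
  have pw: "T b z = density s (\<lambda>x. (x \<bullet> b) * p x) z - frac_integrand s p (h2 b) z" for b z
  proof -
    obtain x y where z: "z = (x, y)" by (cases z)
    show ?thesis unfolding z T_def h2_def frac_integrand_kern
      by (simp add: inner_diff_left power2_eq_square algebra_simps)
  qed
  have Ti: "integrable lborel (T b)" for b
    unfolding pw by (intro Bochner_Integration.integrable_diff integrable_frac_integrand H_fin_en fH p h2H)
  have TL: "(LINT z|lborel. T b z) = energy s (\<lambda>x. (x \<bullet> b) * p x) - en s p (h2 b)" for b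
    unfolding pw en_def
    by (intro Bochner_Integration.integral_diff integrable_frac_integrand H_fin_en fH p h2H)
  note ci = en_disjoint[OF q h2H qh2]
  \<comment> \<open>The eigenvalue bound for the odd function \<open>(x \<bullet> b) * p x\<close>
    is compared with the equation for \<open>u\<close> tested with \<open>h2 b\<close>. Both contain
    \<open>L\<close> times the same squared norm, as \<open>q\<close> and \<open>h2 b\<close> are
    disjoint; it cancels, leaving the interaction of \<open>q\<close> with
    \<open>h2 b\<close>.\<close>
  have le: "(LINT z|lborel. cross q (h2 b) z) \<le> (LINT z|lborel. T b z)" for b
  proof -
    let ?f = "\<lambda>x. (x \<bullet> b) * p x"
    have odd: "odd_fn ?f" using p(2) unfolding odd_fn_def even_fn_def by (rule eventually_mono) simp
    have "L * sqnorm ?f \<le> energy s ?f"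
    proof (cases "sqnorm ?f = 0")
      case True then show ?thesis by (simp only: mult_zero_right en_nonneg)
    next
      case False
      then have "sqnorm ?f > 0" using ip_nonneg[of ?f] by linarith
      from eigenvalue_2_le_odd[OF fH odd this] show ?thesis using cst_pos unfolding L_def by (simp add: field_simps)
    qed
    moreover have "ip (\<lambda>x. p x - q x) (h2 b) = sqnorm ?f"
    proof -
      have "ip (\<lambda>x. p x - q x) (h2 b) = ip p (h2 b) - ip q (h2 b)" by (rule ip_diff_left[OF p(1) q h2H])
      also have "ip p (h2 b) = sqnorm ?f" unfolding ip_def h2_def by (simp add: mult_ac)
      also have "ip q (h2 b) = (LINT x|(lborel :: 'a measure). 0)"
        unfolding ip_def using qh2[of b] H_measurable[OF q] H_measurable[OF h2H] by (intro integral_cong_AE) auto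
      finally show ?thesis by simp
    qed
    moreover have "en s (\<lambda>x. p x - q x) (h2 b) = en s p (h2 b) - en s q (h2 b)"
      by (rule en_diff_left[OF H_fin_en[OF p(1)] H_fin_en[OF q] H_fin_en[OF h2H]])
    ultimately show ?thesis using uen[OF h2H, of b] ci(2)[of b] TL[of b] by simp
  qed
  have sq: "(\<Sum>b\<in>Basis. (x \<bullet> b)\<^sup>2) = norm x ^ 2" for x :: 'a
    by (simp only: power2_norm_eq_inner euclidean_inner[of x x]) (simp add: power2_eq_square)
  have T_eq: "(\<lambda>z. p (fst z) * p (snd z) * norm (fst z - snd z) ^ 2 * kern s (fst z - snd z)) = (\<lambda>z. \<Sum>b\<in>Basis. T b z)"
    unfolding T_def sq[symmetric] by (auto simp: sum_distrib_left sum_distrib_right)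
  have "(\<Sum>b\<in>Basis. cross q (h2 b) z) = (q (fst z) * (p (snd z) * norm (snd z) ^ 2) + q (snd z) * (p (fst z) * norm (fst z) ^ 2)) * kern s (fst z - snd z)" for z
  proof -
    have "(\<Sum>b\<in>Basis. cross q (h2 b) z) = (q (fst z) * (\<Sum>b\<in>Basis. h2 b (snd z)) + q (snd z) * (\<Sum>b\<in>Basis. h2 b (fst z))) * kern s (fst z - snd z)"
      unfolding cross_def by (simp add: sum_distrib_left sum.distrib flip: sum_distrib_right)
    moreover have "(\<Sum>b\<in>Basis. h2 b x) = p x * norm x ^ 2" for x
      unfolding h2_def sq[symmetric] by (simp add: sum_distrib_left power2_eq_square mult_ac)
    ultimately show ?thesis by simp
  qed
  then have C_eq: "(\<lambda>z. (q (fst z) * (p (snd z) * norm (snd z) ^ 2) + q (snd z) * (p (fst z) * norm (fst z) ^ 2)) * kern s (fst z - snd z))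
     = (\<lambda>z. \<Sum>b\<in>Basis. cross q (h2 b) z)" by auto
  show "integrable lborel (\<lambda>z. p (fst z) * p (snd z) * norm (fst z - snd z) ^ 2 * kern s (fst z - snd z))"
    unfolding T_eq by (intro Bochner_Integration.integrable_sum Ti)
  show "integrable lborel (\<lambda>z. (q (fst z) * (p (snd z) * norm (snd z) ^ 2) + q (snd z) * (p (fst z) * norm (fst z) ^ 2)) * kern s (fst z - snd z))"
    unfolding C_eq by (intro Bochner_Integration.integrable_sum ci(1))
  show "(LINT z|lborel. (q (fst z) * (p (snd z) * norm (snd z) ^ 2) + q (snd z) * (p (fst z) * norm (fst z) ^ 2)) * kern s (fst z - snd z))
      \<le> (LINT z|lborel. p (fst z) * p (snd z) * norm (fst z - snd z) ^ 2 * kern s (fst z - snd z))"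
    unfolding T_eq C_eq by (subst (1 2) Bochner_Integration.integral_sum) (auto intro!: sum_mono le Ti ci(1))
qed

end

section \<open>Bumps of fixed size and the estimates on the annulus\<close>

definition bump :: "'a::euclidean_space \<Rightarrow> 'a \<Rightarrow> real" where
  "bump a x = flat_fn 0 ((1/4)\<^sup>2 - (norm (x - a))\<^sup>2)"

lemma bump_nonneg: "0 \<le> bump a x"
  by (simp add: bump_def flat_fn_def)

lemma bump_neq_0_iff: "bump a x \<noteq> 0 \<longleftrightarrow> norm (x - a) < 1/4"
proof -
  have "(norm (x - a))\<^sup>2 < (1/4)\<^sup>2 \<longleftrightarrow> norm (x - a) < 1/4"
    using power_mono_iff[of "1/4" "norm (x - a)" 2] by (simp add: not_le[symmetric] del: power_mono_iff)
  then show ?thesis by (simp add: bump_def flat_fn_def)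
qed

lemma C_order_bump_fn: "C_order k (bump a)"
  unfolding bump_def[abs_def] by (rule C_order_bump)

lemma bump_measurable [measurable]: "bump a \<in> borel_measurable borel"
  using C_order_bump_fn[of 0 a] by (auto intro: borel_measurable_continuous_onI)

lemma bump_shift: "bump a = (\<lambda>x. bump 0 (- a + x))"
  by (auto simp: bump_def fun_eq_iff)

lemma test_functionsI_compact:
  assumes "\<And>k. C_order k f" "compact K" "K \<subseteq> \<Omega>" "\<And>x. f x \<noteq> 0 \<Longrightarrow> x \<in> K"
  shows "f \<in> test_functions \<Omega>"
proof -
  have sub: "closure {x. f x \<noteq> 0} \<subseteq> K"
    by (rule closure_minimal) (use assms compact_imp_closed in auto)
  then have "compact (closure {x. f x \<noteq> 0})"
    using compact_Int_closed[OF assms(2), of "closure {x. f x \<noteq> 0}"] by (simp add: inf_absorb2)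
  then show ?thesis using assms sub by (auto simp: test_functions_def)
qed

text \<open>The locale is interpreted on the unit ball, so the energy of the bump is a constant
  unrelated to any annulus.\<close>

lemma bump_fin_en:
  assumes "0 < s" "s < 1" "2 \<le> DIM('a)"
  shows "fin_en s (bump (0::'a::euclidean_space))"
proof -
  interpret frac_domain s "ball (0::'a) 1" by unfold_locales (use assms in auto)
  have "bump (0::'a) \<in> test_functions (ball 0 1)"
  proof (rule test_functionsI_compact[where K = "cball 0 (1/4)"])
    show "x \<in> cball 0 (1/4)" if "bump 0 x \<noteq> 0" for x :: 'a
      using that bump_neq_0_iff[of 0 x] by simp
  qed (auto simp: C_order_bump_fn)
  then show ?thesis by (rule tf_fin_en)
qed

lemma bump_integral_pos:
  shows "integrable lborel (\<lambda>x. bump (0::'a::euclidean_space) x * bump 0 x)" "0 < (LINT x|lborel. bump (0::'a) x * bump 0 x)"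
proof -
  have "flat_fn 0 t \<le> 1" for t by (auto simp: flat_fn_def)
  then have le: "bump (0::'a) x \<le> 1" for x by (simp only: bump_def)
  have "integrable lborel (indicator (ball (0::'a) 1) :: 'a \<Rightarrow> real)"
    by (simp add: emeasure_ball)
  then show i: "integrable lborel (\<lambda>x. bump (0::'a) x * bump 0 x)"
  proof (rule Bochner_Integration.integrable_bound)
    show "AE x in lborel. norm (bump (0::'a) x * bump 0 x) \<le> norm (indicator (ball 0 1) x :: real)"
    proof (rule AE_I2)
      fix x :: 'a
      have "bump 0 x * bump 0 x \<le> 1 * 1" by (intro mult_mono le bump_nonneg) auto
      then show "norm (bump 0 x * bump 0 x) \<le> norm (indicator (ball 0 1) x :: real)"
        using bump_neq_0_iff[of 0 x] by (auto simp: indicator_def bump_nonneg abs_mult dist_norm)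
    qed
  qed measurable
  have "(LINT x|lborel. bump (0::'a) x * bump 0 x) \<noteq> 0"
  proof
    assume "(LINT x|lborel. bump (0::'a) x * bump 0 x) = 0"
    then have "AE x in lborel. bump (0::'a) x * bump 0 x = 0"
      by (subst (asm) integral_nonneg_eq_0_iff_AE[OF i]) auto
    then have "AE x in lborel. x \<notin> ball (0::'a) (1/4)"
      by (rule eventually_mono) (use bump_neq_0_iff[of "0::'a"] in \<open>auto simp: dist_norm\<close>)
    moreover have "{x \<in> space lborel. \<not> x \<notin> ball (0::'a) (1/4)} = ball 0 (1/4)" by auto
    moreover have "ball (0::'a) (1/4) \<in> sets lborel" by simp
    ultimately have "emeasure lborel (ball (0::'a) (1/4)) = 0" by (simp only: AE_iff_measurable)
    then have "unit_ball_vol (real DIM('a)) = 0" by (simp add: emeasure_ball)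
    moreover have "unit_ball_vol (real DIM('a)) > 0" by simp
    ultimately show False by linarith
  qed
  moreover have "0 \<le> (LINT x|lborel. bump (0::'a) x * bump 0 x)" by (rule integral_nonneg_AE) simp
  ultimately show "0 < (LINT x|lborel. bump (0::'a) x * bump 0 x)" by linarith
qed

text \<open>The parameter \<open>space_type\<close> only serves to fix the ambient space when the locale is interpreted.\<close>

locale frac_annulus = frac_symmetric_domain s "annulus R :: 'a set"
  for s R :: real and space_type :: "'a::euclidean_space itself" +
  assumes R_pos: "0 < R"
begin

text \<open>Two opposite bumps centred in the middle of the shell; radius 1/4 fits inside width 1
  and keeps the supports disjoint. Translation invariance makes both bounds independent of
  \<open>R\<close>, and the 4 is 2 + 2 from \<open>en_diff_le\<close>.\<close>

lemma odd_test_function: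
  "\<exists>f. f \<in> H \<and> odd_fn f \<and> (LINT x|lborel. bump (0::'a) x * bump 0 x) \<le> sqnorm f \<and> energy s f \<le> 4 * energy s (bump (0::'a))"
proof -
  obtain e :: 'a where e: "e \<in> Basis" using nonempty_Basis by blast
  define a where "a = (R + 1/2) *\<^sub>R e"
  have na: "norm a = R + 1/2" using e R_pos by (simp add: a_def)
  define f where "f x = bump a x - bump (- a) x" for x
  have fm [measurable]: "f \<in> borel_measurable borel" unfolding f_def[abs_def] by measurable
  have in_ann: "x \<in> annulus R" if "norm (x - c) \<le> 1/4" "norm c = R + 1/2" for x c :: 'a
    using that norm_triangle_ineq2[of x c] norm_triangle_ineq2[of c x] by (simp add: annulus_def norm_minus_commute[of c x])
  have "f \<in> tf"
  proof (rule test_functionsI_compact[where K = "cball a (1/4) \<union> cball (- a) (1/4)"])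
    show "C_order k f" for k unfolding f_def[abs_def] by (intro C_order_diff C_order_bump_fn)
    show "cball a (1/4) \<union> cball (- a) (1/4) \<subseteq> annulus R"
      using in_ann[of _ a] in_ann[of _ "- a"] na
      by (auto simp: dist_norm norm_minus_commute[of a] norm_minus_commute[of "- a"])
    show "x \<in> cball a (1/4) \<union> cball (- a) (1/4)" if "f x \<noteq> 0" for x
    proof -
      have "bump a x \<noteq> 0 \<or> bump (- a) x \<noteq> 0" using that by (auto simp: f_def)
      then show ?thesis unfolding bump_neq_0_iff by (auto simp: dist_norm norm_minus_commute[of a] norm_minus_commute[of "- a"] less_imp_le)
    qed
  qed (auto intro: compact_Un)
  then have fH: "f \<in> H" by (rule tf_H)
  have "odd_fn f"
  proof -
    have "bump a (- x) = bump (- a) x" "bump (- a) (- x) = bump a x" for x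
      by (simp_all add: bump_def norm_minus_commute add.commute)
    then show ?thesis by (simp add: odd_fn_def f_def)
  qed
  moreover have "(LINT x|lborel. bump (0::'a) x * bump 0 x) \<le> sqnorm f"
  proof -
    have "(LINT x|lborel. bump (0::'a) x * bump 0 x) = (LINT x|distr lborel borel ((+) (- a)). bump (0::'a) x * bump 0 x)"
      by (simp add: lborel_distr_plus)
    also have "\<dots> = (LINT x|lborel. bump a x * bump a x)"
      unfolding bump_shift[of a] by (rule integral_distr) auto
    also have "\<dots> \<le> sqnorm f"
      unfolding ip_def
    proof (rule integral_mono')
      show "integrable lborel (\<lambda>x. f x * f x)" by (rule H_integrable_square[OF fH])
      fix x :: 'a
      show "0 \<le> f x * f x" by simp
      show "bump a x * bump a x \<le> f x * f x"
      proof (cases "bump a x = 0")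
        case False
        then have "norm (x - a) < 1/4" by (simp add: bump_neq_0_iff)
        moreover have "norm (2 *\<^sub>R a) \<le> norm (x - - a) + norm (x - a)"
          using norm_triangle_ineq4[of "x - - a" "x - a"] by (simp add: scaleR_2)
        ultimately have "\<not> norm (x - - a) < 1/4" using na R_pos by simp
        then have "bump (- a) x = 0" using bump_neq_0_iff[of "- a" x] by blast
        then show ?thesis by (simp add: f_def)
      qed simp
    qed
    finally show ?thesis .
  qed
  moreover have "energy s f \<le> 4 * energy s (bump (0::'a))"
  proof -
    note b0 = bump_fin_en[OF s_pos s_less dim]
    have b: "fin_en s (bump c)" "energy s (bump c) = energy s (bump (0::'a))" for c :: 'a
      unfolding bump_shift[of c] by (rule fin_en_shift[OF b0], rule en_shift[OF b0])
    show ?thesis using en_diff_le[OF b(1)[of a] b(1)[of "- a"]] b(2)[of a] b(2)[of "- a"]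
      unfolding f_def[abs_def] by linarith
  qed
  ultimately show ?thesis using fH by blast
qed

text \<open>The added 1 guarantees a positive bound, by which a quotient is formed later when the
  radius \<open>r\<close> is chosen.\<close>

lemma eigenvalue_2_bound:
  "eigenvalue 2 s (annulus R :: 'a set) \<le> cst * ((4 * energy s (bump (0::'a)) + 1) / (LINT x|lborel. bump (0::'a) x * bump 0 x))"
proof -
  let ?B = "LINT x|lborel. bump (0::'a) x * bump 0 x" let ?E = "energy s (bump (0::'a))"
  let ?l = "eigenvalue 2 s (annulus R :: 'a set)"
  have Bp: "?B > 0" by (rule bump_integral_pos(2))
  have E0: "?E \<ge> 0" by (rule en_nonneg)
  show ?thesis
  proof (cases "?l \<le> 0")
    case True
    have "0 \<le> cst * ((4 * ?E + 1) / ?B)" using cst_pos Bp E0 by simp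
    then show ?thesis using True by linarith
  next
    case False
    obtain f where f: "f \<in> H" "odd_fn f" "?B \<le> sqnorm f" "energy s f \<le> 4 * ?E" using odd_test_function by blast
    have "?l * ?B \<le> ?l * sqnorm f" using f(3) False by (intro mult_left_mono) auto
    also have "\<dots> \<le> cst * energy s f" by (rule eigenvalue_2_le_odd[OF f(1,2)]) (use f(3) Bp in linarith)
    also have "\<dots> \<le> cst * (4 * ?E + 1)" using f(4) cst_pos by (intro mult_left_mono) auto
    finally show ?thesis using Bp by (simp add: field_simps)
  qed
qed

text \<open>The conclusion compares \<open>R^2\<close> with \<open>R\<close> to the power
  \<open>2 - 2 * s\<close> up to constants, so it fails for large \<open>R\<close>. The constants
  \<open>\<Lambda>\<close>, \<open>r\<close>, \<open>K\<close> and \<open>k\<close> enter as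
  parameters in order to be chosen before \<open>R\<close>.\<close>

lemma sign_changing_bound:
  assumes p: "p \<in> H" "\<And>x. 0 \<le> p x" "even_fn p" and q: "q \<in> H" "\<And>x. 0 \<le> q x"
    and pq: "AE x in lborel. p x * q x = 0"
    and u: "weak_solution s (annulus R) (eigenvalue 2 s (annulus R :: 'a set)) (\<lambda>x. p x - q x)"
    and le: "sqnorm p \<le> sqnorm q" and pos: "0 < sqnorm p"
    and \<Lambda>: "eigenvalue 2 s (annulus R :: 'a set) \<le> cst * \<Lambda>"
    and r: "0 < r" "r \<le> 1" and rs: "r powr (2 * s) * \<Lambda> \<le> unit_ball_vol (real DIM('a))"
    and K: "\<And>\<rho>. \<rho> > 0 \<Longrightarrow> (\<integral>\<^sup>+z. ennreal (norm z ^ 2 * kern s (z::'a)) * indicator (cball 0 \<rho>) z \<partial>lborel) \<le> ennreal (K * \<rho> powr (2 - 2 * s))"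
    and spread: "\<And>a x x'. a \<in> {p, q} \<Longrightarrow> x \<in> annulus R \<Longrightarrow> x' \<in> annulus R \<Longrightarrow>
       (\<integral>\<^sup>+y. ennreal (a y) * indicator (ball x 1) y \<partial>lborel) \<le> (\<integral>\<^sup>+y. ennreal (a y) * indicator (ball x' 2) y \<partial>lborel)"
    and k: "k = 2 powr (- (real DIM('a) + 2 * s)) * (unit_ball_vol (real DIM('a)) * r ^ DIM('a)) / 2"
    and K0: "0 < K"
  shows "R\<^sup>2 * k \<le> K * (2 * R + 2) powr (2 - 2 * s)"
proof -
  have [measurable]: "p \<in> borel_measurable borel" "q \<in> borel_measurable borel" using p q by (auto intro: H_measurable)
  define L where "L = eigenvalue 2 s (annulus R :: 'a set) / cst"
  have L\<Lambda>: "L \<le> \<Lambda>" using \<Lambda> cst_pos by (simp add: L_def field_simps)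
  have uen: "en s (\<lambda>x. p x - q x) v = L * ip (\<lambda>x. p x - q x) v" if "v \<in> H" for v
    using u that cst_pos unfolding weak_solution_iff L_def by (simp add: field_simps)
  have ipq: "ip p q = 0"
  proof -
    have "ip p q = (LINT x|(lborel :: 'a measure). 0)" unfolding ip_def by (rule integral_cong_AE) (use pq in auto)
    then show ?thesis by simp
  qed
  have k0: "k \<ge> 0" unfolding k using r by simp
  have qpos: "sqnorm q > 0" using le pos by simp
  have enpq: "en s p q \<le> 0" by (rule en_disjoint_eq_0(1)[OF p(1) q(1) pq]) (use p q in auto)
  \<comment> \<open>The equation tested with \<open>p\<close> itself. Since \<open>en s p q\<close>
    is nonpositive, dropping it bounds the energy of \<open>p\<close> by its squared norm.\<close>
  have eq1: "energy s p = L * sqnorm p + en s p q"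
    using uen[OF p(1)] by (simp add: en_diff_left ip_diff_left H_fin_en p q ipq ip_commute[of q p] en_commute[of s q p])
  have eq2: "energy s q = L * sqnorm q + en s p q"
    using uen[OF q(1)] by (simp add: en_diff_left ip_diff_left H_fin_en p q ipq)
  have enp: "energy s p \<le> \<Lambda> * sqnorm p" using eq1 enpq mult_right_mono[OF L\<Lambda> ip_nonneg[of p]] by linarith
  have enq: "energy s q \<le> \<Lambda> * sqnorm q" using eq2 enpq mult_right_mono[OF L\<Lambda> ip_nonneg[of q]] by linarith
  note ci = en_disjoint[OF p(1) q(1) pq]
  define J where "J = (LINT z|lborel. cross p q z)"
  have cross0: "0 \<le> cross p q z" for z using p q by (simp add: cross_def)
  have J0: "0 \<le> J" unfolding J_def by (rule integral_nonneg_AE) (simp add: cross0)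
  have Jnn: "(\<integral>\<^sup>+z. ennreal (cross p q z) \<partial>lborel) = ennreal J"
    unfolding J_def by (rule nn_integral_eq_integral[OF ci(1)]) (simp add: cross0)
  have mass_pos: "\<exists>t>0. (\<integral>\<^sup>+x. ennreal (a x) \<partial>lborel) = ennreal t" if a: "a \<in> H" "\<And>x. 0 \<le> a x" "0 < sqnorm a" for a
  proof -
    have [measurable]: "a \<in> borel_measurable borel" using a by (auto intro: H_measurable)
    have "(\<integral>\<^sup>+x. ennreal (a x) \<partial>lborel) \<noteq> 0"
    proof
      assume "(\<integral>\<^sup>+x. ennreal (a x) \<partial>lborel) = 0"
      then have "AE x in lborel. ennreal (a x) = 0" by (subst (asm) nn_integral_0_iff_AE) auto
      then have "AE x in lborel. a x = 0" by (rule eventually_mono) (use a(2) in \<open>simp add: ennreal_eq_0_iff order_antisym\<close>)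
      then have "sqnorm a = 0" using ip_eq_0_iff[OF a(1)] by blast
      then show False using a(3) by linarith
    qed
    moreover have "(\<integral>\<^sup>+x. ennreal (a x) \<partial>lborel) < top" using H_nn_integral_finite[OF a(1)] by simp
    ultimately show ?thesis by (cases "\<integral>\<^sup>+x. ennreal (a x) \<partial>lborel") (auto simp: less_le)
  qed
  obtain i where i: "i > 0" "(\<integral>\<^sup>+x. ennreal (p x) \<partial>lborel) = ennreal i" using mass_pos[OF p(1,2) pos] by blast
  obtain j where j: "j > 0" "(\<integral>\<^sup>+x. ennreal (q x) \<partial>lborel) = ennreal j" using mass_pos[OF q(1,2) qpos] by blast
  have m1: "j * (k * sqnorm p) \<le> i * J"
  proof -
    have "ennreal j * ennreal (k * sqnorm p) \<le> ennreal i * ennreal J"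
      using mass_inequality[OF p(1,2) q(1,2) enp r rs spread] unfolding i(2) j(2) Jnn k by simp
    then show ?thesis using i(1) j(1) J0 by (simp add: ennreal_mult'[symmetric])
  qed
  have m2: "i * (k * sqnorm q) \<le> j * J"
  proof -
    have "ennreal i * ennreal (k * sqnorm q) \<le> ennreal j * ennreal J"
      using mass_inequality[OF q(1,2) p(1,2) enq r rs spread] unfolding i(2) j(2) cross_commute[of q p] Jnn k by simp
    then show ?thesis using i(1) j(1) J0 by (simp add: ennreal_mult'[symmetric])
  qed
  \<comment> \<open>The ratio of the masses \<open>i\<close> and \<open>j\<close> is unknown: for
    \<open>i \<le> j\<close> the estimate for \<open>p\<close> suffices, otherwise the one for
    \<open>q\<close> does, and \<open>le\<close> passes from \<open>q\<close> to
    \<open>p\<close>.\<close>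
  have kJ: "k * sqnorm p \<le> J"
  proof (cases "i \<le> j")
    case True
    then have "j * (k * sqnorm p) \<le> j * J" using m1 mult_right_mono[OF True J0] by linarith
    then show ?thesis using j(1) by simp
  next
    case False
    then have "i * (k * sqnorm q) \<le> i * J" using m2 mult_right_mono[of j i J] J0 by linarith
    then have "k * sqnorm q \<le> J" using i(1) by simp
    then show ?thesis using mult_left_mono[OF le k0] by linarith
  qed
  note co = coordinate_inequality[OF p(1,3) q(1) pq u]
  let ?C = "\<lambda>z :: 'a \<times> 'a. (q (fst z) * (p (snd z) * norm (snd z) ^ 2) + q (snd z) * (p (fst z) * norm (fst z) ^ 2)) * kern s (fst z - snd z)"
  let ?T = "\<lambda>z :: 'a \<times> 'a. p (fst z) * p (snd z) * norm (fst z - snd z) ^ 2 * kern s (fst z - snd z)"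
  have vp: "AE x in lborel. x \<notin> annulus R \<longrightarrow> p x = 0" using H_vanishing[OF p(1)] by (simp add: vanishing_def)
  have "R\<^sup>2 * J = (LINT z|lborel. R\<^sup>2 * cross p q z)" unfolding J_def by simp
  also have "\<dots> \<le> (LINT z|lborel. ?C z)"
  proof (rule integral_mono_AE)
    show "integrable lborel (\<lambda>z. R\<^sup>2 * cross p q z)" using ci(1) by simp
    show "integrable lborel ?C" by (rule co(2))
    show "AE z in lborel. R\<^sup>2 * cross p q z \<le> ?C z"
      using AE_lborel_fst[OF vp] AE_lborel_snd[OF vp]
    proof eventually_elim
      fix z :: "'a \<times> 'a"
      assume v: "fst z \<notin> annulus R \<longrightarrow> p (fst z) = 0" "snd z \<notin> annulus R \<longrightarrow> p (snd z) = 0"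
      obtain x y where z: "z = (x, y)" by (cases z)
      have sq: "R\<^sup>2 * p t \<le> p t * norm t ^ 2" if "t \<notin> annulus R \<longrightarrow> p t = 0" for t
      proof (cases "t \<in> annulus R")
        case True
        then have "R\<^sup>2 \<le> norm t ^ 2" using R_pos by (intro power_mono) (auto simp: annulus_def)
        then show ?thesis using p(2)[of t] by (simp add: mult.commute mult_left_mono)
      qed (use that in simp)
      have "R\<^sup>2 * (p x * q y + p y * q x) = (R\<^sup>2 * p x) * q y + (R\<^sup>2 * p y) * q x" by (simp add: algebra_simps)
      also have "\<dots> \<le> (p x * norm x ^ 2) * q y + (p y * norm y ^ 2) * q x"
        using sq[of x] sq[of y] v z q(2) by (intro add_mono mult_right_mono) auto
      also have "\<dots> = q x * (p y * norm y ^ 2) + q y * (p x * norm x ^ 2)" by (simp add: algebra_simps)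
      finally have "R\<^sup>2 * (p x * q y + p y * q x) * kern s (x - y) \<le> (q x * (p y * norm y ^ 2) + q y * (p x * norm x ^ 2)) * kern s (x - y)"
        by (rule mult_right_mono) simp
      then show "R\<^sup>2 * cross p q z \<le> ?C z" by (simp add: z cross_def mult.assoc)
    qed
  qed
  also have "\<dots> \<le> (LINT z|lborel. ?T z)" by (rule co(3))
  also have "\<dots> \<le> sqnorm p * (K * (2 * R + 2) powr (2 - 2 * s))"
  proof -
    \<comment> \<open>Two points of the annulus are at distance at most \<open>2 * R + 2\<close>.
      With \<open>p x * p y\<close> bounded by the mean of the squares, the integral splits into two
      convolutions with \<open>g\<close>.\<close>
    define g :: "'a \<Rightarrow> ennreal" where "g z = ennreal (norm z ^ 2 * kern s z) * indicator (cball 0 (2 * R + 2)) z" for z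
    have [measurable]: "cball (0::'a) (2 * R + 2) \<in> sets borel" by auto
    have [measurable]: "g \<in> borel_measurable borel" unfolding g_def by measurable
    have even: "g (- z) = g z" for z by (simp add: g_def kern_def indicator_def)
    let ?G = "K * (2 * R + 2) powr (2 - 2 * s)"
    have gK: "(\<integral>\<^sup>+z. g z \<partial>lborel) \<le> ennreal ?G" unfolding g_def by (rule K) (use R_pos in simp)
    have p2: "(\<integral>\<^sup>+x. ennreal (p x * p x) \<partial>lborel) = ennreal (sqnorm p)"
      using nn_integral_eq_integral[OF H_integrable_square[OF p(1)]] by (simp add: ip_def)
    have "ennreal (LINT z|lborel. ?T z) = (\<integral>\<^sup>+z. ennreal (?T z) \<partial>lborel)"
      by (rule nn_integral_eq_integral[OF co(1), symmetric]) (use p in simp)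
    also have "\<dots> \<le> (\<integral>\<^sup>+z. ennreal (1/2) * (ennreal (p (fst z) * p (fst z)) * g (fst z - snd z) + ennreal (p (snd z) * p (snd z)) * g (fst z - snd z)) \<partial>lborel)"
    proof (rule nn_integral_mono_AE)
      show "AE z in lborel. ennreal (?T z) \<le> ennreal (1/2) * (ennreal (p (fst z) * p (fst z)) * g (fst z - snd z) + ennreal (p (snd z) * p (snd z)) * g (fst z - snd z))"
        using AE_lborel_fst[OF vp] AE_lborel_snd[OF vp]
      proof eventually_elim
        fix z :: "'a \<times> 'a"
        assume v: "fst z \<notin> annulus R \<longrightarrow> p (fst z) = 0" "snd z \<notin> annulus R \<longrightarrow> p (snd z) = 0"
        obtain x y where z: "z = (x, y)" by (cases z)
        show "ennreal (?T z) \<le> ennreal (1/2) * (ennreal (p (fst z) * p (fst z)) * g (fst z - snd z) + ennreal (p (snd z) * p (snd z)) * g (fst z - snd z))"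
        proof (cases "x \<in> annulus R \<and> y \<in> annulus R")
          case True
          then have "norm (x - y) \<le> 2 * R + 2" using norm_triangle_ineq4[of x y] by (simp add: annulus_def)
          then have g1: "g (x - y) = ennreal (norm (x - y) ^ 2 * kern s (x - y))" by (simp add: g_def)
          have "p x * p y \<le> 1/2 * (p x * p x + p y * p y)" using sum_squares_bound[of "p x" "p y"] by (simp add: power2_eq_square)
          then have "p x * p y * (norm (x - y) ^ 2 * kern s (x - y)) \<le> 1/2 * (p x * p x + p y * p y) * (norm (x - y) ^ 2 * kern s (x - y))"
            by (rule mult_right_mono) simp
          then have "ennreal (?T z) \<le> ennreal (1/2 * ((p x * p x) * (norm (x - y) ^ 2 * kern s (x - y)) + (p y * p y) * (norm (x - y) ^ 2 * kern s (x - y))))"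
            by (intro ennreal_leI) (simp add: z algebra_simps)
          also have "\<dots> = ennreal (1/2) * (ennreal (p x * p x) * g (x - y) + ennreal (p y * p y) * g (x - y))"
            unfolding g1 by (simp only: ennreal_mult'[symmetric] ennreal_plus[symmetric] zero_le_square zero_le_power2
                kern_nonneg mult_nonneg_nonneg zero_le_divide_1_iff zero_le_numeral add_nonneg_nonneg)
          finally show ?thesis by (simp only: z fst_conv snd_conv)
        next
          case False
          then have T0: "?T z = 0" using v z by auto
          show ?thesis unfolding T0 by simp
        qed
      qed
    qed
    also have "\<dots> = ennreal (1/2) * (ennreal (sqnorm p) * (\<integral>\<^sup>+z. g z \<partial>lborel) + ennreal (sqnorm p) * (\<integral>\<^sup>+z. g z \<partial>lborel))"
      using nn_integral_convolution_fst[of g "\<lambda>x. ennreal (p x * p x)"] nn_integral_convolution_snd[of g "\<lambda>x. ennreal (p x * p x)"] even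
      by (simp add: nn_integral_cmult nn_integral_add p2)
    also have "\<dots> \<le> ennreal (1/2) * (ennreal (sqnorm p) * ennreal ?G + ennreal (sqnorm p) * ennreal ?G)"
      by (intro mult_left_mono add_mono gK) auto
    also have "\<dots> = ennreal (sqnorm p * ?G)"
    proof -
      have G0: "0 \<le> ?G" using K0 by simp
      have "ennreal (1/2) * (ennreal (sqnorm p) * ennreal ?G + ennreal (sqnorm p) * ennreal ?G) = ennreal (1/2 * (sqnorm p * ?G + sqnorm p * ?G))"
        by (simp only: ennreal_mult'[symmetric] ennreal_plus[symmetric] ip_nonneg G0 mult_nonneg_nonneg
            zero_le_divide_1_iff zero_le_numeral)
      moreover have "1/2 * (sqnorm p * ?G + sqnorm p * ?G) = sqnorm p * ?G" by simp
      ultimately show ?thesis by (simp only:)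
    qed
    finally show ?thesis using K0 ip_nonneg[of p] by (subst (asm) ennreal_le_iff) auto
  qed
  finally have "R\<^sup>2 * J \<le> sqnorm p * (K * (2 * R + 2) powr (2 - 2 * s))" .
  moreover have "R\<^sup>2 * (k * sqnorm p) \<le> R\<^sup>2 * J" by (rule mult_left_mono[OF kJ]) simp
  ultimately have "sqnorm p * (R\<^sup>2 * k) \<le> sqnorm p * (K * (2 * R + 2) powr (2 - 2 * s))" by (simp add: mult_ac)
  then show ?thesis using pos by simp
qed

end

section \<open>Rotation invariance and the mass of radial functions in balls\<close>

lemma nn_integral_orthogonal:
  fixes T :: "'a::euclidean_space \<Rightarrow> 'a" and f :: "'a \<Rightarrow> ennreal"
  assumes T: "orthogonal_transformation T" and [measurable]: "f \<in> borel_measurable borel"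
  shows "(\<integral>\<^sup>+x. f (T x) \<partial>lborel) = (\<integral>\<^sup>+x. f x \<partial>lborel)"
proof -
  \<comment> \<open>Uniqueness of translation invariant measures: evaluate \<open>\<integral>\<integral> f (T x + y) 1\<^sub>B(y)\<close> for the unit ball \<open>B\<close> in both orders.\<close>
  have lin: "linear T" using T by (rule orthogonal_transformation_linear)
  have [measurable]: "T \<in> borel_measurable borel"
    by (rule borel_measurable_continuous_onI) (use lin linear_continuous_on linear_conv_bounded_linear in blast)
  have surj: "surj T" using orthogonal_transformation_bij[OF T] by (simp add: bij_def)
  define g :: "'a \<Rightarrow> ennreal" where "g = indicator (ball 0 1)"
  have [measurable]: "ball (0::'a) 1 \<in> sets borel" by simp
  have [measurable]: "g \<in> borel_measurable borel" unfolding g_def by measurable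
  define W where "W = emeasure lborel (ball (0::'a) 1)"
  have W: "W \<noteq> 0" "W \<noteq> \<infinity>"
    using unit_ball_vol_pos[of "real DIM('a)"] by (simp_all add: W_def emeasure_ball del: unit_ball_vol_pos)
  have gW: "(\<integral>\<^sup>+y. g y \<partial>lborel) = W" by (simp add: g_def W_def)
  have left: "(\<integral>\<^sup>+y. \<integral>\<^sup>+x. f (T x + y) * g y \<partial>lborel \<partial>lborel) = (\<integral>\<^sup>+x. f (T x) \<partial>lborel) * W"
  proof -
    have "(\<integral>\<^sup>+x. f (T x + y) \<partial>lborel) = (\<integral>\<^sup>+x. f (T x) \<partial>lborel)" for y
    proof -
      obtain z where z: "y = T z" using surj by (metis surjD)
      have "(\<integral>\<^sup>+x. f (T x + y) \<partial>lborel) = (\<integral>\<^sup>+x. f (T (z + x)) \<partial>lborel)"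
        by (simp add: z linear_add[OF lin] add.commute)
      also have "\<dots> = (\<integral>\<^sup>+x. f (T x) \<partial>lborel)" by (rule nn_integral_lborel_shift[of "\<lambda>x. f (T x)"]) measurable
      finally show ?thesis .
    qed
    then show ?thesis by (simp add: nn_integral_multc nn_integral_cmult gW)
  qed
  have "(\<integral>\<^sup>+y. \<integral>\<^sup>+x. f (T x + y) * g y \<partial>lborel \<partial>lborel) = (\<integral>\<^sup>+x. \<integral>\<^sup>+y. f (T x + y) * g y \<partial>lborel \<partial>lborel)"
    using nn_integral_lborel_pair'[of "\<lambda>p. f (T (fst p) + snd p) * g (snd p)"]
      nn_integral_lborel_pair[of "\<lambda>p. f (T (fst p) + snd p) * g (snd p)"] by simp
  also have "\<dots> = (\<integral>\<^sup>+x. \<integral>\<^sup>+y. f y * g (y - T x) \<partial>lborel \<partial>lborel)"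
  proof (rule nn_integral_cong)
    fix x :: 'a
    have "(\<integral>\<^sup>+y. f y * g (y - T x) \<partial>lborel) = (\<integral>\<^sup>+y. f (T x + y) * g (T x + y - T x) \<partial>lborel)"
      by (rule nn_integral_lborel_shift[symmetric]) measurable
    then show "(\<integral>\<^sup>+y. f (T x + y) * g y \<partial>lborel) = (\<integral>\<^sup>+y. f y * g (y - T x) \<partial>lborel)" by simp
  qed
  also have "\<dots> = (\<integral>\<^sup>+y. \<integral>\<^sup>+x. f y * g (y - T x) \<partial>lborel \<partial>lborel)"
    using nn_integral_lborel_pair'[of "\<lambda>p. f (snd p) * g (snd p - T (fst p))"]
      nn_integral_lborel_pair[of "\<lambda>p. f (snd p) * g (snd p - T (fst p))"] by simp
  also have "\<dots> = (\<integral>\<^sup>+y. f y * W \<partial>lborel)"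
  proof (rule nn_integral_cong)
    fix y :: 'a
    obtain z where z: "y = T z" using surj by (metis surjD)
    have "g (y - T x) = g (- z + x)" for x
    proof -
      have "norm (y - T x) = norm (- z + x)"
        using orthogonal_transformation_norm[OF T, of "z - x"] by (simp add: z linear_diff[OF lin] norm_minus_commute)
      then show ?thesis by (simp add: g_def indicator_def)
    qed
    then have "(\<integral>\<^sup>+x. g (y - T x) \<partial>lborel) = (\<integral>\<^sup>+x. g (- z + x) \<partial>lborel)" by simp
    also have "\<dots> = W" by (subst nn_integral_lborel_shift) (simp_all add: gW)
    finally show "(\<integral>\<^sup>+x. f y * g (y - T x) \<partial>lborel) = f y * W" by (simp add: nn_integral_cmult)
  qed
  finally have "(\<integral>\<^sup>+x. f (T x) \<partial>lborel) * W = (\<integral>\<^sup>+x. f x \<partial>lborel) * W"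
    unfolding left by (simp add: nn_integral_multc)
  then show ?thesis using W by (simp add: ennreal_mult_cancel_left mult.commute[of _ W])
qed

lemma distr_lborel_orthogonal:
  fixes T :: "'a::euclidean_space \<Rightarrow> 'a"
  assumes T: "orthogonal_transformation T"
  shows "T \<in> borel_measurable borel" "distr lborel borel T = lborel"
proof -
  have lin: "linear T" using T by (rule orthogonal_transformation_linear)
  show Tm [measurable]: "T \<in> borel_measurable borel"
    by (rule borel_measurable_continuous_onI) (use lin linear_continuous_on linear_conv_bounded_linear in blast)
  show "distr lborel borel T = lborel"
  proof (rule measure_eqI)
    fix A :: "'a set" assume "A \<in> sets (distr lborel borel T)"
    then have A [measurable]: "A \<in> sets borel" by simp
    have "emeasure (distr lborel borel T) A = (\<integral>\<^sup>+x. indicator A x \<partial>distr lborel borel T)" by simp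
    also have "\<dots> = (\<integral>\<^sup>+x. indicator A (T x) \<partial>lborel)" by (rule nn_integral_distr) auto
    also have "\<dots> = emeasure lborel A" by (subst nn_integral_orthogonal[OF T]) auto
    finally show "emeasure (distr lborel borel T) A = emeasure lborel A" .
  qed simp
qed

text \<open>Radiality holds off a null set only, and that set has to be carried along by
  \<open>T\<close>; hence the measure preservation just proved.\<close>

lemma radial_orthogonal_invariant:
  fixes u :: "'a::euclidean_space \<Rightarrow> real" and T :: "'a \<Rightarrow> 'a"
  assumes u: "radial u" and T: "orthogonal_transformation T"
  shows "AE x in lborel. u (T x) = u x"
proof -
  obtain g where g: "AE x in lborel. u x = g (norm x)" using u by (auto simp: radial_def)
  have "AE x in lborel. u (T x) = g (norm (T x))"
    by (rule AE_lborel_distr[OF distr_lborel_orthogonal[OF T] g])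
  with g show ?thesis
    by eventually_elim (simp add: orthogonal_transformation_norm[OF T])
qed

lemma radial_comp: "radial u \<Longrightarrow> radial (\<lambda>x. f (u x))"
  unfolding radial_def by (elim exE, rule_tac x = "\<lambda>t. f (g t)" in exI) (auto elim: eventually_mono)

text \<open>The annulus has width 1, so after a rotation aligning \<open>x\<close> with \<open>x'\<close> the unit ball around \<open>x\<close>
  lies in the ball of radius 2 around \<open>x'\<close>.\<close>

lemma radial_ball_mass:
  fixes a :: "real ^ 'n \<Rightarrow> real"
  assumes a: "radial a" and [measurable]: "a \<in> borel_measurable borel" and R: "0 < R"
    and x: "x \<in> annulus R" and x': "x' \<in> annulus R"
  shows "(\<integral>\<^sup>+y. ennreal (a y) * indicator (ball x 1) y \<partial>lborel) \<le> (\<integral>\<^sup>+y. ennreal (a y) * indicator (ball x' 2) y \<partial>lborel)"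
proof -
  \<comment> \<open>The point in the direction of \<open>x'\<close> with the norm of
    \<open>x\<close>. A rotation takes it to \<open>x\<close>, and its distance from
    \<open>x'\<close> is the difference of the two norms, below 1.\<close>
  define z where "z = (norm x / norm x') *\<^sub>R x'"
  have nx': "norm x' > 0" using x' R by (auto simp: annulus_def intro: less_trans)
  have nz: "norm z = norm x" using nx' by (simp add: z_def)
  obtain T where T: "orthogonal_transformation T" "T z = x" using orthogonal_transformation_exists[OF nz] by blast
  have [measurable]: "T \<in> borel_measurable borel" by (rule distr_lborel_orthogonal(1)[OF T(1)])
  have [measurable]: "ball w c \<in> sets borel" for w :: "real ^ 'n" and c by simp
  have "(\<integral>\<^sup>+y. ennreal (a y) * indicator (ball x 1) y \<partial>lborel) = (\<integral>\<^sup>+y. ennreal (a y) * indicator (ball x 1) y \<partial>distr lborel borel T)"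
    by (simp add: distr_lborel_orthogonal(2)[OF T(1)])
  also have "\<dots> = (\<integral>\<^sup>+y. ennreal (a (T y)) * indicator (ball x 1) (T y) \<partial>lborel)"
    by (rule nn_integral_distr) auto
  also have "\<dots> \<le> (\<integral>\<^sup>+y. ennreal (a y) * indicator (ball x' 2) y \<partial>lborel)"
  proof (rule nn_integral_mono_AE)
    show "AE y in lborel. ennreal (a (T y)) * indicator (ball x 1) (T y) \<le> ennreal (a y) * indicator (ball x' 2) y"
      using radial_orthogonal_invariant[OF a T(1)]
    proof eventually_elim
      fix y assume y: "a (T y) = a y"
      show "ennreal (a (T y)) * indicator (ball x 1) (T y) \<le> ennreal (a y) * indicator (ball x' 2) y"
      proof (cases "T y \<in> ball x 1")
        case True
        have "dist x (T y) = dist z y" using orthogonal_transformation_isometry[of T] T by metis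
        then have zy: "dist z y < 1" using True by simp
        have "x' - z = (1 - norm x / norm x') *\<^sub>R x'" by (simp add: z_def algebra_simps)
        then have "dist x' z = \<bar>1 - norm x / norm x'\<bar> * norm x'" by (simp add: dist_norm)
        also have "\<dots> = \<bar>(1 - norm x / norm x') * norm x'\<bar>" by (simp add: abs_mult)
        also have "(1 - norm x / norm x') * norm x' = norm x' - norm x" using nx' by (simp add: field_simps)
        finally have "dist x' z = \<bar>norm x' - norm x\<bar>" .
        moreover have "\<bar>norm x' - norm x\<bar> < 1" using x x' unfolding annulus_def mem_Collect_eq by linarith
        ultimately have "dist x' z < 1" by linarith
        then have "y \<in> ball x' 2" using zy dist_triangle[of x' y z] by simp
        then show ?thesis using True y by simp
      qed simp
    qed
  qed
  finally show ?thesis .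
qed

lemma frac_annulus_annulus:
  assumes "0 < s" "s < 1" "2 \<le> DIM('a::euclidean_space)" "0 < R"
  shows "frac_annulus TYPE('a) s R"
proof
  have "annulus R \<subseteq> ball (0::'a) (R + 1)" by (auto simp: annulus_def)
  then show "bounded (annulus R :: 'a set)" using bounded_ball bounded_subset by blast
  show "(annulus R :: 'a set) \<in> sets borel" unfolding annulus_def by measurable
qed (use assms in \<open>auto simp: annulus_def\<close>)

section \<open>Combination of the one-signed and the sign-changing case\<close>

context frac_domain
begin

text \<open>Changing the sign of \<open>u\<close> exchanges its positive and negative parts, which
  justifies ordering their norms.\<close>

lemma weak_solution_uminus:
  assumes "weak_solution s \<Omega> \<nu> u"
  shows "weak_solution s \<Omega> \<nu> (\<lambda>x. - u x)"
proof -
  have u: "u \<in> H" "\<And>v. v \<in> H \<Longrightarrow> cst * en s u v = \<nu> * ip u v" using assms by (auto simp: weak_solution_iff)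
  have "(\<lambda>x. -1 * u x) \<in> H" by (rule H_cmult[OF u(1)])
  moreover have "cst * en s (\<lambda>x. -1 * u x) v = \<nu> * ip (\<lambda>x. -1 * u x) v" if "v \<in> H" for v
    unfolding en_cmult_left ip_cmult_left using u(2)[OF that] by simp
  ultimately have "weak_solution s \<Omega> \<nu> (\<lambda>x. -1 * u x)" unfolding weak_solution_iff by blast
  then show ?thesis by simp
qed

end

text \<open>The locale is interpreted for one \<open>R\<close>, while the constants are
  characterised without reference to \<open>R\<close>; this is what permits a threshold
  \<open>R0\<close> uniform in all larger radii.\<close>

lemma radial_second_eigenfunction_bound:
  fixes u :: "real ^ 'n \<Rightarrow> real" and s \<Lambda> r K R :: real
  assumes s: "0 < s" "s < 1" and dim: "2 \<le> CARD('n)" and R: "0 < R"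
    and u: "second_eigenfunction s (annulus R) u" "radial u"
    and \<Lambda>: "\<Lambda> = (4 * energy s (bump (0 :: real ^ 'n)) + 1) / (LINT x|lborel. bump (0 :: real ^ 'n) x * bump 0 x)"
    and r: "0 < r" "r \<le> 1" and rs: "r powr (2 * s) * \<Lambda> \<le> unit_ball_vol (real CARD('n))"
    and K: "\<And>\<rho>. \<rho> > 0 \<Longrightarrow> (\<integral>\<^sup>+z. ennreal (norm z ^ 2 * kern s (z :: real ^ 'n)) * indicator (cball 0 \<rho>) z \<partial>lborel) \<le> ennreal (K * \<rho> powr (2 - 2 * s))"
    and k: "k = 2 powr (- (real CARD('n) + 2 * s)) * (unit_ball_vol (real CARD('n)) * r ^ CARD('n)) / 2"
    and K0: "0 < K"
  shows "R\<^sup>2 * k \<le> K * (2 * R + 2) powr (2 - 2 * s)"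
proof -
  interpret A: frac_annulus s R "TYPE(real ^ 'n)" by (rule frac_annulus_annulus) (use s dim R in auto)
  let ?l = "eigenvalue 2 s (annulus R :: (real ^ 'n) set)"
  have w: "weak_solution s (annulus R) ?l u" and nt: "nontrivial u" using u(1) by (auto simp: second_eigenfunction_def)
  have uH: "u \<in> A.H" using w by (simp add: weak_solution_def)
  have w': "weak_solution s (annulus R) ?l (\<lambda>x. - u x)" by (rule A.weak_solution_uminus[OF w])
  have even: "A.even_fn a" if "radial a" for a :: "real ^ 'n \<Rightarrow> real"
    unfolding A.even_fn_def
    by (rule radial_orthogonal_invariant[OF that]) (simp add: orthogonal_transformation_neg)
  obtain f where f: "f \<in> A.H" "A.odd_fn f" "(LINT x|lborel. bump (0 :: real ^ 'n) x * bump 0 x) \<le> A.sqnorm f"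
    using A.odd_test_function by blast
  have fpos: "A.sqnorm f > 0" using f(3) bump_integral_pos(2)[where 'a = "real ^ 'n"] by linarith
  have ne: "A.spec2 \<noteq> {}" using A.odd_Rayleigh_spec2[OF f(1,2) fpos] by blast
  \<comment> \<open>A radial function is even, so the odd test function is orthogonal to it and can
    serve as the competitor for \<open>one_signed_eigenfunction\<close>. The result would be that
    the second eigenvalue is below itself.\<close>
  have one: False if v: "weak_solution s (annulus R) ?l v" "nontrivial v" "radial v" "AE x in lborel. 0 \<le> v x" for v :: "real ^ 'n \<Rightarrow> real"
  proof -
    have vH: "v \<in> A.H" using v(1) by (simp add: weak_solution_def)
    have "A.ip f v = 0" by (rule A.odd_even_orthogonal(1)[OF f(1,2) vH even[OF v(3)]])
    from A.one_signed_eigenfunction[OF v(1,2,4) f(1) this fpos ne] show False by simp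
  qed
  define p where "p x = max 0 (u x)" for x
  define q where "q x = max 0 (- u x)" for x
  have pr: "radial p" and qr: "radial q"
    unfolding p_def[abs_def] q_def[abs_def] by (rule radial_comp[OF u(2)])+
  have pH: "p \<in> A.H" unfolding p_def[abs_def] by (rule A.H_pos_part[OF uH])
  have qH: "q \<in> A.H" unfolding q_def[abs_def] using A.H_pos_part[OF A.H_cmult[OF uH, of "-1"]] by simp
  have upq: "u = (\<lambda>x. p x - q x)" "(\<lambda>x. - u x) = (\<lambda>x. q x - p x)" by (auto simp: p_def q_def max_def)
  have pq: "AE x in lborel. p x * q x = 0" and qp: "AE x in lborel. q x * p x = 0" by (auto simp: p_def q_def max_def)
  have p0: "0 \<le> p x" and q0: "0 \<le> q x" for x by (simp_all add: p_def q_def)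
  have ppos: "0 < A.sqnorm p"
  proof (rule ccontr)
    assume "\<not> 0 < A.sqnorm p"
    then have "A.sqnorm p = 0" using A.ip_nonneg[of p] by linarith
    then have "AE x in lborel. p x = 0" using A.ip_eq_0_iff[OF pH] by blast
    then have "AE x in lborel. 0 \<le> - u x" by (rule eventually_mono) (auto simp: p_def max_def split: if_splits)
    moreover have "nontrivial (\<lambda>x. - u x)" using nt by (simp add: nontrivial_def)
    ultimately show False using one[OF w' _ radial_comp[OF u(2)]] by blast
  qed
  have qpos: "0 < A.sqnorm q"
  proof (rule ccontr)
    assume "\<not> 0 < A.sqnorm q"
    then have "A.sqnorm q = 0" using A.ip_nonneg[of q] by linarith
    then have "AE x in lborel. q x = 0" using A.ip_eq_0_iff[OF qH] by blast
    then have "AE x in lborel. 0 \<le> u x" by (rule eventually_mono) (auto simp: q_def max_def split: if_splits)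
    then show False using one[OF w nt u(2)] by blast
  qed
  have spread: "(\<integral>\<^sup>+y. ennreal (a y) * indicator (ball x 1) y \<partial>lborel) \<le> (\<integral>\<^sup>+y. ennreal (a y) * indicator (ball x' 2) y \<partial>lborel)"
    if "a \<in> {p, q}" "x \<in> annulus R" "x' \<in> annulus R" for a x x'
    by (rule radial_ball_mass[OF _ _ R that(2,3)]) (use that(1) pr qr A.H_measurable[OF pH] A.H_measurable[OF qH] in auto)
  have \<Lambda>': "?l \<le> A.cst * \<Lambda>" unfolding \<Lambda> by (rule A.eigenvalue_2_bound)
  have dimn: "DIM(real ^ 'n) = CARD('n)" by simp
  show ?thesis
  proof (cases "A.sqnorm p \<le> A.sqnorm q")
    case True
    show ?thesis
      by (rule A.sign_changing_bound[of p q \<Lambda> r K k, unfolded dimn])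
         (use pH p0 even[OF pr] qH q0 pq w upq(1) True ppos \<Lambda>' r rs K spread k K0 in auto)
  next
    case False
    then have le: "A.sqnorm q \<le> A.sqnorm p" by simp
    show ?thesis
      by (rule A.sign_changing_bound[of q p \<Lambda> r K k, unfolded dimn])
         (use pH p0 even[OF qr] qH q0 qp w' upq(2) le qpos \<Lambda>' r rs K spread k K0 in auto)
  qed
qed

theorem theorem1p1:
  fixes s :: real
  assumes "CARD('n::finite) \<ge> 2" and "0 < s" and "s < 1"
  shows "\<exists>R0>0. \<forall>R\<ge>R0. \<forall>u :: real ^ 'n \<Rightarrow> real.
    second_eigenfunction s (annulus R) u \<longrightarrow> \<not> radial u"
proof -
  define \<Lambda> where "\<Lambda> = (4 * energy s (bump (0 :: real ^ 'n)) + 1) / (LINT x|lborel. bump (0 :: real ^ 'n) x * bump 0 x)"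
  define w where "w = unit_ball_vol (real CARD('n))"
  have w: "w > 0" by (simp add: w_def)
  have \<Lambda>pos: "\<Lambda> > 0"
    unfolding \<Lambda>_def using en_nonneg[of s "bump (0 :: real ^ 'n)"] bump_integral_pos(2)[where 'a = "real ^ 'n"]
    by (intro divide_pos_pos) auto
  \<comment> \<open>The second entry is where \<open>r powr (2 * s) * \<Lambda>\<close> equals
    \<open>w\<close>; the minimum with 1 makes balls of radius \<open>r\<close> fit into unit
    balls.\<close>
  define r where "r = min 1 ((w / \<Lambda>) powr (1 / (2 * s)))"
  have r: "0 < r" "r \<le> 1" using w \<Lambda>pos by (auto simp: r_def)
  have rs: "r powr (2 * s) * \<Lambda> \<le> w"
  proof -
    have "r powr (2 * s) \<le> ((w / \<Lambda>) powr (1 / (2 * s))) powr (2 * s)"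
      using r assms by (intro powr_mono2) (auto simp: r_def)
    also have "\<dots> = w / \<Lambda>" using assms w \<Lambda>pos by (simp add: powr_powr)
    finally show ?thesis using \<Lambda>pos by (simp add: field_simps)
  qed
  define k where "k = 2 powr (- (real CARD('n) + 2 * s)) * (w * r ^ CARD('n)) / 2"
  have kpos: "k > 0" using w r by (simp add: k_def)
  obtain K where K: "K > 0" "\<And>\<rho>. \<rho> > 0 \<Longrightarrow>
      (\<integral>\<^sup>+z. ennreal (norm z ^ 2 * kern s (z :: real ^ 'n)) * indicator (cball 0 \<rho>) z \<partial>lborel) \<le> ennreal (K * \<rho> powr (2 - 2 * s))"
    using nn_integral_norm_square_kern[of s, where 'a = "real ^ 'n"] assms by auto
  \<comment> \<open>The bound forces \<open>R powr (2 * s) \<le> 16 * K / k\<close>, where 16 is an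
    upper bound for \<open>4 powr (2 - 2 * s)\<close>; the added 1 makes the violation strict. The 1
    inside the maximum gives \<open>2 * R + 2 \<le> 4 * R\<close>.\<close>
  define R0 where "R0 = max 1 ((16 * K / k + 1) powr (1 / (2 * s)))"
  have "\<not> radial u" if R: "R \<ge> R0" and u: "second_eigenfunction s (annulus R) u" for R and u :: "real ^ 'n \<Rightarrow> real"
  proof
    assume rad: "radial u"
    have R1: "R \<ge> 1" using R by (simp add: R0_def)
    have "R\<^sup>2 * k \<le> K * (2 * R + 2) powr (2 - 2 * s)"
      by (rule radial_second_eigenfunction_bound[OF assms(2,3,1) _ u rad \<Lambda>_def r rs[unfolded w_def] K(2) k_def[unfolded w_def] K(1)]) (use R1 in auto)
    also have "\<dots> \<le> K * (4 * R) powr (2 - 2 * s)"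
      using K(1) R1 assms by (intro mult_left_mono powr_mono2) auto
    also have "(4 * R) powr (2 - 2 * s) = 4 powr (2 - 2 * s) * R powr (2 - 2 * s)" using R1 by (simp add: powr_mult)
    also have "K * (4 powr (2 - 2 * s) * R powr (2 - 2 * s)) \<le> K * (16 * R powr (2 - 2 * s))"
    proof -
      have "(4::real) powr (2 - 2 * s) \<le> 4 powr 2" using assms by (intro powr_mono) auto
      then have "(4::real) powr (2 - 2 * s) \<le> 16" by simp
      then show ?thesis using K(1) by (intro mult_left_mono mult_right_mono) auto
    qed
    also have "R powr (2 - 2 * s) = R\<^sup>2 / R powr (2 * s)" using R1 by (simp add: powr_diff)
    finally have "R\<^sup>2 * k \<le> R\<^sup>2 * (16 * K / R powr (2 * s))" by (simp add: mult_ac)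
    then have "k \<le> 16 * K / R powr (2 * s)" by (rule mult_left_le_imp_le) (use R1 in simp)
    then have "R powr (2 * s) \<le> 16 * K / k" using R1 kpos by (simp add: field_simps)
    moreover have "16 * K / k + 1 \<le> R powr (2 * s)"
    proof -
      have "16 * K / k + 1 = ((16 * K / k + 1) powr (1 / (2 * s))) powr (2 * s)"
        using assms K(1) kpos by (simp add: powr_powr add_pos_pos)
      also have "\<dots> \<le> R powr (2 * s)" using R assms by (intro powr_mono2) (auto simp: R0_def)
      finally show ?thesis .
    qed
    ultimately show False by linarith
  qed
  then show ?thesis by (intro exI[of _ R0]) (auto simp: R0_def)
qed

end
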